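(* Suppose that nonpolynomial entire functions $f_j:\mathbb C\to\mathbb C$, $1\le j\le m$, of class $\mathscr C$ are such that $\rho_{f_1}\le\cdots\le\rho_{f_m}$ and, for $j\in\{1,\dots,m-1\}$, $$\lim_{r\to\infty}\frac{m_{f_j}(r)-m_{f_j}\left(\frac re\right)}{\sqrt{m_{f_{j+1}}(r)-m_{f_{j+1}}\left(\frac re\right)}}=0\qquad\text{if }\rho_{f_{j+1}}<\infty,$$ and $$\limsup_{r\to\infty}\frac{\ln m_{f_j}(r)}{\ln m_{f_{j+1}}\left(\frac re\right)}<\frac12\qquad\text{if }\rho_{f_j}=\infty.$$ Then for $f=(f_1,\dots,f_m):\mathbb C\to\mathbb C^m$ its graph $\Gamma_f\subset\mathbb C^{m+1}$ admits the Bernstein type inequality of exponent $\mu(k):=k^{2^m+\varepsilon(k)}$, $k\in\mathbb Z_+$, for some $\varepsilon:\mathbb Z_+\to\mathbb R_+$ decreasing to zero. Here $\varepsilon=0$ if all $\rho_{f_j}<\infty$.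
   Context: $\mathbb Z_+=\{0,1,2,\dots\}$, $\mathbb R_+=[0,\infty)$; $\mathbb B^n_r\subset\mathbb C^n$ is the open Euclidean ball of radius $r$ centered at $0$. For an entire function $f$ on $\mathbb C^n$: $M_f(r):=\sup_{\mathbb B^n_r}|f|$, $m_f(r):=\ln M_f(r)$, the order is $\rho_f:=\limsup_{r\to\infty}\frac{\ln m_f(r)}{\ln r}$, and $\phi_f(t):=m_f(e^t)$, $t\in\mathbb R$. Class $\mathscr C$ consists of the nonpolynomial entire functions $f$ satisfying one of the following: (I) $\rho_f<\infty$ and $\limsup_{t\to\infty}\frac{\phi_f(t+1)-\phi_f(t)}{\phi_f(t)-\phi_f(t-1)}<\infty$; (II) $\rho_f=\infty$ and $\lim_{t\to\infty}t^2\left(\frac1{\ln\psi(t)}\right)'=0$ (limit over the points where $\psi'$ exists) for some convex increasing $\psi\in C(\mathbb R)$ with $\lim_{t\to\infty}\frac{\ln\psi(t)}{\ln\phi_f(t)}=1$. The graph $\Gamma_f=\{(z,f(z)):z\in\mathbb C\}\subset\mathbb C^{m+1}$ of a holomorphic map $f:\mathbb C\to\mathbb C^m$ admits the Bernstein type inequality of exponent $\mu:\mathbb Z_+\to\mathbb R_+$ if for each $r>0$ there is a nonnegative constant $C(r)$ such that for all holomorphic polynomials $p$ on $\mathbb C^{m+1}$, $\max_{|z|\le er}|p(z,f(z))|\le C(r)^{\mu(\deg p)}\max_{|z|\le r}|p(z,f(z))|$. *)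

theory Defs
  imports "HOL-Complex_Analysis.Complex_Analysis" "HOL-Library.Poly_Mapping"
begin

definition max_modulus :: "(complex \<Rightarrow> complex) \<Rightarrow> real \<Rightarrow> real" where
  "max_modulus f r = (SUP z\<in>ball 0 r. norm (f z))"

definition log_max_modulus :: "(complex \<Rightarrow> complex) \<Rightarrow> real \<Rightarrow> real" where
  "log_max_modulus f r = ln (max_modulus f r)"

definition growth_order :: "(complex \<Rightarrow> complex) \<Rightarrow> ereal" where
  "growth_order f = Limsup at_top (\<lambda>r. ereal (ln (log_max_modulus f r) / ln r))"

definition growth_phi :: "(complex \<Rightarrow> complex) \<Rightarrow> real \<Rightarrow> real" where
  "growth_phi f t = log_max_modulus f (exp t)"

definition entire_nonpolynomial :: "(complex \<Rightarrow> complex) \<Rightarrow> bool" where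
  "entire_nonpolynomial f \<longleftrightarrow> f holomorphic_on UNIV \<and> (\<nexists>p :: complex poly. f = poly p)"

definition class_I :: "(complex \<Rightarrow> complex) \<Rightarrow> bool" where
  "class_I f \<longleftrightarrow> growth_order f < \<infinity> \<and>
     Limsup at_top (\<lambda>t. ereal ((growth_phi f (t + 1) - growth_phi f t) /
                                (growth_phi f t - growth_phi f (t - 1)))) < \<infinity>"

(* The filter of the last limit expresses t \<rightarrow> \<infinity> along the set where \<psi> has a derivative.
   As \<psi> is convex, that set has countable complement. *)
definition class_II :: "(complex \<Rightarrow> complex) \<Rightarrow> bool" where
  "class_II f \<longleftrightarrow> growth_order f = \<infinity> \<and>
     (\<exists>\<psi> :: real \<Rightarrow> real. convex_on UNIV \<psi> \<and> mono \<psi> \<and> continuous_on UNIV \<psi> \<and>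
        ((\<lambda>t. ln (\<psi> t) / ln (growth_phi f t)) \<longlongrightarrow> 1) at_top \<and>
        ((\<lambda>t. t\<^sup>2 * deriv (\<lambda>s. 1 / ln (\<psi> s)) t) \<longlongrightarrow> 0)
           (inf at_top (principal {t. \<psi> differentiable (at t)})))"

definition class_C :: "(complex \<Rightarrow> complex) set" where
  "class_C = {f. entire_nonpolynomial f \<and> (class_I f \<or> class_II f)}"

(* Complex polynomials in variables indexed by nat: finitely supported maps from
   exponent vectors (monomials) to coefficients. *)
type_synonym cpoly = "(nat \<Rightarrow>\<^sub>0 nat) \<Rightarrow>\<^sub>0 complex"

(* The polynomials on \<complex>^n, with coordinates indexed by 0, ..., n - 1. *)
definition polynomials_on :: "nat \<Rightarrow> cpoly set" where
  "polynomials_on n = {p. \<forall>s\<in>Poly_Mapping.keys p. Poly_Mapping.keys s \<subseteq> {..<n}}"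

(* Total degree; the zero polynomial gets degree 0. *)
definition total_deg :: "cpoly \<Rightarrow> nat" where
  "total_deg p = Max (insert 0 ((\<lambda>s. \<Sum>i\<in>Poly_Mapping.keys s. Poly_Mapping.lookup s i) `
                                  Poly_Mapping.keys p))"

definition eval_poly_at :: "cpoly \<Rightarrow> (nat \<Rightarrow> complex) \<Rightarrow> complex" where
  "eval_poly_at p w = (\<Sum>s\<in>Poly_Mapping.keys p. Poly_Mapping.lookup p s *
                        (\<Prod>i\<in>Poly_Mapping.keys s. w i ^ Poly_Mapping.lookup s i))"

(* The point (z, f_1(z), ..., f_m(z)) of the graph: coordinate 0 is z, coordinate j is f_j(z).
   Coordinates beyond m are not seen by polynomials on \<complex>^(m + 1). *)
definition graph_point :: "(nat \<Rightarrow> complex \<Rightarrow> complex) \<Rightarrow> complex \<Rightarrow> nat \<Rightarrow> complex" where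
  "graph_point f z i = (if i = 0 then z else f i z)"

(* For holomorphic f_1, ..., f_m both suprema are maxima, the discs being compact.
   Isabelle has 0 powr 0 = 0, but C = 0 is excluded under either convention for 0^0: with
   0 powr 0 = 0 by p = 1, and with 0^0 = 1 by the polynomial z if \<mu> 1 > 0. *)
definition graph_bernstein :: "nat \<Rightarrow> (nat \<Rightarrow> complex \<Rightarrow> complex) \<Rightarrow> (nat \<Rightarrow> real) \<Rightarrow> bool" where
  "graph_bernstein m f \<mu> \<longleftrightarrow>
     (\<forall>r>0. \<exists>C\<ge>0. \<forall>p\<in>polynomials_on (m + 1).
        (SUP z\<in>cball 0 (exp 1 * r). norm (eval_poly_at p (graph_point f z)))
          \<le> C powr \<mu> (total_deg p) *
             (SUP z\<in>cball 0 r. norm (eval_poly_at p (graph_point f z))))"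

end

theory Submission
  imports Defs "HOL-Real_Asymp.Real_Asymp"
begin

text \<open>Write a polynomial restricted to the graph as \<open>F = \<Sum>i\<le>k. g i * h ^ i\<close> with \<open>h = f m\<close> and
  \<open>g i\<close> polynomials in \<open>z, f 1, \<dots>, f (m - 1)\<close>, and let \<open>\<phi> t\<close> be the logarithm of the maximum of
  \<open>\<bar>h\<bar>\<close> on the disc of radius \<open>exp t\<close>. The key estimate bounds the \<open>g i\<close> by \<open>F\<close> without counting
  zeros. Let \<open>\<rho>\<close> be the maximum of \<open>\<bar>h\<bar>\<close> on a disc. The Horner tails \<open>Q\<close> of the sum satisfy
  \<open>\<bar>Q\<bar> * max \<rho> \<bar>h\<bar> \<le> A\<close> on a larger circle, where \<open>A\<close> is controlled by \<open>F\<close> and the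
  \<open>g i\<close>; since \<open>max \<rho> \<bar>h\<bar>\<close> is much larger than \<open>\<rho>\<close> on average over that circle, \<open>Q\<close> is smaller
  than \<open>A / \<rho>\<close> on the disc by a factor \<open>exp (- c * n)\<close>, where \<open>n\<close> is an increment of \<open>\<phi>\<close>.
  If \<open>n\<close> exceeds the growth of the \<open>g i\<close>, which is bounded by induction on \<open>m\<close>, the factor
  absorbs the \<open>g i\<close> in \<open>A\<close>, and the growth of \<open>F\<close> is at most about \<open>k\<close> times that of \<open>\<phi>\<close>. By Hadamard's three circles theorem it suffices to
  have this at one large radius. For finite order a radius with \<open>n\<close> comparable to \<open>k ^ m\<close> is chosen,
  the doubling condition on \<open>\<phi>\<close> making unit steps in \<open>t\<close> admissible; for infinite order \<open>\<phi> t\<close> is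
  close to \<open>k ^ m\<close> and the steps in \<open>t\<close> have length comparable to \<open>1 / ln (\<phi> t)\<close>. In both cases the
  exponent grows by one per function, so \<open>m + 1 \<le> 2 ^ m\<close> is reached.\<close>

section \<open>Maximum modulus on discs\<close>

text \<open>The closed disc makes the supremum a maximum and is the set used in
  \<open>graph_bernstein\<close>. For positive radii the open ball of \<open>max_modulus\<close>
  gives the same number, see \<open>max_modulus_eq_disc_max\<close>.\<close>

definition disc_max :: "(complex \<Rightarrow> complex) \<Rightarrow> real \<Rightarrow> real" where
  "disc_max F r = (SUP z\<in>cball 0 r. norm (F z))"

lemma entire_continuous_on: "F holomorphic_on UNIV \<Longrightarrow> continuous_on A F"
  by (meson continuous_on_subset holomorphic_on_imp_continuous_on top_greatest)

lemma bdd_above_disc: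
  assumes "F holomorphic_on UNIV"
  shows "bdd_above ((\<lambda>z. norm (F z)) ` cball 0 r)"
proof -
  have "compact ((\<lambda>z. norm (F z)) ` cball 0 r)"
    by (intro compact_continuous_image continuous_on_norm entire_continuous_on assms compact_cball)
  then show ?thesis
    by (simp add: bounded_imp_bdd_above compact_imp_bounded)
qed

lemma norm_le_disc_max:
  assumes "F holomorphic_on UNIV" "norm z \<le> r"
  shows "norm (F z) \<le> disc_max F r"
  unfolding disc_max_def using assms by (intro cSUP_upper bdd_above_disc) auto

lemma disc_max_leI:
  assumes "r \<ge> 0" "\<And>z. norm z \<le> r \<Longrightarrow> norm (F z) \<le> B"
  shows "disc_max F r \<le> B"
  unfolding disc_max_def using assms by (intro cSUP_least) auto

lemma disc_max_nonneg:
  assumes "F holomorphic_on UNIV" "r \<ge> 0"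
  shows "0 \<le> disc_max F r"
  using norm_le_disc_max[OF assms(1), of 0 r] assms(2) norm_ge_zero[of "F 0"]
  by (metis norm_zero order_trans)

lemma disc_max_mono:
  assumes "F holomorphic_on UNIV" "0 \<le> r" "r \<le> s"
  shows "disc_max F r \<le> disc_max F s"
  by (rule disc_max_leI) (use assms in \<open>auto intro!: norm_le_disc_max\<close>)

lemma max_modulus_principle_disc:
  assumes "F holomorphic_on UNIV" "r > 0" "\<And>z. norm z = r \<Longrightarrow> norm (F z) \<le> B" "norm z \<le> r"
  shows "norm (F z) \<le> B"
proof (rule maximum_modulus_frontier[where S = "cball 0 r" and f = F and \<xi> = z])
  show "F holomorphic_on interior (cball 0 r)"
    using assms(1) holomorphic_on_subset by blast
  show "continuous_on (closure (cball 0 r)) F"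
    by (rule entire_continuous_on[OF assms(1)])
qed (use assms in auto)

text \<open>The maximum principle moves the maximum point to the circle. Its exact modulus is needed
  later, to take logarithms and inverses of that point.\<close>

lemma disc_max_attained:
  assumes "F holomorphic_on UNIV" "r > 0"
  obtains z where "norm z = r" "norm (F z) = disc_max F r"
proof -
  have ne: "sphere (0::complex) r \<noteq> {}"
    using assms(2) by simp
  have cont: "continuous_on (sphere 0 r) (\<lambda>z. norm (F z))"
    by (intro continuous_on_norm entire_continuous_on assms)
  obtain z where z: "z \<in> sphere 0 r" "\<forall>w\<in>sphere 0 r. norm (F w) \<le> norm (F z)"
    using continuous_attains_sup[OF compact_sphere ne cont] by blast
  have "disc_max F r \<le> norm (F z)"
  proof (rule disc_max_leI)
    fix w :: complex assume w: "norm w \<le> r"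
    show "norm (F w) \<le> norm (F z)"
      by (rule max_modulus_principle_disc[OF assms(1,2) _ w]) (use z in auto)
  qed (use assms in auto)
  moreover have "norm (F z) \<le> disc_max F r"
    using z by (intro norm_le_disc_max assms) auto
  ultimately show ?thesis
    using that z by auto
qed

lemma max_modulus_eq_disc_max:
  assumes "F holomorphic_on UNIV" "r > 0"
  shows "max_modulus F r = disc_max F r"
proof (rule antisym)
  show "max_modulus F r \<le> disc_max F r"
    unfolding max_modulus_def
    using assms by (intro cSUP_least norm_le_disc_max) auto
  have bdd: "bdd_above ((\<lambda>z. norm (F z)) ` ball 0 r)"
    by (rule bdd_above_mono[OF bdd_above_disc[OF assms(1), of r]]) auto
  have ball: "norm (F z) \<le> max_modulus F r" if "z \<in> ball 0 r" for z
    unfolding max_modulus_def using that by (intro cSUP_upper bdd)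
  show "disc_max F r \<le> max_modulus F r"
  proof (rule disc_max_leI)
    fix z :: complex assume "norm z \<le> r"
    then have "z \<in> closure (ball 0 r)"
      using assms(2) by simp
    moreover have "continuous_on (closure (ball 0 r)) (\<lambda>z. norm (F z))"
      by (intro continuous_on_norm entire_continuous_on assms)
    ultimately show "norm (F z) \<le> max_modulus F r"
      using continuous_le_on_closure[of "ball 0 r" "\<lambda>z. norm (F z)" z "max_modulus F r"] ball
      by blast
  qed (use assms in auto)
qed

text \<open>By the identity theorem, a zero maximum on one disc would make \<open>F\<close> vanish
  everywhere.\<close>

lemma disc_max_pos:
  assumes "F holomorphic_on UNIV" "F z0 \<noteq> 0" "r > 0"
  shows "disc_max F r > 0"
proof (rule ccontr)
  assume "\<not> disc_max F r > 0"
  then have z: "F z = 0" if "norm z \<le> r" for z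
    using norm_le_disc_max[OF assms(1) that] by (smt (verit) norm_le_zero_iff)
  have "F z0 = 0"
  proof (rule analytic_continuation_open[where s = "ball 0 r" and s' = UNIV and f = F and g = "\<lambda>_. 0"])
    show "ball 0 r \<noteq> ({}::complex set)" using assms(3) by auto
  qed (use assms z in \<open>auto intro: connected_UNIV\<close>)
  then show False using assms by simp
qed

section \<open>Convexity of the logarithm of the maximum modulus\<close>

text \<open>Pulling back by the exponential makes \<open>z \<mapsto> z powr \<alpha>\<close> single valued; the
  \<open>2 * pi\<close>-periodicity of the modulus replaces boundedness of the strip.\<close>

lemma three_circles_weighted:
  assumes F: "F holomorphic_on UNIV" and ab: "a \<le> t" "t \<le> b"
    and a: "disc_max F (exp a) * exp (\<alpha> * a) \<le> B"
    and b: "disc_max F (exp b) * exp (\<alpha> * b) \<le> B"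
  shows "disc_max F (exp t) * exp (\<alpha> * t) \<le> B"
proof -
  define G where "G = (\<lambda>\<zeta>. F (exp \<zeta>) * exp (of_real \<alpha> * \<zeta>))"
  have holG: "G holomorphic_on UNIV"
  proof -
    have "F \<circ> exp holomorphic_on UNIV"
      by (rule holomorphic_on_compose_gen[OF holomorphic_on_exp F]) simp
    then have "(\<lambda>\<zeta>. F (exp \<zeta>)) holomorphic_on UNIV"
      by (simp add: o_def)
    then show ?thesis
      unfolding G_def by (rule holomorphic_on_mult) (intro holomorphic_intros)
  qed
  have normG: "norm (G \<zeta>) = norm (F (exp \<zeta>)) * exp (\<alpha> * Re \<zeta>)" for \<zeta>
    by (simp add: G_def norm_mult)
  have le_max: "norm (G \<zeta>) \<le> disc_max F (exp (Re \<zeta>)) * exp (\<alpha> * Re \<zeta>)" for \<zeta>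
    unfolding normG by (intro mult_right_mono norm_le_disc_max F) auto
  have per: "norm (G (\<zeta> + 2 * of_int n * of_real pi * \<i>)) = norm (G \<zeta>)" for \<zeta> n
  proof -
    have "exp (\<zeta> + 2 * of_int n * of_real pi * \<i>) = exp \<zeta>"
      by (subst exp_eq) auto
    then show ?thesis unfolding normG by simp
  qed
  have main: "norm (G \<zeta>) \<le> B" if "a \<le> Re \<zeta>" "Re \<zeta> \<le> b" for \<zeta>
  proof (rule ccontr)
    assume "\<not> norm (G \<zeta>) \<le> B"
    then have big: "norm (G \<zeta>) > B" by simp
    define K where "K = cbox (Complex a (- pi)) (Complex b pi)"
    have inK: "\<zeta> \<in> K \<longleftrightarrow> a \<le> Re \<zeta> \<and> Re \<zeta> \<le> b \<and> - pi \<le> Im \<zeta> \<and> Im \<zeta> \<le> pi" for \<zeta>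
      by (auto simp: K_def in_cbox_complex_iff)
    have red: "\<exists>\<xi>\<in>K. norm (G \<xi>) = norm (G \<zeta>) \<and> Re \<xi> = Re \<zeta>" if "a \<le> Re \<zeta>" "Re \<zeta> \<le> b" for \<zeta>
    proof -
      \<comment> \<open>Shifting by the nearest whole number of periods brings the imaginary part
        into the interval from \<open>- pi\<close> to \<open>pi\<close>, so the strip reduces to the
        compact rectangle \<open>K\<close>.\<close>
      define n where "n = - round (Im \<zeta> / (2 * pi))"
      have "\<bar>of_int (round (Im \<zeta> / (2 * pi))) - Im \<zeta> / (2 * pi)\<bar> \<le> 1 / 2"
        by (rule of_int_round_abs_le)
      then have "\<bar>of_int (round (Im \<zeta> / (2 * pi))) - Im \<zeta> / (2 * pi)\<bar> * (2 * pi) \<le> 1 / 2 * (2 * pi)"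
        by (rule mult_right_mono) auto
      then have "\<bar>(of_int (round (Im \<zeta> / (2 * pi))) - Im \<zeta> / (2 * pi)) * (2 * pi)\<bar> \<le> pi"
        by (simp add: abs_mult)
      then have "\<bar>of_int (round (Im \<zeta> / (2 * pi))) * (2 * pi) - Im \<zeta>\<bar> \<le> pi"
        by (simp add: algebra_simps)
      then have "\<bar>Im (\<zeta> + 2 * of_int n * of_real pi * \<i>)\<bar> \<le> pi"
        by (simp add: n_def algebra_simps)
      then show ?thesis
        using that by (intro bexI[of _ "\<zeta> + 2 * of_int n * of_real pi * \<i>"] conjI per)
          (auto simp: inK abs_le_iff)
    qed
    have K: "compact K" "K \<noteq> {}"
      using red[OF that] by (auto simp: K_def)
    have cont: "continuous_on K (\<lambda>z. norm (G z))"
      by (intro continuous_on_norm entire_continuous_on holG)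
    obtain \<xi> where \<xi>: "\<xi> \<in> K" "\<forall>w\<in>K. norm (G w) \<le> norm (G \<xi>)"
      using continuous_attains_sup[OF K cont] by blast
    have glob: "norm (G w) \<le> norm (G \<xi>)" if "a \<le> Re w" "Re w \<le> b" for w
      using red[OF that] \<xi>(2) by metis
    have \<xi>B: "norm (G \<xi>) > B"
      using glob[OF that] big by linarith
    have nb: "Re \<xi> \<noteq> a" "Re \<xi> \<noteq> b"
      using le_max[of \<xi>] a b \<xi>B by auto
    let ?S = "{w. a < Re w} \<inter> {w. Re w < b}"
    have \<xi>S: "\<xi> \<in> ?S"
      using nb \<xi>(1) inK by auto
    \<comment> \<open>An interior maximum makes \<open>G\<close> constant on the open strip.
      Continuity along the real segment extends the constant to the edge \<open>a\<close>, where the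
      modulus is at most \<open>B\<close>.\<close>
    have "G constant_on ?S"
    proof (rule maximum_modulus_principle[where U = ?S and \<xi> = \<xi>])
      show "G holomorphic_on ?S" using holG holomorphic_on_subset by blast
      show "open ?S" by (intro open_Int open_halfspace_Re_gt open_halfspace_Re_lt)
      then show "open ?S" .
      show "connected ?S"
        by (intro convex_connected convex_Int convex_halfspace_Re_gt convex_halfspace_Re_lt)
    qed (use \<xi>S glob in auto)
    then obtain c where c: "\<And>w. w \<in> ?S \<Longrightarrow> G w = c"
      by (auto simp: constant_on_def)
    have ab': "a < b" using \<xi>S by auto
    define L where "L = (\<lambda>s. G (of_real s))"
    have "continuous_on {a..b} L"
      unfolding L_def
      by (rule continuous_on_compose2[OF entire_continuous_on[OF holG, of UNIV]]) (auto intro: continuous_intros)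
    then have cont: "continuous_on (closure {a<..<b}) L"
      using ab' by simp
    have "L a = c"
      by (rule continuous_constant_on_closure[OF cont]) (use ab' c in \<open>auto simp: L_def\<close>)
    then have "G (of_real a) = G \<xi>"
      using c[OF \<xi>S] by (simp add: L_def)
    then show False
      using le_max[of "of_real a"] a \<xi>B by simp
  qed
  obtain z where z: "norm z = exp t" "norm (F z) = disc_max F (exp t)"
    using disc_max_attained[OF F, of "exp t"] by auto
  then have "z \<noteq> 0" by auto
  then have "exp (Ln z) = z" "Re (Ln z) = t"
    using z(1) by simp_all
  then show ?thesis
    using main[of "Ln z"] ab z by (simp add: normG)
qed

text \<open>The radius is \<open>exp t\<close>, so that Hadamard's theorem becomes convexity in
  \<open>t\<close>. For entire functions this is \<open>growth_phi\<close>.\<close>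

definition log_max :: "(complex \<Rightarrow> complex) \<Rightarrow> real \<Rightarrow> real" where
  "log_max F t = ln (disc_max F (exp t))"

lemma disc_max_exp:
  assumes "F holomorphic_on UNIV" "F z0 \<noteq> 0"
  shows "disc_max F (exp t) = exp (log_max F t)"
  unfolding log_max_def using disc_max_pos[OF assms, of "exp t"] by simp

lemma growth_phi_eq_log_max:
  assumes "F holomorphic_on UNIV"
  shows "growth_phi F t = log_max F t"
  using assms by (simp add: growth_phi_def log_max_modulus_def log_max_def max_modulus_eq_disc_max)

lemma log_max_chord:
  assumes F: "F holomorphic_on UNIV" "F z0 \<noteq> 0" and ab: "a \<le> t" "t \<le> b" "a < b"
  shows "log_max F t * (b - a) \<le> log_max F a * (b - t) + log_max F b * (t - a)"
proof -
  note e = disc_max_exp[OF F]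
  \<comment> \<open>Minus the slope of the chord: this weight makes the weighted maxima at
    \<open>a\<close> and \<open>b\<close> equal, so one bound serves both ends.\<close>
  define \<alpha> where "\<alpha> = - (log_max F b - log_max F a) / (b - a)"
  have \<alpha>: "\<alpha> * (b - a) = log_max F a - log_max F b"
    using ab by (simp add: \<alpha>_def field_simps)
  have "disc_max F (exp t) * exp (\<alpha> * t) \<le> exp (log_max F a + \<alpha> * a)"
  proof (rule three_circles_weighted[OF F(1) ab(1,2)])
    show "disc_max F (exp a) * exp (\<alpha> * a) \<le> exp (log_max F a + \<alpha> * a)"
      by (simp add: e exp_add)
    have "log_max F b + \<alpha> * b = log_max F a + \<alpha> * a"
      using \<alpha> by (simp add: algebra_simps)
    then show "disc_max F (exp b) * exp (\<alpha> * b) \<le> exp (log_max F a + \<alpha> * a)"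
      by (simp add: e flip: exp_add)
  qed
  then have "log_max F t + \<alpha> * t \<le> log_max F a + \<alpha> * a"
    by (simp add: e flip: exp_add)
  then have "(log_max F t - log_max F a) * (b - a) \<le> - (\<alpha> * (t - a)) * (b - a)"
    using ab by (intro mult_right_mono) (auto simp: algebra_simps)
  also have "\<dots> = (log_max F b - log_max F a) * (t - a)"
    using \<alpha> by (metis (no_types, opaque_lifting) minus_diff_eq minus_mult_left mult.assoc mult.commute)
  finally show ?thesis by (simp add: algebra_simps)
qed

lemma convex_log_max:
  assumes F: "F holomorphic_on UNIV" "F z0 \<noteq> 0"
  shows "convex_on UNIV (log_max F)"
proof (rule convex_onI)
  fix s x y :: real assume s: "0 < s" "s < 1"
  have *: "log_max F ((1 - s) * x + s * y) \<le> (1 - s) * log_max F x + s * log_max F y"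
    if "x < y" "0 < s" "s < 1" for s x y
  proof -
    let ?t = "(1 - s) * x + s * y"
    have t: "?t - x = s * (y - x)" "y - ?t = (1 - s) * (y - x)"
      by (simp_all add: algebra_simps)
    then have "x \<le> ?t" "?t \<le> y"
      using that by (smt (verit) mult_nonneg_nonneg)+
    from log_max_chord[OF F this that(1)] 
    have "log_max F ?t * (y - x) \<le> ((1 - s) * log_max F x + s * log_max F y) * (y - x)"
      unfolding t by (simp add: algebra_simps)
    then show ?thesis
      by (rule mult_right_le_imp_le) (use that in simp)
  qed
  have "x < y \<or> x = y \<or> y < x" by linarith
  then show "log_max F ((1 - s) *\<^sub>R x + s *\<^sub>R y) \<le> (1 - s) * log_max F x + s * log_max F y"
  proof (elim disjE)
    assume "y < x"
    then show ?thesis using *[of y x "1 - s"] s by (simp add: add.commute)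
  next
    assume "x < y"
    then show ?thesis using *[of x y s] s by simp
  next
    assume "x = y"
    then show ?thesis by (simp add: algebra_simps)
  qed
qed auto

lemma mono_log_max:
  assumes F: "F holomorphic_on UNIV" "F z0 \<noteq> 0" and "s \<le> t"
  shows "log_max F s \<le> log_max F t"
  unfolding log_max_def
  using disc_max_mono[OF F(1), of "exp s" "exp t"] disc_max_pos[OF F, of "exp s"] assms(3) by simp

text \<open>Slopes of chords increase, and the chord from \<open>a\<close> to \<open>d\<close>
  mediates between the two given ones. Products instead of quotients allow \<open>a = b\<close>; the
  intervals may overlap.\<close>

lemma convex_on_increments:
  fixes f :: "real \<Rightarrow> real"
  assumes f: "convex_on UNIV f" and "a \<le> b" "c < d" "b \<le> d" "a \<le> c"
  shows "(f b - f a) * (d - c) \<le> (f d - f c) * (b - a)"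
proof (cases "a = b")
  case False
  then have ab: "a < b" using assms by simp
  have ch: "(f y - f x) * (z - x) \<le> (f z - f x) * (y - x)"
    "(f z - f x) * (z - y) \<le> (f z - f y) * (z - x)" if "x \<le> y" "y \<le> z" "x < z" for x y z
  proof -
    define s where "s = (y - x) / (z - x)"
    have s: "0 \<le> s" "s \<le> 1" "s * (z - x) = y - x" using that by (auto simp: s_def divide_le_eq)
    then have y: "(1 - s) * x + s * z = y" by (simp add: algebra_simps)
    have "f ((1 - s) *\<^sub>R x + s *\<^sub>R z) \<le> (1 - s) * f x + s * f z"
      using s by (intro convex_onD[OF f]) auto
    then have "f y * (z - x) \<le> ((1 - s) * f x + s * f z) * (z - x)"
      using that y by (intro mult_right_mono) auto
    also have "\<dots> = f x * (z - x) + (f z - f x) * (s * (z - x))"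
      by (simp add: algebra_simps)
    finally have "f y * (z - x) \<le> f x * (z - x) + (f z - f x) * (y - x)"
      using s(3) by simp
    then show "(f y - f x) * (z - x) \<le> (f z - f x) * (y - x)"
      "(f z - f x) * (z - y) \<le> (f z - f y) * (z - x)"
      by (simp_all only: left_diff_distrib right_diff_distrib)
  qed
  have ad: "a < d" using ab assms by simp
  have 1: "(f b - f a) * (d - a) \<le> (f d - f a) * (b - a)" using ch(1)[of a b d] assms ab by simp
  have 2: "(f d - f a) * (d - c) \<le> (f d - f c) * (d - a)" using ch(2)[of a c d] assms ad by simp
  have "(f b - f a) * (d - a) * (d - c) \<le> (f d - f a) * (b - a) * (d - c)"
    using 1 assms by (intro mult_right_mono) auto
  also have "\<dots> = (f d - f a) * (d - c) * (b - a)" by (simp only: mult_ac)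
  also have "\<dots> \<le> (f d - f c) * (d - a) * (b - a)"
    using 2 ab by (intro mult_right_mono) auto
  finally have "((f b - f a) * (d - c)) * (d - a) \<le> ((f d - f c) * (b - a)) * (d - a)"
    by (simp only: mult_ac)
  then show ?thesis
    by (rule mult_right_le_imp_le) (use ad in simp)
next
  case True
  then show ?thesis by simp
qed

text \<open>By convexity the slope over the interval from \<open>c\<close> to \<open>d\<close>
  dominates every slope to its left, so one estimate at a large radius yields all smaller ones. The
  zero function is treated apart, as it has no logarithm.\<close>

lemma disc_max_growth_propagates:
  assumes F: "F holomorphic_on UNIV" and ord: "a \<le> b" "b \<le> c" "c < d"
    and X: "disc_max F (exp d) \<le> exp X * disc_max F (exp c)"
  shows "disc_max F (exp b) \<le> exp (X / (d - c) * (b - a)) * disc_max F (exp a)"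
proof (cases "\<exists>z0. F z0 \<noteq> 0")
  case True
  then obtain z0 where z0: "F z0 \<noteq> 0" by blast
  note e = disc_max_exp[OF F z0]
  from X have X': "log_max F d - log_max F c \<le> X"
    by (simp add: e flip: exp_add)
  have "(log_max F b - log_max F a) * (d - c) \<le> (log_max F d - log_max F c) * (b - a)"
    using ord by (intro convex_on_increments convex_log_max[OF F z0]) auto
  also have "\<dots> \<le> X * (b - a)"
    using X' ord by (intro mult_right_mono) auto
  finally have "log_max F b - log_max F a \<le> X * (b - a) / (d - c)"
    using ord by (simp only: pos_le_divide_eq diff_gt_0_iff_gt)
  then have "exp (log_max F b) \<le> exp (X * (b - a) / (d - c) + log_max F a)"
    unfolding exp_le_cancel_iff by linarith
  then show ?thesis
    unfolding e exp_add times_divide_eq_left .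
next
  case False
  then have "F = (\<lambda>_. 0)" by auto
  then show ?thesis by (simp add: disc_max_def)
qed

section \<open>Smallness from a circle average\<close>

text \<open>On the circle \<open>z * cnj z\<close> is constant, which removes mixed powers of
  \<open>z\<close> and \<open>cnj z\<close>, and conjugation does not change real parts. Hence the
  real parts of polynomials form an algebra on the circle.\<close>

lemma Re_mult_cnj_eq_Re_poly_on_sphere:
  fixes p q :: "complex poly"
  shows "\<exists>r. \<forall>z. norm z = S \<longrightarrow> Re (poly p z * cnj (poly q z)) = Re (poly r z)"
proof (induction p q rule: poly_induct2)
  case 0
  show ?case by (rule exI[of _ 0]) simp
next
  case (pCons a p b q)
  then obtain r where r: "\<And>z. norm z = S \<Longrightarrow> Re (poly p z * cnj (poly q z)) = Re (poly r z)"
    by blast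
  \<comment> \<open>The summands come from expanding the product: the constant terms, the two cross
    terms, one of them conjugated, and the product covered by the induction, which carries the
    factor \<open>z * cnj z\<close>.\<close>
  define r' where "r' = [:a * cnj b:] + smult (cnj a) (pCons 0 q) + smult (cnj b) (pCons 0 p)
    + smult (of_real (S\<^sup>2)) r"
  have "Re (poly (pCons a p) z * cnj (poly (pCons b q) z)) = Re (poly r' z)" if z: "norm z = S" for z
  proof -
    have zz: "z * cnj z = of_real (S\<^sup>2)"
      using z complex_norm_square[of z] by simp
    have "poly (pCons a p) z * cnj (poly (pCons b q) z)
        = a * cnj b + a * cnj (z * poly q z) + cnj b * (z * poly p z) + (z * cnj z) * (poly p z * cnj (poly q z))"
      by (simp add: algebra_simps)
    also have "Re \<dots> = Re (a * cnj b) + Re (a * cnj (z * poly q z)) + Re (cnj b * (z * poly p z))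
        + S\<^sup>2 * Re (poly p z * cnj (poly q z))"
      unfolding zz by (simp del: of_real_power)
    also have "Re (a * cnj (z * poly q z)) = Re (cnj a * (z * poly q z))"
      by (simp add: algebra_simps)
    also have "Re (a * cnj b) + Re (cnj a * (z * poly q z)) + Re (cnj b * (z * poly p z))
        + S\<^sup>2 * Re (poly p z * cnj (poly q z)) = Re (poly r' z)"
      unfolding r[OF z] r'_def by (simp add: algebra_simps del: of_real_power)
    finally show ?thesis .
  qed
  then show ?case by blast
qed

text \<open>Stone-Weierstrass for the algebra of real parts of polynomials. It provides a harmonic
  function \<open>Re E\<close> on the disc with nearly prescribed boundary values, together with its
  holomorphic completion \<open>E\<close>.\<close>

lemma approx_Re_poly_on_sphere:
  fixes u :: "complex \<Rightarrow> real"
  assumes u: "continuous_on (sphere 0 S) u" and e: "e > 0"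
  obtains E :: "complex poly" where "\<And>z. norm z = S \<Longrightarrow> \<bar>u z - Re (poly E z)\<bar> < e"
proof -
  define R where "R = {g. continuous_on (sphere 0 S) g \<and>
    (\<exists>p :: complex poly. \<forall>z. norm z = S \<longrightarrow> g z = Re (poly p z))}"
  interpret function_ring_on R "sphere (0::complex) S"
  proof
    show "compact (sphere (0::complex) S)" by simp
    show "continuous_on (sphere 0 S) g" if "g \<in> R" for g
      using that by (simp add: R_def)
    show "(\<lambda>x. g x + h x) \<in> R" if "g \<in> R" "h \<in> R" for g h
    proof -
      from that obtain p q :: "complex poly" where pq:
        "\<forall>z. norm z = S \<longrightarrow> g z = Re (poly p z)" "\<forall>z. norm z = S \<longrightarrow> h z = Re (poly q z)"
        unfolding R_def by blast
      have "\<forall>z. norm z = S \<longrightarrow> g z + h z = Re (poly (p + q) z)"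
        using pq by simp
      moreover have "continuous_on (sphere 0 S) (\<lambda>x. g x + h x)"
        using that by (auto simp: R_def intro: continuous_on_add)
      ultimately show ?thesis unfolding R_def by blast
    qed
    show "(\<lambda>x. g x * h x) \<in> R" if "g \<in> R" "h \<in> R" for g h
    proof -
      from that obtain p q :: "complex poly" where pq:
        "\<forall>z. norm z = S \<longrightarrow> g z = Re (poly p z)" "\<forall>z. norm z = S \<longrightarrow> h z = Re (poly q z)"
        unfolding R_def by blast
      obtain r where r: "\<forall>z. norm z = S \<longrightarrow> Re (poly p z * cnj (poly q z)) = Re (poly r z)"
        using Re_mult_cnj_eq_Re_poly_on_sphere by blast
      \<comment> \<open>Here \<open>Re a * Re b = (Re (a * b) + Re (a * cnj b)) / 2\<close>, and on
        the circle the second part is again the real part of a polynomial.\<close>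
      have "\<forall>z. norm z = S \<longrightarrow> g z * h z = Re (poly (smult (1/2) (p * q + r)) z)"
      proof (intro allI impI)
        fix z :: complex assume z: "norm z = S"
        have "Re (poly (smult (1/2) (p * q + r)) z) = (Re (poly p z * poly q z) + Re (poly r z)) / 2"
          by simp
        also have "Re (poly r z) = Re (poly p z * cnj (poly q z))"
          using r z by simp
        also have "(Re (poly p z * poly q z) + Re (poly p z * cnj (poly q z))) / 2 = g z * h z"
          using pq z by (simp add: field_simps)
        finally show "g z * h z = Re (poly (smult (1/2) (p * q + r)) z)" by simp
      qed
      moreover have "continuous_on (sphere 0 S) (\<lambda>x. g x * h x)"
        using that by (auto simp: R_def intro: continuous_on_mult)
      ultimately show ?thesis unfolding R_def by blast
    qed
    show "(\<lambda>_. c) \<in> R" for c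
      unfolding R_def by (auto intro!: exI[of _ "[:of_real c:]"])
    show "\<exists>f\<in>R. f x \<noteq> f y" if "x \<noteq> y" for x y
    proof -
      have *: "(\<lambda>z. Re (poly p z)) \<in> R" for p
        unfolding R_def by (auto intro!: continuous_intros)
      have "Re (poly [:0, 1:] x) \<noteq> Re (poly [:0, 1:] y) \<or> Re (poly [:0, \<i>:] x) \<noteq> Re (poly [:0, \<i>:] y)"
        using that by (auto simp: complex_eq_iff)
      then show ?thesis
        using *[of "[:0, 1:]"] *[of "[:0, \<i>:]"] by (auto intro: bexI[rotated])
    qed
  qed
  from Stone_Weierstrass_basic[OF u e] obtain g where
    g: "g \<in> R" "\<forall>z\<in>sphere 0 S. \<bar>u z - g z\<bar> < e" by blast
  then obtain E :: "complex poly" where "\<forall>z. norm z = S \<longrightarrow> g z = Re (poly E z)"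
    unfolding R_def by blast
  with g(2) show ?thesis by (intro that[of E]) simp
qed

text \<open>Harnack's inequality from the Schwarz lemma: \<open>g\<close> composes \<open>E\<close>
  with a map of the right half plane to the unit disc that sends \<open>E 0\<close> to
  \<open>0\<close>. Solving the resulting bound \<open>r / S\<close> for the real parts gives both
  estimates.\<close>

lemma harnack_disc:
  assumes E: "E holomorphic_on UNIV" and pos: "\<And>z. norm z < S \<Longrightarrow> Re (E z) > 0"
    and z: "norm z \<le> r" "r < S"
  shows "Re (E 0) * (S - r) \<le> Re (E z) * (S + r)"
    and "Re (E z) * (S - r) \<le> Re (E 0) * (S + r)"
proof -
  have r: "r \<ge> 0" using z(1) norm_ge_zero[of z] by linarith
  then have S: "S > 0" using z by linarith
  define g where "g = (\<lambda>w. (E (of_real S * w) - E 0) / (E (of_real S * w) + cnj (E 0)))"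
  have inS: "norm (of_real S * w) < S" if "norm w < 1" for w :: complex
    using that S by (simp add: norm_mult)
  have x0: "Re (E 0) > 0" using pos[of 0] S by simp
  have den: "E (of_real S * w) + cnj (E 0) \<noteq> 0" if "norm w < 1" for w
    using pos[OF inS[OF that]] x0 by (auto simp: complex_eq_iff)
  have less: "norm (a - b) < norm (a + cnj b)" if "Re a > 0" "Re b > 0" for a b
  proof -
    have "(Re a - Re b)\<^sup>2 < (Re a + Re b)\<^sup>2"
      using mult_pos_pos[OF that] by (simp add: power2_eq_square algebra_simps)
    then have "(norm (a - b))\<^sup>2 < (norm (a + cnj b))\<^sup>2"
      unfolding cmod_power2 by simp
    then show ?thesis by (rule power_less_imp_less_base) simp
  qed
  have ES: "(\<lambda>w. E (of_real S * w)) holomorphic_on A" for A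
  proof -
    have "E \<circ> (\<lambda>w. of_real S * w) holomorphic_on A"
      by (rule holomorphic_on_compose_gen[OF _ E]) (auto intro!: holomorphic_intros)
    then show ?thesis by (simp add: o_def)
  qed
  have "g holomorphic_on ball 0 1"
    unfolding g_def using den by (intro holomorphic_intros ES) auto
  moreover have "g 0 = 0" by (simp add: g_def)
  moreover have "norm (g w) < 1" if "norm w < 1" for w
    using less[OF pos[OF inS[OF that]] x0] den[OF that]
    by (simp add: g_def norm_divide)
  moreover have "norm (z / of_real S) < 1"
    using z S by (simp add: norm_divide)
  ultimately have "norm (g (z / of_real S)) \<le> norm (z / of_real S)"
    by (intro Schwarz_Lemma(1)) auto
  also have "\<dots> \<le> r / S" using z S by (simp add: norm_divide divide_right_mono)
  finally have "norm (E z - E 0) / norm (E z + cnj (E 0)) \<le> r / S"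
    using S by (simp add: g_def norm_divide)
  moreover have "E z + cnj (E 0) \<noteq> 0"
    using den[of "z / of_real S"] z S by (simp add: norm_divide)
  ultimately have "norm (E z - E 0) \<le> r / S * norm (E z + cnj (E 0))"
    by (simp add: pos_divide_le_eq)
  then have "(norm (E z - E 0))\<^sup>2 \<le> (r / S * norm (E z + cnj (E 0)))\<^sup>2"
    by (intro power_mono) auto
  then have main: "(Re (E z) - Re (E 0))\<^sup>2 + (Im (E z) - Im (E 0))\<^sup>2
      \<le> (r / S)\<^sup>2 * ((Re (E z) + Re (E 0))\<^sup>2 + (Im (E z) - Im (E 0))\<^sup>2)"
    unfolding power_mult_distrib cmod_power2 by simp
  \<comment> \<open>The imaginary parts contribute the same square to both sides; a factor of at
    most one on the right allows it to be dropped.\<close>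
  have rS: "(r / S)\<^sup>2 \<le> 1"
    using z(2) r S by (intro power_le_one) auto
  have "(r / S)\<^sup>2 * (Im (E z) - Im (E 0))\<^sup>2 \<le> (Im (E z) - Im (E 0))\<^sup>2"
    using mult_right_mono[OF rS, of "(Im (E z) - Im (E 0))\<^sup>2"] by simp
  with main have "(Re (E z) - Re (E 0))\<^sup>2 \<le> (r / S)\<^sup>2 * (Re (E z) + Re (E 0))\<^sup>2"
    by (simp add: distrib_left)
  then have "(Re (E z) - Re (E 0))\<^sup>2 \<le> (r / S * (Re (E z) + Re (E 0)))\<^sup>2"
    unfolding power_mult_distrib .
  moreover have "0 \<le> r / S * (Re (E z) + Re (E 0))"
    using pos[of z] x0 z r S by simp
  ultimately have "\<bar>Re (E z) - Re (E 0)\<bar> \<le> r / S * (Re (E z) + Re (E 0))"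
    using abs_le_square_iff by (metis abs_of_nonneg)
  then have "\<bar>Re (E z) - Re (E 0)\<bar> * S \<le> r * (Re (E z) + Re (E 0))"
    using S by (simp add: pos_le_divide_eq)
  moreover have "(Re (E z) - Re (E 0)) * S \<le> \<bar>Re (E z) - Re (E 0)\<bar> * S"
    "- (Re (E z) - Re (E 0)) * S \<le> \<bar>Re (E z) - Re (E 0)\<bar> * S"
    using S by (intro mult_right_mono; simp)+
  ultimately show "Re (E 0) * (S - r) \<le> Re (E z) * (S + r)"
    "Re (E z) * (S - r) \<le> Re (E 0) * (S + r)"
    by (simp_all add: algebra_simps)
qed

text \<open>The factor \<open>max \<rho> \<bar>h\<bar>\<close> is replaced by \<open>\<bar>exp E\<bar>\<close> with \<open>E\<close> a polynomial whose real part
  approximates \<open>ln (max 1 \<bar>h / \<rho>\<bar>)\<close> on the circle. The maximum principle for \<open>h * exp (- E)\<close> makes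
  \<open>Re E\<close> large at \<open>z1\<close>, Harnack's inequality spreads this to the whole inner disc, and the
  maximum principle for \<open>Q * exp E\<close> concludes.\<close>

lemma small_of_small_times_max:
  assumes Q: "Q holomorphic_on UNIV" and h: "h holomorphic_on UNIV"
    and \<rho>: "\<rho> > 0" and r: "0 \<le> r" "r < S" and n: "n \<ge> 0"
    and A: "\<And>z. norm z = S \<Longrightarrow> norm (Q z) * max \<rho> (norm (h z)) \<le> A"
    and z1: "norm z1 \<le> r" "norm (h z1) \<ge> \<rho> * exp n"
    and z0: "norm z0 \<le> r"
  shows "norm (Q z0) * \<rho> \<le> A * exp (- ((S - r) / (S + r))\<^sup>2 * n)"
proof -
  \<comment> \<open>Harnack's inequality is applied twice, from \<open>z1\<close> to the centre and
    from the centre to \<open>z0\<close>; hence the square.\<close>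
  define c where "c = ((S - r) / (S + r))\<^sup>2"
  have S: "S > 0" using r by linarith
  define s where "s = (\<lambda>z. ln (max \<rho> (norm (h z)) / \<rho>))"
  have mx_pos: "max \<rho> (norm (h z)) / \<rho> \<ge> 1" for z using \<rho> by simp
  have exps: "\<rho> * exp (s z) = max \<rho> (norm (h z))" for z
    using mx_pos[of z] \<rho> unfolding s_def by (subst exp_ln) auto
  have s0: "s z \<ge> 0" for z unfolding s_def using mx_pos[of z] by simp
  have approx: "norm (Q z0) * \<rho> \<le> A * exp (2 * e - c * n)" if e: "e > 0" for e
  proof -
    have "continuous_on (sphere 0 S) (\<lambda>z. s z + e)"
      unfolding s_def using mx_pos \<rho>
      by (intro continuous_intros entire_continuous_on[OF h]) (auto simp: max_def)
    then obtain E where E: "\<And>z. norm z = S \<Longrightarrow> \<bar>s z + e - Re (poly E z)\<bar> < e / 2"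
      using approx_Re_poly_on_sphere[of S "\<lambda>z. s z + e" "e / 2"] e by auto
    \<comment> \<open>Shifting by \<open>e\<close> with accuracy \<open>e / 2\<close> keeps
      \<open>Re E\<close> positive on the circle at a cost of at most \<open>2 * e\<close>. The
      maximum principle for \<open>exp (- E)\<close> then gives the positivity inside that Harnack's
      inequality requires.\<close>
    have lo: "Re (poly E z) \<ge> s z + e / 2" and hi: "Re (poly E z) \<le> s z + 2 * e" if "norm z = S" for z
      using E[OF that] e by linarith+
    have Epos: "Re (poly E z) > 0" if "norm z \<le> S" for z
    proof -
      have "norm (exp (- poly E z)) \<le> exp (- e / 2)"
      proof (rule max_modulus_principle_disc[OF _ S _ that])
        show "(\<lambda>z. exp (- poly E z)) holomorphic_on UNIV"
          by (intro holomorphic_intros)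
        show "norm (exp (- poly E z)) \<le> exp (- e / 2)" if "norm z = S" for z
          using lo[OF that] s0[of z] by simp
      qed
      then show ?thesis using e by simp
    qed
    have "norm (h z1 * exp (- poly E z1)) \<le> \<rho>"
    proof (rule max_modulus_principle_disc[where F = "\<lambda>z. h z * exp (- poly E z)", OF _ S])
      show "(\<lambda>z. h z * exp (- poly E z)) holomorphic_on UNIV"
        by (intro holomorphic_intros h)
      show "norm (h z * exp (- poly E z)) \<le> \<rho>" if "norm z = S" for z
      proof -
        have "norm (h z * exp (- poly E z)) = norm (h z) * exp (- Re (poly E z))"
          by (simp add: norm_mult)
        also have "\<dots> \<le> (\<rho> * exp (s z)) * exp (- s z)"
          unfolding exps using lo[OF that] e \<rho> by (intro mult_mono) (auto simp: le_max_iff_disj)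
        also have "\<dots> = \<rho>" by (simp add: exp_minus)
        finally show ?thesis .
      qed
      show "norm z1 \<le> S" using z1 r by linarith
    qed
    then have "norm (h z1) / exp (Re (poly E z1)) \<le> \<rho>"
      by (simp add: norm_mult exp_minus divide_inverse norm_inverse)
    then have "norm (h z1) \<le> \<rho> * exp (Re (poly E z1))"
      by (simp add: pos_divide_le_eq)
    with z1 have "\<rho> * exp n \<le> \<rho> * exp (Re (poly E z1))" by linarith
    then have nE: "n \<le> Re (poly E z1)" using \<rho> by simp
    have H: "Re (poly E z1) * (S - r) \<le> Re (poly E 0) * (S + r)"
      "Re (poly E 0) * (S - r) \<le> Re (poly E z0) * (S + r)"
    proof -
      have hol: "poly E holomorphic_on UNIV" by (intro holomorphic_intros)
      have pos: "Re (poly E z) > 0" if "norm z < S" for z using that Epos by simp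
      show "Re (poly E z1) * (S - r) \<le> Re (poly E 0) * (S + r)"
        by (rule harnack_disc(2)[OF hol pos z1(1) r(2)])
      show "Re (poly E 0) * (S - r) \<le> Re (poly E z0) * (S + r)"
        by (rule harnack_disc(1)[OF hol pos z0 r(2)])
    qed
    have "n * (S - r) * (S - r) \<le> Re (poly E z1) * (S - r) * (S - r)"
      using nE r by (intro mult_right_mono) auto
    also have "\<dots> \<le> Re (poly E 0) * (S + r) * (S - r)"
      using H(1) r by (intro mult_right_mono) auto
    also have "\<dots> = Re (poly E 0) * (S - r) * (S + r)" by simp
    also have "\<dots> \<le> Re (poly E z0) * (S + r) * (S + r)"
      using H(2) r by (intro mult_right_mono) auto
    finally have "n * (S - r)\<^sup>2 \<le> Re (poly E z0) * (S + r)\<^sup>2"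
      by (simp add: power2_eq_square mult.assoc)
    then have "n * (S - r)\<^sup>2 / (S + r)\<^sup>2 \<le> Re (poly E z0)"
      using r by (subst pos_divide_le_eq) auto
    then have cE: "c * n \<le> Re (poly E z0)"
      by (simp add: c_def power_divide mult.commute)
    have "norm (Q z0 * exp (poly E z0)) \<le> A / \<rho> * exp (2 * e)"
    proof (rule max_modulus_principle_disc[where F = "\<lambda>z. Q z * exp (poly E z)", OF _ S])
      show "(\<lambda>z. Q z * exp (poly E z)) holomorphic_on UNIV"
        by (intro holomorphic_intros Q)
      show "norm (Q z * exp (poly E z)) \<le> A / \<rho> * exp (2 * e)" if "norm z = S" for z
      proof -
        have "norm (Q z * exp (poly E z)) = norm (Q z) * exp (Re (poly E z))"
          by (simp add: norm_mult)
        also have "\<dots> \<le> norm (Q z) * exp (s z + 2 * e)"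
          using hi[OF that] by (intro mult_left_mono) auto
        also have "\<dots> = norm (Q z) * (\<rho> * exp (s z)) / \<rho> * exp (2 * e)"
          using \<rho> by (simp add: exp_add)
        also have "\<dots> \<le> A / \<rho> * exp (2 * e)"
          unfolding exps using A[OF that] \<rho> by (intro mult_right_mono divide_right_mono) auto
        finally show ?thesis .
      qed
      show "norm z0 \<le> S" using z0 r by linarith
    qed
    then have *: "norm (Q z0) * exp (Re (poly E z0)) \<le> A / \<rho> * exp (2 * e)"
      by (simp add: norm_mult)
    have "norm (Q z0) * exp (c * n) \<le> norm (Q z0) * exp (Re (poly E z0))"
      using cE by (intro mult_left_mono) auto
    also note *
    finally have "norm (Q z0) * exp (c * n) * \<rho> \<le> A * exp (2 * e)"
      using \<rho> by (simp add: field_simps)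
    then show ?thesis
      by (simp add: exp_diff field_simps)
  qed
  have "norm (Q z0) * \<rho> \<le> A * exp (2 * 0 - c * n)"
  proof (rule tendsto_le[of "at_right 0"])
    show "((\<lambda>e. A * exp (2 * e - c * n)) \<longlongrightarrow> A * exp (2 * 0 - c * n)) (at_right 0)"
      by (intro tendsto_intros)
    show "((\<lambda>e. norm (Q z0) * \<rho>) \<longlongrightarrow> norm (Q z0) * \<rho>) (at_right (0::real))"
      by (rule tendsto_const)
    show "\<forall>\<^sub>F e in at_right 0. norm (Q z0) * \<rho> \<le> A * exp (2 * e - c * n)"
      using approx by (auto simp: eventually_at_right_less eventually_at_filter)
  qed simp
  then show ?thesis by (simp add: c_def)
qed

section \<open>Bounding the coefficients of a power sum\<close>

text \<open>Where \<open>norm h\<close> is at most \<open>\<rho>\<close>, the tail is estimated term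
  by term. Elsewhere the tail times \<open>h ^ Suc l\<close> is the full sum minus its lower part,
  and dividing by powers of \<open>h\<close> only helps. The factor
  \<open>max \<rho> (norm h)\<close> joins both cases.\<close>

lemma horner_tail_bound:
  fixes g :: "nat \<Rightarrow> complex" and h :: complex
  assumes \<rho>: "\<rho> > 0" and l: "l < k"
  shows "norm (\<Sum>i\<in>{Suc l..k}. g i * h ^ (i - Suc l)) * \<rho> ^ l * max \<rho> (norm h)
    \<le> norm (\<Sum>i\<le>k. g i * h ^ i) + (\<Sum>i\<le>k. norm (g i) * \<rho> ^ i)"
    (is "norm ?T * _ * _ \<le> norm ?F + ?G")
proof (cases "norm h \<le> \<rho>")
  case True
  have "norm ?T \<le> (\<Sum>i\<in>{Suc l..k}. norm (g i) * \<rho> ^ (i - Suc l))"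
    by (rule order_trans[OF norm_sum])
      (auto simp: norm_mult norm_power intro!: sum_mono mult_left_mono power_mono True)
  then have "norm ?T * \<rho> ^ Suc l \<le> (\<Sum>i\<in>{Suc l..k}. norm (g i) * \<rho> ^ (i - Suc l)) * \<rho> ^ Suc l"
    using \<rho> by (intro mult_right_mono) auto
  also have "\<dots> = (\<Sum>i\<in>{Suc l..k}. norm (g i) * \<rho> ^ i)"
    unfolding sum_distrib_right
  proof (rule sum.cong)
    fix i assume "i \<in> {Suc l..k}"
    then have "i - Suc l + Suc l = i" by simp
    then show "norm (g i) * \<rho> ^ (i - Suc l) * \<rho> ^ Suc l = norm (g i) * \<rho> ^ i"
      by (metis mult.assoc power_add)
  qed simp
  also have "\<dots> \<le> ?G"
    using \<rho> by (intro sum_mono2) auto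
  finally have "norm ?T * \<rho> ^ l * \<rho> \<le> ?G"
    by (simp only: power_Suc2 mult.assoc)
  moreover have m: "max \<rho> (norm h) = \<rho>" using True by simp
  ultimately show ?thesis
    unfolding m using norm_ge_zero[of ?F] by linarith
next
  case False
  then have h: "norm h > \<rho>" "norm h > 0" using \<rho> by auto
  have "?F = (\<Sum>i\<in>{..l}. g i * h ^ i) + (\<Sum>i\<in>{Suc l..k}. g i * h ^ i)"
  proof -
    have "{..k} = {..l} \<union> {Suc l..k}" using l by auto
    then show ?thesis by (simp add: sum.union_disjoint)
  qed
  also have "(\<Sum>i\<in>{Suc l..k}. g i * h ^ i) = ?T * h ^ Suc l"
    unfolding sum_distrib_right
  proof (rule sum.cong)
    fix i assume "i \<in> {Suc l..k}"
    then have "i - Suc l + Suc l = i" by simp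
    then show "g i * h ^ i = g i * h ^ (i - Suc l) * h ^ Suc l"
      by (metis mult.assoc power_add)
  qed simp
  finally have F: "?T * h ^ Suc l = ?F - (\<Sum>i\<le>l. g i * h ^ i)" by simp
  \<comment> \<open>Powers of \<open>q\<close> turn powers of \<open>norm h\<close> into powers of
    \<open>\<rho>\<close>; as \<open>q\<close> is at most one, its exponent \<open>l\<close> may be
    lowered to \<open>i\<close>.\<close>
  define q where "q = \<rho> / norm h"
  have q: "0 < q" "q \<le> 1" "norm h * q = \<rho>"
    using h \<rho> by (auto simp: q_def)
  have "norm ?T * \<rho> ^ l * norm h = norm (?T * h ^ Suc l) * q ^ l"
    by (simp add: norm_mult norm_power power_mult_distrib flip: q(3))
  also have "\<dots> \<le> (norm ?F + norm (\<Sum>i\<le>l. g i * h ^ i)) * q ^ l"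
    unfolding F using q by (intro mult_right_mono norm_triangle_ineq4) auto
  also have "\<dots> \<le> (norm ?F + (\<Sum>i\<le>l. norm (g i * h ^ i))) * q ^ l"
    using q by (intro mult_right_mono add_left_mono norm_sum) auto
  also have "\<dots> = norm ?F * q ^ l + (\<Sum>i\<le>l. norm (g i) * (norm h ^ i * q ^ l))"
    by (simp add: distrib_right sum_distrib_right norm_mult norm_power mult.assoc)
  also have "\<dots> \<le> norm ?F + (\<Sum>i\<le>l. norm (g i) * \<rho> ^ i)"
  proof (intro add_mono sum_mono mult_left_mono)
    show "norm ?F * q ^ l \<le> norm ?F"
      using q by (intro mult_left_le power_le_one) auto
    fix i assume "i \<in> {..l}"
    then have "norm h ^ i * q ^ l \<le> norm h ^ i * q ^ i"
      using q by (intro mult_left_mono power_decreasing) auto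
    then show "norm h ^ i * q ^ l \<le> \<rho> ^ i"
      by (simp add: power_mult_distrib flip: q(3))
  qed auto
  also have "\<dots> \<le> norm ?F + ?G"
    using \<rho> l by (intro add_left_mono sum_mono2) auto
  finally have "norm ?T * \<rho> ^ l * norm h \<le> norm ?F + ?G" .
  moreover have "max \<rho> (norm h) = norm h" using h by simp
  ultimately show ?thesis by (simp only:)
qed

text \<open>Every Horner tail is small on the inner disc by
  \<open>small_of_small_times_max\<close>, and two consecutive tails determine a coefficient.\<close>

lemma coefficients_le_disc_max:
  fixes g :: "nat \<Rightarrow> complex \<Rightarrow> complex" and h :: "complex \<Rightarrow> complex" and k :: nat
  defines "F \<equiv> \<lambda>z. \<Sum>i\<le>k. g i z * h z ^ i"
  assumes h: "h holomorphic_on UNIV" and g: "\<And>i. g i holomorphic_on UNIV"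
    and r: "0 < r0" "r0 \<le> r1" "r1 < S" and \<rho>: "disc_max h r0 = \<rho>" "\<rho> > 0"
    and n: "n \<ge> 0" "disc_max h r1 \<ge> \<rho> * exp n"
    and D: "D \<ge> 0" "\<And>i. i \<le> k \<Longrightarrow> disc_max (g i) S \<le> exp D * disc_max (g i) r0"
    and big: "4 * (real k + 1) * exp D \<le> exp (((S - r1) / (S + r1))\<^sup>2 * n)"
  shows "(\<Sum>i\<le>k. disc_max (g i) r0 * \<rho> ^ i) \<le> 3 * disc_max F S"
proof -
  have holF: "F holomorphic_on UNIV"
    unfolding F_def by (intro holomorphic_intros g h)
  define X where "X = (\<Sum>i\<le>k. disc_max (g i) r0 * \<rho> ^ i)"
  define q where "q = exp (- ((S - r1) / (S + r1))\<^sup>2 * n)"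
  \<comment> \<open>The right-hand side of \<open>horner_tail_bound\<close> on the circle of radius
    \<open>S\<close>, after the growth of the \<open>g i\<close> from \<open>r0\<close> to
    \<open>S\<close> is paid with \<open>exp D\<close>. It contains the unknown \<open>X\<close>
    itself.\<close>
  define A where "A = disc_max F S + exp D * X"
  define T where "T = (\<lambda>j z. \<Sum>i\<in>{j..k}. g i z * h z ^ (i - j))"
  have holT: "T j holomorphic_on UNIV" for j
    unfolding T_def by (intro holomorphic_intros g h)
  have q: "q > 0" "q \<le> 1" "4 * (real k + 1) * exp D * q \<le> 1"
    using big n(1) by (auto simp: q_def exp_minus field_simps)
  have r1: "r1 > 0" "S > 0" using r by auto
  have F0: "disc_max F S \<ge> 0"
    using disc_max_nonneg[OF holF] r1 by simp
  have X0: "X \<ge> 0"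
    unfolding X_def using \<rho> r disc_max_nonneg[OF g] by (intro sum_nonneg mult_nonneg_nonneg) auto
  have A0: "A \<ge> 0" using F0 X0 by (simp add: A_def)
  obtain z1 where z1: "norm z1 = r1" "norm (h z1) = disc_max h r1"
    using disc_max_attained[OF h r1(1)] by blast
  have hle: "norm (h z) \<le> \<rho>" if "norm z \<le> r0" for z
    using norm_le_disc_max[OF h that] \<rho> by simp
  have T_small: "norm (T (Suc l) z) * \<rho> ^ Suc l \<le> A * q" if l: "l < k" and z: "norm z \<le> r0" for l z
  proof -
    have "norm (T (Suc l) z * of_real (\<rho> ^ l)) * \<rho> \<le> A * exp (- ((S - r1) / (S + r1))\<^sup>2 * n)"
    proof (rule small_of_small_times_max[where Q = "\<lambda>z. T (Suc l) z * of_real (\<rho> ^ l)", OF _ h \<rho>(2) _ r(3) n(1)])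
      show "(\<lambda>z. T (Suc l) z * complex_of_real (\<rho> ^ l)) holomorphic_on UNIV"
        by (intro holomorphic_intros holT)
      show "norm (T (Suc l) w * complex_of_real (\<rho> ^ l)) * max \<rho> (norm (h w)) \<le> A"
        if w: "norm w = S" for w
      proof -
        have "norm (T (Suc l) w) * \<rho> ^ l * max \<rho> (norm (h w))
            \<le> norm (F w) + (\<Sum>i\<le>k. norm (g i w) * \<rho> ^ i)"
          unfolding T_def F_def by (rule horner_tail_bound[OF \<rho>(2) l])
        also have "\<dots> \<le> disc_max F S + (\<Sum>i\<le>k. exp D * disc_max (g i) r0 * \<rho> ^ i)"
        proof (intro add_mono sum_mono mult_right_mono)
          show "norm (F w) \<le> disc_max F S"
            using w by (intro norm_le_disc_max holF) auto
          show "norm (g i w) \<le> exp D * disc_max (g i) r0" if "i \<in> {..k}" for i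
            using w that by (intro order_trans[OF norm_le_disc_max[OF g] D(2)]) auto
        qed (use \<rho> in auto)
        also have "\<dots> = A"
          by (simp add: A_def X_def sum_distrib_left mult.assoc)
        finally show ?thesis
          using \<rho> by (simp add: norm_mult norm_power)
      qed
    qed (use z r z1 n in auto)
    then show ?thesis
      using \<rho> by (simp add: norm_mult norm_power q_def mult_ac)
  qed
  have T_small': "norm (T (Suc l) z) * \<rho> ^ Suc l \<le> A * q" if z: "norm z \<le> r0" for l z
  proof (cases "l < k")
    case False
    then have "T (Suc l) z = 0" by (simp add: T_def)
    then show ?thesis using A0 q by simp
  qed (use T_small z in blast)
  have rec: "T j z = g j z + h z * T (Suc j) z" if "j \<le> k" for j z
  proof -
    have "T j z = g j z + (\<Sum>i\<in>{Suc j..k}. g i z * h z ^ (i - j))"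
      unfolding T_def using that by (subst sum.atLeast_Suc_atMost) auto
    also have "(\<Sum>i\<in>{Suc j..k}. g i z * h z ^ (i - j)) = h z * T (Suc j) z"
      unfolding T_def sum_distrib_left
    proof (rule sum.cong)
      fix i assume "i \<in> {Suc j..k}"
      then have "i - j = Suc (i - Suc j)" using Suc_diff_Suc[of j i] by simp
      then show "g i z * h z ^ (i - j) = h z * (g i z * h z ^ (i - Suc j))" by simp
    qed simp
    finally show ?thesis .
  qed
  have T0: "T 0 = F"
    by (auto simp: T_def F_def atLeast0AtMost)
  \<comment> \<open>The tail with index zero is \<open>F\<close> itself, for which no smallness is
    available; all later tails are small.\<close>
  have T_le: "norm (T j z) * \<rho> ^ j \<le> (if j = 0 then disc_max F S else 0) + A * q"
    if "norm z \<le> r0" for j z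
  proof (cases j)
    case 0
    have "norm (F z) \<le> disc_max F S"
      using that r by (intro norm_le_disc_max holF) auto
    then show ?thesis using 0 A0 q T0 by (simp add: add_increasing2)
  qed (use T_small' that in auto)
  have g_le: "disc_max (g j) r0 * \<rho> ^ j \<le> (if j = 0 then disc_max F S else 0) + 2 * (A * q)" if "j \<le> k" for j
  proof -
    have *: "norm (g j z) \<le> ((if j = 0 then disc_max F S else 0) + 2 * (A * q)) / \<rho> ^ j" if z: "norm z \<le> r0" for z
    proof -
      have "g j z = T j z - h z * T (Suc j) z" using rec[OF \<open>j \<le> k\<close>, of z] by simp
      then have "norm (g j z) * \<rho> ^ j \<le> (norm (T j z) + norm (h z) * norm (T (Suc j) z)) * \<rho> ^ j"
        using \<rho> norm_triangle_ineq4[of "T j z" "h z * T (Suc j) z"]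
        by (intro mult_right_mono) (auto simp: norm_mult)
      also have "\<dots> \<le> (norm (T j z) + \<rho> * norm (T (Suc j) z)) * \<rho> ^ j"
        using \<rho> hle[OF z] by (intro mult_right_mono add_left_mono) auto
      also have "\<dots> = norm (T j z) * \<rho> ^ j + norm (T (Suc j) z) * \<rho> ^ Suc j"
        by (simp add: algebra_simps)
      also have "\<dots> \<le> ((if j = 0 then disc_max F S else 0) + A * q) + A * q"
        by (intro add_mono T_le T_small' z)
      finally show ?thesis using \<rho> by (simp add: pos_le_divide_eq)
    qed
    have "disc_max (g j) r0 \<le> ((if j = 0 then disc_max F S else 0) + 2 * (A * q)) / \<rho> ^ j"
      using r * by (intro disc_max_leI) auto
    then show ?thesis using \<rho> by (simp add: pos_le_divide_eq)
  qed
  have "X \<le> (\<Sum>j\<le>k. (if j = 0 then disc_max F S else 0) + 2 * (A * q))"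
    unfolding X_def by (intro sum_mono g_le) auto
  also have "\<dots> = disc_max F S + 2 * (real k + 1) * (A * q)"
    by (simp add: sum.distrib algebra_simps)
  \<comment> \<open>After doubling, the share of \<open>X\<close> hidden in \<open>A\<close> is at
    most \<open>X\<close> by \<open>big\<close> and can be subtracted; the remaining multiple of
    \<open>disc_max F S\<close> is three.\<close>
  finally have "2 * X \<le> 2 * disc_max F S + 4 * (real k + 1) * q * A" by (simp add: algebra_simps)
  also have "4 * (real k + 1) * q * A = 4 * (real k + 1) * q * disc_max F S + (4 * (real k + 1) * exp D * q) * X"
    by (simp add: A_def algebra_simps)
  also have "\<dots> \<le> disc_max F S + X"
  proof (intro add_mono)
    have "4 * (real k + 1) * 1 * q \<le> 4 * (real k + 1) * exp D * q"
      using q D by (intro mult_right_mono mult_left_mono) auto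
    then have "4 * (real k + 1) * q \<le> 1" using q(3) by linarith
    then show "4 * (real k + 1) * q * disc_max F S \<le> disc_max F S"
      using mult_right_mono[OF _ F0] by fastforce
    show "4 * (real k + 1) * exp D * q * X \<le> X"
      using mult_right_mono[OF q(3) X0] by simp
  qed
  finally show ?thesis by (simp add: X_def)
qed

text \<open>The coefficient bound is put back into the sum on the disc of radius \<open>R\<close>:
  compared with \<open>r0\<close>, each \<open>g i\<close> costs at most \<open>exp D\<close> and
  each power of \<open>h\<close> at most \<open>(disc_max h R / \<rho>) ^ k\<close>. What remains is
  a growth estimate for \<open>F\<close> alone.\<close>

lemma disc_max_sum_le:
  fixes g :: "nat \<Rightarrow> complex \<Rightarrow> complex" and h :: "complex \<Rightarrow> complex" and k :: nat
  defines "F \<equiv> \<lambda>z. \<Sum>i\<le>k. g i z * h z ^ i"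
  assumes h: "h holomorphic_on UNIV" and g: "\<And>i. g i holomorphic_on UNIV"
    and r: "0 < r0" "r0 \<le> r1" "r1 < S" "S \<le> R" and \<rho>: "disc_max h r0 = \<rho>" "\<rho> > 0"
    and n: "n \<ge> 0" "disc_max h r1 \<ge> \<rho> * exp n"
    and D: "D \<ge> 0" "\<And>i. i \<le> k \<Longrightarrow> disc_max (g i) R \<le> exp D * disc_max (g i) r0"
    and big: "4 * (real k + 1) * exp D \<le> exp (((S - r1) / (S + r1))\<^sup>2 * n)"
  shows "disc_max F R \<le> 3 * exp D * (disc_max h R / \<rho>) ^ k * disc_max F S"
proof -
  have DS: "disc_max (g i) S \<le> exp D * disc_max (g i) r0" if "i \<le> k" for i
    using disc_max_mono[OF g[of i], of S R] D(2)[OF that] r by linarith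
  have X: "(\<Sum>i\<le>k. disc_max (g i) r0 * \<rho> ^ i) \<le> 3 * disc_max F S"
    unfolding F_def by (rule coefficients_le_disc_max[OF h g r(1-3) \<rho> n D(1) DS big])
  define H where "H = disc_max h R"
  have H: "H \<ge> \<rho>"
    unfolding H_def \<rho>(1)[symmetric] using r by (intro disc_max_mono h) auto
  have "disc_max F R \<le> exp D * (H / \<rho>) ^ k * (\<Sum>i\<le>k. disc_max (g i) r0 * \<rho> ^ i)"
  proof (rule disc_max_leI)
    fix z :: complex assume z: "norm z \<le> R"
    have "norm (F z) \<le> (\<Sum>i\<le>k. norm (g i z * h z ^ i))"
      unfolding F_def by (rule norm_sum)
    also have "\<dots> \<le> (\<Sum>i\<le>k. exp D * (H / \<rho>) ^ k * (disc_max (g i) r0 * \<rho> ^ i))"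
    proof (rule sum_mono)
      fix i assume i: "i \<in> {..k}"
      have gi: "disc_max (g i) r0 \<ge> 0" using r by (intro disc_max_nonneg g) auto
      have "norm (g i z * h z ^ i) \<le> (exp D * disc_max (g i) r0) * H ^ i"
        unfolding norm_mult norm_power
      proof (intro mult_mono power_mono)
        show "norm (g i z) \<le> exp D * disc_max (g i) r0"
          using norm_le_disc_max[OF g[of i] z] D(2)[of i] i by simp
        show "norm (h z) \<le> H" unfolding H_def by (rule norm_le_disc_max[OF h z])
      qed (use gi in auto)
      also have "H ^ i = (H / \<rho>) ^ i * \<rho> ^ i"
        using \<rho> by (simp add: power_divide)
      also have "(exp D * disc_max (g i) r0) * ((H / \<rho>) ^ i * \<rho> ^ i) \<le>
          (exp D * disc_max (g i) r0) * ((H / \<rho>) ^ k * \<rho> ^ i)"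
        using i gi H \<rho> by (intro mult_left_mono mult_right_mono power_increasing) (auto simp: pos_le_divide_eq)
      finally show "norm (g i z * h z ^ i) \<le> exp D * (H / \<rho>) ^ k * (disc_max (g i) r0 * \<rho> ^ i)"
        by (simp add: mult_ac)
    qed
    finally show "norm (F z) \<le> exp D * (H / \<rho>) ^ k * (\<Sum>i\<le>k. disc_max (g i) r0 * \<rho> ^ i)"
      by (simp add: sum_distrib_left)
  qed (use r in auto)
  also have "\<dots> \<le> exp D * (H / \<rho>) ^ k * (3 * disc_max F S)"
    using H \<rho>(2) by (intro mult_left_mono[OF X]) simp
  finally show ?thesis by (simp only: H_def mult_ac)
qed

section \<open>Polynomials on the graph and their growth\<close>

text \<open>These are the restrictions to the graph of the polynomials of degree at most \<open>k\<close> in each variable.\<close>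

primrec graph_space :: "(nat \<Rightarrow> complex \<Rightarrow> complex) \<Rightarrow> nat \<Rightarrow> nat \<Rightarrow> (complex \<Rightarrow> complex) set" where
  "graph_space f 0 k = {poly p |p. degree p \<le> k}"
| "graph_space f (Suc m) k =
     {\<lambda>z. \<Sum>i\<le>k. g i z * f (Suc m) z ^ i |g. \<forall>i. g i \<in> graph_space f m k}"

lemma graph_space_holomorphic:
  assumes "\<And>j. j \<in> {1..m} \<Longrightarrow> f j holomorphic_on UNIV" "F \<in> graph_space f m k"
  shows "F holomorphic_on UNIV"
  using assms
proof (induction m arbitrary: F)
  case 0
  then show ?case by (auto intro!: holomorphic_intros)
next
  case (Suc m)
  then obtain g where g: "\<And>i. g i \<in> graph_space f m k" "F = (\<lambda>z. \<Sum>i\<le>k. g i z * f (Suc m) z ^ i)"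
    by auto
  have "g i holomorphic_on UNIV" for i
    by (rule Suc.IH[OF _ g(1)]) (use Suc.prems(1) in auto)
  moreover have "f (Suc m) holomorphic_on UNIV"
    using Suc.prems(1) by simp
  ultimately show ?case
    unfolding g(2) by (intro holomorphic_intros)
qed

lemma graph_space_zero: "(\<lambda>_. 0) \<in> graph_space f m k"
proof (induction m)
  case 0
  have "(\<lambda>_. 0) = poly (0 :: complex poly)" by auto
  then show ?case by (auto intro: exI[of _ 0])
next
  case (Suc m)
  then show ?case by (auto intro!: exI[of _ "\<lambda>_ _. 0"])
qed

lemma graph_space_add:
  assumes "F \<in> graph_space f m k" "G \<in> graph_space f m k"
  shows "(\<lambda>z. F z + G z) \<in> graph_space f m k"
  using assms
proof (induction m arbitrary: F G)
  case 0
  then obtain p q where "F = poly p" "degree p \<le> k" "G = poly q" "degree q \<le> k" by auto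
  then show ?case by (auto intro!: exI[of _ "p + q"] degree_add_le)
next
  case (Suc m)
  then obtain a b where a: "\<And>i. a i \<in> graph_space f m k" "F = (\<lambda>z. \<Sum>i\<le>k. a i z * f (Suc m) z ^ i)"
    and b: "\<And>i. b i \<in> graph_space f m k" "G = (\<lambda>z. \<Sum>i\<le>k. b i z * f (Suc m) z ^ i)"
    by auto
  have "(\<lambda>z. F z + G z) = (\<lambda>z. \<Sum>i\<le>k. (a i z + b i z) * f (Suc m) z ^ i)"
    by (simp add: a(2) b(2) distrib_right sum.distrib)
  moreover have "\<And>i. (\<lambda>z. a i z + b i z) \<in> graph_space f m k"
    by (intro Suc.IH a b)
  ultimately show ?case
    by (auto intro!: exI[of _ "\<lambda>i z. a i z + b i z"])
qed

lemma graph_space_cmult: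
  assumes "F \<in> graph_space f m k"
  shows "(\<lambda>z. c * F z) \<in> graph_space f m k"
  using assms
proof (induction m arbitrary: F)
  case 0
  then obtain p where "F = poly p" "degree p \<le> k" by auto
  then show ?case by (auto intro!: exI[of _ "smult c p"] order_trans[OF degree_smult_le])
next
  case (Suc m)
  then obtain a where a: "\<And>i. a i \<in> graph_space f m k" "F = (\<lambda>z. \<Sum>i\<le>k. a i z * f (Suc m) z ^ i)"
    by auto
  have "(\<lambda>z. c * F z) = (\<lambda>z. \<Sum>i\<le>k. (c * a i z) * f (Suc m) z ^ i)"
    by (simp add: a(2) sum_distrib_left mult.assoc)
  moreover have "\<And>i. (\<lambda>z. c * a i z) \<in> graph_space f m k"
    by (intro Suc.IH a)
  ultimately show ?case
    by (auto intro!: exI[of _ "\<lambda>i z. c * a i z"])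
qed

lemma graph_space_sum:
  assumes "\<And>s. s \<in> A \<Longrightarrow> F s \<in> graph_space f m k"
  shows "(\<lambda>z. \<Sum>s\<in>A. F s z) \<in> graph_space f m k"
  using assms
  by (induction A rule: infinite_finite_induct) (auto intro: graph_space_zero graph_space_add)

lemma graph_space_monomial:
  assumes "\<And>j. j \<le> m \<Longrightarrow> a j \<le> k"
  shows "(\<lambda>z. \<Prod>j\<le>m. graph_point f z j ^ a j) \<in> graph_space f m k"
  using assms
proof (induction m)
  case 0
  have "(\<lambda>z. z ^ a 0) = poly (monom (1::complex) (a 0))"
    by (auto simp: poly_monom)
  then show ?case
    using 0 by (auto simp: graph_point_def degree_monom_eq)
next
  case (Suc m)
  define g where "g = (\<lambda>i. if i = a (Suc m) then (\<lambda>z. \<Prod>j\<le>m. graph_point f z j ^ a j) else (\<lambda>_. 0))"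
  have "\<And>i. g i \<in> graph_space f m k"
    using Suc by (auto simp: g_def intro: graph_space_zero)
  moreover have "(\<lambda>z. \<Prod>j\<le>Suc m. graph_point f z j ^ a j) = (\<lambda>z. \<Sum>i\<le>k. g i z * f (Suc m) z ^ i)"
  proof
    fix z
    have "(\<Sum>i\<le>k. g i z * f (Suc m) z ^ i) =
        (\<Sum>i\<le>k. if i = a (Suc m) then (\<Prod>j\<le>m. graph_point f z j ^ a j) * f (Suc m) z ^ i else 0)"
      by (intro sum.cong) (auto simp: g_def)
    also have "\<dots> = (\<Prod>j\<le>m. graph_point f z j ^ a j) * f (Suc m) z ^ a (Suc m)"
      using Suc.prems[of "Suc m"] by simp
    finally show "(\<Prod>j\<le>Suc m. graph_point f z j ^ a j) = (\<Sum>i\<le>k. g i z * f (Suc m) z ^ i)"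
      by (simp add: graph_point_def)
  qed
  ultimately show ?case by auto
qed

lemma eval_poly_at_graph_point_in_graph_space:
  assumes p: "p \<in> polynomials_on (m + 1)" and k: "total_deg p \<le> k"
  shows "(\<lambda>z. eval_poly_at p (graph_point f z)) \<in> graph_space f m k"
  unfolding eval_poly_at_def
proof (intro graph_space_sum graph_space_cmult)
  fix s assume s: "s \<in> Poly_Mapping.keys p"
  then have ks: "Poly_Mapping.keys s \<subseteq> {..m}"
    using p unfolding polynomials_on_def by (fastforce simp: less_Suc_eq_le)
  have "(\<Prod>i\<in>Poly_Mapping.keys s. graph_point f z i ^ Poly_Mapping.lookup s i)
      = (\<Prod>i\<le>m. graph_point f z i ^ Poly_Mapping.lookup s i)" for z
    using ks by (intro prod.mono_neutral_left) (auto simp: in_keys_iff)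
  moreover have "(\<lambda>z. \<Prod>i\<le>m. graph_point f z i ^ Poly_Mapping.lookup s i) \<in> graph_space f m k"
  proof (rule graph_space_monomial)
    fix j
    show "Poly_Mapping.lookup s j \<le> k"
    proof (cases "j \<in> Poly_Mapping.keys s")
      case True
      then have "Poly_Mapping.lookup s j \<le> (\<Sum>i\<in>Poly_Mapping.keys s. Poly_Mapping.lookup s i)"
        by (intro member_le_sum) auto
      also have "\<dots> \<le> total_deg p"
        unfolding total_deg_def using s by (intro Max_ge) auto
      finally show ?thesis using k by simp
    qed (simp add: in_keys_iff)
  qed
  ultimately show "(\<lambda>z. \<Prod>i\<in>Poly_Mapping.keys s. graph_point f z i ^ Poly_Mapping.lookup s i) \<in> graph_space f m k"
    by simp
qed

text \<open>For nonzero \<open>F\<close> this bounds the slopes of \<open>log_max F\<close> up to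
  \<open>t\<close>, with \<open>L\<close> uniform over the space. The multiplicative form also
  covers the zero function.\<close>

definition slope_bound :: "(nat \<Rightarrow> complex \<Rightarrow> complex) \<Rightarrow> nat \<Rightarrow> nat \<Rightarrow> real \<Rightarrow> real \<Rightarrow> bool" where
  "slope_bound f m k t L \<longleftrightarrow> (\<forall>F\<in>graph_space f m k. \<forall>a b. a \<le> b \<longrightarrow> b \<le> t \<longrightarrow>
     disc_max F (exp b) \<le> exp (L * (b - a)) * disc_max F (exp a))"

lemma slope_boundD:
  assumes "slope_bound f m k t L" "F \<in> graph_space f m k" "a \<le> b" "b \<le> t"
  shows "disc_max F (exp b) \<le> exp (L * (b - a)) * disc_max F (exp a)"
  using assms unfolding slope_bound_def by blast

lemma slope_bound_mono:
  assumes f: "\<And>j. j \<in> {1..m} \<Longrightarrow> f j holomorphic_on UNIV"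
    and "slope_bound f m k t L" "t' \<le> t" "L \<le> L'"
  shows "slope_bound f m k t' L'"
  unfolding slope_bound_def
proof (intro ballI allI impI)
  fix F a b assume F: "F \<in> graph_space f m k" and ab: "a \<le> b" "b \<le> t'"
  have "disc_max F (exp b) \<le> exp (L * (b - a)) * disc_max F (exp a)"
    using slope_boundD[OF assms(2) F ab(1)] ab(2) assms(3) by simp
  also have "\<dots> \<le> exp (L' * (b - a)) * disc_max F (exp a)"
  proof (rule mult_right_mono)
    have "L * (b - a) \<le> L' * (b - a)"
      using assms(4) ab by (intro mult_right_mono) auto
    then show "exp (L * (b - a)) \<le> exp (L' * (b - a))" by simp
    have "F holomorphic_on UNIV" by (rule graph_space_holomorphic[OF f F])
    then show "0 \<le> disc_max F (exp a)" by (rule disc_max_nonneg) simp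
  qed
  finally show "disc_max F (exp b) \<le> exp (L' * (b - a)) * disc_max F (exp a)" .
qed

text \<open>A Bernstein-Walsh estimate: the reversal \<open>w ^ k * p (1 / w)\<close> exchanges the
  roles of the two circles, and the maximum principle applies to it.\<close>

lemma poly_disc_max_growth:
  fixes p :: "complex poly"
  assumes p: "degree p \<le> k" and ab: "a \<le> b"
  shows "disc_max (poly p) (exp b) \<le> exp (real k * (b - a)) * disc_max (poly p) (exp a)"
proof -
  have holp: "poly p holomorphic_on UNIV" by (intro holomorphic_intros)
  \<comment> \<open>\<open>reflect_poly\<close> reverses with respect to the actual degree; the
    extra power brings this to \<open>k\<close> and keeps the function entire.\<close>
  define q where "q = (\<lambda>w. w ^ (k - degree p) * poly (reflect_poly p) w)"
  have holq: "q holomorphic_on UNIV" unfolding q_def by (intro holomorphic_intros)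
  have q: "q w = w ^ k * poly p (inverse w)" if "w \<noteq> 0" for w
  proof -
    have "w ^ (k - degree p) * w ^ degree p = w ^ k"
      using p by (simp flip: power_add)
    then show ?thesis
      using that by (simp add: q_def poly_reflect_poly_nz mult.assoc[symmetric])
  qed
  obtain z where z: "norm z = exp b" "norm (poly p z) = disc_max (poly p) (exp b)"
    using disc_max_attained[OF holp, of "exp b"] by auto
  have "norm (q (inverse z)) \<le> exp (- a) ^ k * disc_max (poly p) (exp a)"
  proof (rule max_modulus_principle_disc[OF holq, of "exp (- a)"])
    fix w :: complex assume w: "norm w = exp (- a)"
    then have "w \<noteq> 0" by auto
    moreover have "norm (poly p (inverse w)) \<le> disc_max (poly p) (exp a)"
      using w by (intro norm_le_disc_max holp) (simp add: norm_inverse exp_minus)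
    ultimately show "norm (q w) \<le> exp (- a) ^ k * disc_max (poly p) (exp a)"
      using w by (simp add: q norm_mult norm_power mult_left_mono)
  qed (use z ab in \<open>auto simp: norm_inverse simp flip: exp_minus\<close>)
  moreover have "z \<noteq> 0" using z by auto
  ultimately have "exp (- b) ^ k * disc_max (poly p) (exp b) \<le> exp (- a) ^ k * disc_max (poly p) (exp a)"
    using z by (simp add: q norm_mult norm_power norm_inverse exp_minus)
  then have "exp (b * k) * (exp (- b * k) * disc_max (poly p) (exp b))
      \<le> exp (b * k) * (exp (- a * k) * disc_max (poly p) (exp a))"
    unfolding exp_of_nat2_mult by (intro mult_left_mono) simp_all
  moreover have "b * k + - b * k = 0" "b * k + - a * k = real k * (b - a)"
    by (simp_all add: algebra_simps)
  ultimately show ?thesis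
    by (simp only: mult.assoc[symmetric] exp_add[symmetric] exp_zero mult_1)
qed

lemma slope_bound_polynomials: "slope_bound f 0 k t (real k)"
  unfolding slope_bound_def using poly_disc_max_growth by auto

text \<open>The ratio is the one in Harnack's inequality for the radii \<open>exp t\<close> and
  \<open>exp (t + d)\<close>; its square produces the \<open>d\<^sup>2 / 16\<close> of the next
  lemma.\<close>

lemma exp_ratio_ge:
  fixes d :: real
  assumes "0 \<le> d" "d \<le> 1"
  shows "d / 4 \<le> (exp (t + d) - exp t) / (exp (t + d) + exp t)"
proof -
  have "1 + d \<le> exp d" by (rule exp_ge_add_one_self)
  then have "d * (exp d + 1) \<le> 4 * (exp d - 1)"
  proof -
    have "0 \<le> (4 - d) * (exp d - (1 + d))"
      using \<open>1 + d \<le> exp d\<close> assms by (intro mult_nonneg_nonneg) auto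
    moreover have "d * d \<le> d * 1" using assms by (intro mult_left_mono) auto
    ultimately show ?thesis using assms by (simp add: algebra_simps)
  qed
  then have "d * (exp d + 1) * exp t \<le> 4 * (exp d - 1) * exp t"
    by (rule mult_right_mono) simp
  then have "d * (exp (t + d) + exp t) \<le> 4 * (exp (t + d) - exp t)"
    by (simp add: exp_add algebra_simps)
  moreover have "exp (t + d) + exp t > 0" by (simp add: add_pos_pos)
  ultimately show ?thesis by (simp add: pos_le_divide_eq)
qed

text \<open>The induction step, with four circles at distance \<open>d\<close> in the variable
  \<open>t\<close>. The growth of the last function is measured from the first to the second,
  Harnack's inequality is paid for between the second and the third, and the coefficients are
  compared from the first to the fourth. This yields the growth of \<open>F\<close> from the third
  to the fourth, which convexity carries to smaller radii.\<close>

lemma slope_bound_step: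
  assumes f: "\<And>j. j \<in> {1..Suc m} \<Longrightarrow> f j holomorphic_on UNIV" and nz: "f (Suc m) z0 \<noteq> 0"
    and d: "0 < d" "d \<le> 1"
    and sb: "slope_bound f m k (t + 3 * d) L" "L \<ge> 0"
    and big: "ln (4 * (real k + 1)) + 3 * d * L
      \<le> d\<^sup>2 / 16 * (log_max (f (Suc m)) (t + d) - log_max (f (Suc m)) t)"
  shows "slope_bound f (Suc m) k (t + 2 * d)
    ((ln 3 + 3 * d * L + k * (log_max (f (Suc m)) (t + 3 * d) - log_max (f (Suc m)) t)) / d)"
  unfolding slope_bound_def
proof (intro ballI allI impI)
  define h where "h = f (Suc m)"
  have h: "h holomorphic_on UNIV" using f by (simp add: h_def)
  have h0: "h z0 \<noteq> 0" using nz by (simp add: h_def)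
  note e = disc_max_exp[OF h h0]
  define n where "n = log_max h (t + d) - log_max h t"
  have n: "n \<ge> 0" unfolding n_def using mono_log_max[OF h h0, of t "t + d"] d by simp
  fix F a b assume "F \<in> graph_space f (Suc m) k" and ab: "a \<le> b" "b \<le> t + 2 * d"
  then obtain g where g: "\<And>i. g i \<in> graph_space f m k" and F: "F = (\<lambda>z. \<Sum>i\<le>k. g i z * h z ^ i)"
    by (auto simp: h_def)
  have holg: "g i holomorphic_on UNIV" for i
    by (rule graph_space_holomorphic[OF _ g]) (use f in auto)
  have holF: "F holomorphic_on UNIV" unfolding F by (intro holomorphic_intros holg h)
  define q where "q = (exp (t + 2 * d) - exp (t + d)) / (exp (t + 2 * d) + exp (t + d))"
  have "d / 4 \<le> q"
    using exp_ratio_ge[of d "t + d"] d by (simp add: q_def add.assoc)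
  then have "(d / 4)\<^sup>2 \<le> q\<^sup>2" using d by (intro power_mono) auto
  then have "(d / 4)\<^sup>2 * n \<le> q\<^sup>2 * n" using n by (rule mult_right_mono)
  then have big': "ln (4 * (real k + 1)) + 3 * d * L \<le> q\<^sup>2 * n"
    using big by (simp add: power_divide n_def h_def)
  have "disc_max F (exp (t + 3 * d)) \<le> 3 * exp (3 * d * L) * (disc_max h (exp (t + 3 * d)) / exp (log_max h t)) ^ k
      * disc_max F (exp (t + 2 * d))"
    unfolding F
  proof (rule disc_max_sum_le[OF h holg, where ?r1.0 = "exp (t + d)" and n = n])
    show "exp (log_max h t) * exp n \<le> disc_max h (exp (t + d))"
      by (simp add: e n_def flip: exp_add)
    show "disc_max (g i) (exp (t + 3 * d)) \<le> exp (3 * d * L) * disc_max (g i) (exp t)" for i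
      using slope_boundD[OF sb(1) g, of t "t + 3 * d"] d by (simp add: mult_ac)
    have "exp (ln (4 * (real k + 1)) + 3 * d * L) \<le> exp (q\<^sup>2 * n)"
      using big' by simp
    then show "4 * (real k + 1) * exp (3 * d * L)
      \<le> exp (((exp (t + 2 * d) - exp (t + d)) / (exp (t + 2 * d) + exp (t + d)))\<^sup>2 * n)"
      unfolding q_def[symmetric] by (simp only: exp_add) simp
  qed (use d sb n e in auto)
  also have "(disc_max h (exp (t + 3 * d)) / exp (log_max h t)) ^ k
    = exp (k * (log_max h (t + 3 * d) - log_max h t))"
    by (simp only: e exp_diff[symmetric] exp_of_nat_mult[symmetric])
  also have "3 * exp (3 * d * L) * exp (k * (log_max h (t + 3 * d) - log_max h t))
    = exp (ln 3 + 3 * d * L + k * (log_max h (t + 3 * d) - log_max h t))"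
    by (simp only: exp_add) simp
  finally have X: "disc_max F (exp (t + 3 * d))
    \<le> exp (ln 3 + 3 * d * L + k * (log_max h (t + 3 * d) - log_max h t)) * disc_max F (exp (t + 2 * d))" .
  have d': "t + 2 * d < t + 3 * d" "t + 3 * d - (t + 2 * d) = d" using d by simp_all
  show "disc_max F (exp b) \<le>
      exp ((ln 3 + 3 * d * L + k * (log_max (f (Suc m)) (t + 3 * d) - log_max (f (Suc m)) t)) / d * (b - a))
      * disc_max F (exp a)"
    using disc_max_growth_propagates[OF holF ab(1,2) d'(1) X] unfolding d'(2) h_def .
qed

section \<open>Finite order\<close>

text \<open>With \<open>r = exp t\<close> this is the difference of logarithmic maxima at
  \<open>r\<close> and \<open>r / e\<close> in the finite-order hypothesis; the quotients in
  \<open>class_I\<close> are those of consecutive increments.\<close>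

definition log_max_increment :: "(complex \<Rightarrow> complex) \<Rightarrow> real \<Rightarrow> real" where
  "log_max_increment h t = log_max h t - log_max h (t - 1)"

lemma entire_nonpolynomial_holomorphic: "entire_nonpolynomial h \<Longrightarrow> h holomorphic_on UNIV"
  by (simp add: entire_nonpolynomial_def)

lemma entire_nonpolynomial_nonzero:
  assumes "entire_nonpolynomial h"
  obtains z0 where "h z0 \<noteq> 0"
proof (rule ccontr)
  assume "\<not> thesis"
  then have "h = poly 0" using that by (intro ext) auto
  then show False using assms unfolding entire_nonpolynomial_def by blast
qed

section \<open>Increments of the logarithmic maximum of a nonpolynomial entire function\<close>

context
  fixes h :: "complex \<Rightarrow> complex"
  assumes h: "entire_nonpolynomial h"
begin

lemma convex_log_max_np: "convex_on UNIV (log_max h)"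
  using entire_nonpolynomial_holomorphic[OF h] entire_nonpolynomial_nonzero[OF h] convex_log_max by blast

lemma mono_log_max_np: "s \<le> t \<Longrightarrow> log_max h s \<le> log_max h t"
  using entire_nonpolynomial_holomorphic[OF h] entire_nonpolynomial_nonzero[OF h] mono_log_max by blast

lemma continuous_on_log_max: "continuous_on A (log_max h)"
  using convex_on_continuous[OF open_UNIV convex_log_max_np] continuous_on_subset by blast

lemma log_max_increment_nonneg: "log_max_increment h t \<ge> 0"
  unfolding log_max_increment_def using mono_log_max_np[of "t - 1" t] by simp

lemma mono_log_max_increment:
  assumes "s \<le> t"
  shows "log_max_increment h s \<le> log_max_increment h t"
  using convex_on_increments[OF convex_log_max_np, of "s - 1" s "t - 1" t] assms
  by (simp add: log_max_increment_def)

lemma continuous_on_log_max_increment: "continuous_on A (log_max_increment h)"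
  unfolding log_max_increment_def
  by (intro continuous_on_diff continuous_on_log_max continuous_on_compose2[OF continuous_on_log_max[of UNIV]])
    (auto intro: continuous_intros)

text \<open>Bounded increments would bound the slopes of the convex function
  \<open>log_max h\<close>, hence give polynomial growth, and Liouville's theorem would make
  \<open>h\<close> a polynomial.\<close>

lemma log_max_increment_unbounded: "\<exists>t. log_max_increment h t > B"
proof (rule ccontr)
  assume "\<not> ?thesis"
  then have B: "log_max_increment h t \<le> B" for t by (simp add: not_less)
  obtain n :: nat where n: "B \<le> real n" using real_arch_simple by blast
  note hol = entire_nonpolynomial_holomorphic[OF h]
  obtain z0 where z0: "h z0 \<noteq> 0" using entire_nonpolynomial_nonzero[OF h] by blast
  have growth: "norm (h z) \<le> exp (log_max h 0) * norm z ^ n" if z: "1 \<le> norm z" for z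
  proof -
    define t where "t = ln (norm z)"
    have t: "t \<ge> 0" "exp t = norm z" using z by (auto simp: t_def)
    have "log_max h t - log_max h 0 \<le> log_max_increment h (t + 1) * t"
      using convex_on_increments[OF convex_log_max_np, of 0 t t "t + 1"] t
      by (simp add: log_max_increment_def)
    also have "\<dots> \<le> n * t"
      using B[of "t + 1"] n t by (intro mult_right_mono) auto
    finally have "exp (log_max h t) \<le> exp (log_max h 0 + n * t)" by simp
    moreover have "norm (h z) \<le> exp (log_max h t)"
      using norm_le_disc_max[OF hol, of z "exp t"] t by (simp flip: disc_max_exp[OF hol z0])
    ultimately show ?thesis
      by (simp add: exp_add exp_of_nat_mult t(2))
  qed
  have "h = poly (\<Sum>i\<le>n. monom ((deriv ^^ i) h 0 / fact i) i)"
  proof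
    fix z
    show "h z = poly (\<Sum>i\<le>n. monom ((deriv ^^ i) h 0 / fact i) i) z"
      using Liouville_polynomial[OF hol, of 1 "exp (log_max h 0)" n z] growth
      by (simp add: poly_sum poly_monom)
  qed
  then show False using h unfolding entire_nonpolynomial_def by blast
qed

lemma log_max_increment_at_top: "filterlim (log_max_increment h) at_top at_top"
  unfolding filterlim_at_top
proof
  fix B
  obtain t where "log_max_increment h t > B" using log_max_increment_unbounded by blast
  then have "\<forall>s\<ge>t. B \<le> log_max_increment h s"
    using mono_log_max_increment by (meson less_imp_le order_trans)
  then show "\<forall>\<^sub>F s in at_top. B \<le> log_max_increment h s"
    unfolding eventually_at_top_linorder by blast
qed

lemma log_max_at_top: "filterlim (log_max h) at_top at_top"
proof (rule filterlim_at_top_mono)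
  show "filterlim (\<lambda>t. log_max h 0 + log_max_increment h t) at_top at_top"
    by (intro filterlim_tendsto_add_at_top[OF tendsto_const] log_max_increment_at_top)
  show "\<forall>\<^sub>F t in at_top. log_max h 0 + log_max_increment h t \<le> log_max h t"
    using eventually_ge_at_top[of 1]
    by eventually_elim (use mono_log_max_np[of 0] in \<open>auto simp: log_max_increment_def\<close>)
qed

end

text \<open>For large \<open>k\<close> the estimates start only where the growth reaches a level
  depending on \<open>k\<close>. This finds a radius with exactly that level; the bound there covers
  all smaller radii.\<close>

lemma attains_above:
  fixes g :: "real \<Rightarrow> real"
  assumes "continuous_on UNIV g" "filterlim g at_top at_top" "g t \<le> y"
  obtains s where "s \<ge> t" "g s = y"
proof -
  have "\<forall>\<^sub>F s in at_top. y \<le> g s \<and> t \<le> s"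
    using assms(2) eventually_ge_at_top[of t] by (simp add: filterlim_at_top eventually_conj)
  then obtain b where b: "y \<le> g b" "t \<le> b"
    using eventually_happens'[OF trivial_limit_at_top_linorder] by blast
  have "\<exists>s\<ge>t. s \<le> b \<and> g s = y"
    using assms b by (intro IVT') (auto intro: continuous_on_subset)
  then show ?thesis using that by blast
qed

text \<open>The last step needs an increment of order \<open>k ^ m\<close>, and the resulting slope
  is \<open>k\<close> times the increment. The first term is this price at radii where the increment
  is still too small, the second the bound where it is large enough.\<close>

definition finite_order_bound :: "(nat \<Rightarrow> complex \<Rightarrow> complex) \<Rightarrow> nat \<Rightarrow> (real \<Rightarrow> real) \<Rightarrow> bool" where
  "finite_order_bound f m G \<longleftrightarrow> (\<exists>C\<ge>0. \<exists>t0. \<forall>k\<ge>1. \<forall>t\<ge>t0.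
     slope_bound f m k t (C * (real k ^ (m + 1) + real k * G t)))"

lemma finite_order_bound_0: "finite_order_bound f 0 (\<lambda>_. 0)"
  unfolding finite_order_bound_def
  by (rule exI[of _ 1]) (use slope_bound_polynomials in auto)

text \<open>Unit steps suffice because \<open>A\<close> controls the following increments. The
  increment has to dominate the coefficient growth \<open>L\<close>: the threshold \<open>K\<close>
  takes care of \<open>k ^ (m + 1)\<close>, and for \<open>m \<ge> 1\<close> both \<open>k\<close>
  and \<open>G\<close> are at most of the order of the square root of the increment, which takes
  care of \<open>k * G\<close>.\<close>

lemma finite_order_bound_Suc:
  assumes f: "\<And>j. j \<in> {1..Suc m} \<Longrightarrow> entire_nonpolynomial (f j)"
    and IH: "finite_order_bound f m G"
    and A: "A \<ge> 1" "\<forall>\<^sub>F t in at_top. log_max_increment (f (Suc m)) (t + 1) \<le> A * log_max_increment (f (Suc m)) t"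
    and G: "m = 0 \<and> (\<forall>t. G t = 0) \<or> m \<ge> 1 \<and> (\<forall>\<^sub>F t in at_top. 0 \<le> G t \<and> G t \<le> sqrt (log_max_increment (f (Suc m)) t))"
  shows "finite_order_bound f (Suc m) (log_max_increment (f (Suc m)))"
proof -
  define h where "h = f (Suc m)"
  define N where "N = log_max_increment h"
  have hnp: "entire_nonpolynomial h" using f by (simp add: h_def)
  obtain z0 where z0: "h z0 \<noteq> 0" using entire_nonpolynomial_nonzero[OF hnp] by blast
  have hol: "\<And>j. j \<in> {1..Suc m} \<Longrightarrow> f j holomorphic_on UNIV"
    using f entire_nonpolynomial_holomorphic by blast
  have sbm: "slope_bound f (Suc m) k t' L'"
    if "slope_bound f (Suc m) k t L" "t' \<le> t" "L \<le> L'" for k t t' L L'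
    using hol that by (rule slope_bound_mono)
  have N0: "N t \<ge> 0" for t unfolding N_def by (rule log_max_increment_nonneg[OF hnp])
  obtain C t0 where C: "C \<ge> 0"
    and sb: "\<And>k t. k \<ge> 1 \<Longrightarrow> t \<ge> t0 \<Longrightarrow> slope_bound f m k t (C * (real k ^ (m + 1) + real k * G t))"
    using IH unfolding finite_order_bound_def by blast
  \<comment> \<open>The bracket adds the coefficients of \<open>\<nu> / s\<close> in the bound for
    \<open>ln (4 * (k + 1)) + 3 * L\<close>, so that the total is the \<open>\<nu> / 16\<close>
    required by the step with \<open>d = 1\<close>.\<close>
  define s where "s = 16 * (8 + 3 * C + 3 * C * A)"
  have s: "s \<ge> 1" using C A by (simp add: s_def add_increasing)
  \<comment> \<open>Squared because the threshold is also used under a square root, where a factor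
    \<open>s\<close> has to remain.\<close>
  define K where "K = s\<^sup>2"
  have K: "K \<ge> 1" "K \<ge> s" using s self_le_power[OF s, of 2] by (auto simp: K_def one_le_power)
  have G_le: "\<forall>\<^sub>F t in at_top. 0 \<le> G t \<and> (m \<ge> 1 \<longrightarrow> G t \<le> sqrt (N t)) \<and> (m = 0 \<longrightarrow> G t = 0)"
    using G by (auto simp: N_def h_def elim: eventually_mono)
  have A': "\<forall>\<^sub>F t in at_top. N (t + 1) \<le> A * N t" using A(2) by (simp add: N_def h_def)
  from eventually_conj[OF G_le A'] obtain t1 where
    t1: "\<And>t. t \<ge> t1 \<Longrightarrow> 0 \<le> G t" "\<And>t. t \<ge> t1 \<Longrightarrow> m \<ge> 1 \<Longrightarrow> G t \<le> sqrt (N t)"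
    "\<And>t. t \<ge> t1 \<Longrightarrow> m = 0 \<Longrightarrow> G t = 0" "\<And>t. t \<ge> t1 \<Longrightarrow> N (t + 1) \<le> A * N t"
    unfolding eventually_at_top_linorder by blast
  define C' where "C' = 3 + A + A\<^sup>2"
  have C': "C' \<ge> 0" using A by (simp add: C'_def)
  have main: "slope_bound f (Suc m) k (t + 1) (C' * (k * N (t + 1)))"
    if k: "k \<ge> 1" and t: "t \<ge> max t0 t1" and big: "N (t + 1) \<ge> K * real k ^ (m + 1)" for k t
  proof -
    define \<nu> where "\<nu> = N (t + 1)"
    define L where "L = C * (real k ^ (m + 1) + real k * G (t + 3))"
    have tt: "t \<ge> t0" "t \<ge> t1" using t by auto
    have k1: "1 \<le> real k" using k by simp
    have kpow: "real k \<le> real k ^ (m + 1)" using self_le_power[OF k1, of "m + 1"] by simp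
    have \<nu>k: "real k ^ (m + 1) \<le> \<nu> / s"
    proof -
      have "real k ^ (m + 1) * s \<le> real k ^ (m + 1) * K" using K by (intro mult_left_mono) auto
      then show ?thesis using big s by (simp add: \<nu>_def pos_le_divide_eq mult.commute)
    qed
    have \<nu>1: "\<nu> \<ge> 1"
    proof -
      have "1 \<le> real k ^ (m + 1)" using k1 kpow by linarith
      then have "1 * 1 \<le> K * real k ^ (m + 1)" using K by (intro mult_mono) auto
      then show ?thesis using big by (simp add: \<nu>_def)
    qed
    have N2: "N (t + 2) \<le> A * \<nu>" using t1(4)[of "t + 1"] tt by (simp add: \<nu>_def add.commute)
    have "N (t + 3) \<le> A * N (t + 2)" using t1(4)[of "t + 2"] tt by (simp add: add.commute)
    also have "\<dots> \<le> A * (A * \<nu>)" using A N2 by (intro mult_left_mono) auto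
    finally have N3: "N (t + 3) \<le> A\<^sup>2 * \<nu>" by (simp add: power2_eq_square mult.assoc)
    have kG: "real k * G (t + 3) \<le> A * (\<nu> / s)"
    proof (cases "m = 0")
      case True
      then show ?thesis using t1(3)[of "t + 3"] tt A \<nu>1 s by simp
    next
      case False
      then have "G (t + 3) \<le> sqrt (N (t + 3))" using t1(2)[of "t + 3"] tt by simp
      also have "\<dots> \<le> sqrt (A\<^sup>2 * \<nu>)" using N3 by (rule real_sqrt_le_mono)
      also have "\<dots> = A * sqrt \<nu>" using A by (simp add: real_sqrt_mult)
      finally have G3: "G (t + 3) \<le> A * sqrt \<nu>" .
      \<comment> \<open>For \<open>m \<ge> 1\<close> the threshold is at least quadratic in
        \<open>k\<close>, so \<open>k\<close> is bounded by the square root of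
        \<open>\<nu>\<close>.\<close>
      have "K * (real k)\<^sup>2 \<le> K * real k ^ (m + 1)"
        using False k1 K by (intro mult_left_mono power_increasing) auto
      then have "(s * real k)\<^sup>2 \<le> \<nu>" using big by (simp add: K_def \<nu>_def power_mult_distrib)
      then have "s * real k \<le> sqrt \<nu>" by (rule real_le_rsqrt)
      then have "real k \<le> sqrt \<nu> / s" using s by (simp add: pos_le_divide_eq mult.commute)
      then have "real k * G (t + 3) \<le> sqrt \<nu> / s * (A * sqrt \<nu>)"
        using G3 t1(1)[of "t + 3"] tt A \<nu>1 s by (intro mult_mono) auto
      also have "\<dots> = A * (\<nu> / s)" using \<nu>1 by (simp add: mult.commute mult.left_commute)
      finally show ?thesis .
    qed
    have "L \<le> C * (\<nu> / s + A * (\<nu> / s))"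
      unfolding L_def using C \<nu>k kG by (intro mult_left_mono add_mono) auto
    then have L_le: "L \<le> (C + C * A) * (\<nu> / s)" by (simp add: algebra_simps)
    have L0: "L \<ge> 0"
      unfolding L_def using C t1(1)[of "t + 3"] tt by (intro mult_nonneg_nonneg add_nonneg_nonneg) auto
    have "ln (4 * (real k + 1)) \<le> 4 * (real k + 1) - 1" by (intro ln_le_minus_one) auto
    also have "\<dots> \<le> 8 * real k" using k1 by simp
    also have "\<dots> \<le> 8 * (\<nu> / s)"
      by (rule mult_left_mono[OF order_trans[OF kpow \<nu>k]]) simp
    finally have "ln (4 * (real k + 1)) + 3 * L \<le> 8 * (\<nu> / s) + 3 * ((C + C * A) * (\<nu> / s))"
      by (rule add_mono) (rule mult_left_mono[OF L_le], simp)
    also have "\<dots> = (8 + 3 * C + 3 * C * A) * (\<nu> / s)"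
      by (simp only: distrib_right distrib_left mult.assoc add.assoc)
    also have "\<dots> = \<nu> / 16" using s unfolding s_def by (simp add: field_simps)
    finally have le: "ln (4 * (real k + 1)) + 3 * L \<le> \<nu> / 16" .
    have "slope_bound f (Suc m) k (t + 2 * 1)
      ((ln 3 + 3 * 1 * L + k * (log_max (f (Suc m)) (t + 3 * 1) - log_max (f (Suc m)) t)) / 1)"
    proof (rule slope_bound_step[OF hol _ _ _ _ L0])
      show "f (Suc m) z0 \<noteq> 0" using z0 by (simp add: h_def)
      show "slope_bound f m k (t + 3 * 1) L"
        unfolding L_def using sb[OF k, of "t + 3"] tt by simp
      show "ln (4 * (real k + 1)) + 3 * 1 * L
        \<le> 1\<^sup>2 / 16 * (log_max (f (Suc m)) (t + 1) - log_max (f (Suc m)) t)"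
        using le by (simp add: \<nu>_def N_def log_max_increment_def h_def)
    qed auto
    moreover have "(ln 3 + 3 * 1 * L + k * (log_max (f (Suc m)) (t + 3 * 1) - log_max (f (Suc m)) t)) / 1
      \<le> C' * (k * \<nu>)"
    proof -
      have "log_max h (t + 3) - log_max h t = N (t + 1) + N (t + 2) + N (t + 3)"
        by (simp add: N_def log_max_increment_def add_diff_eq[symmetric])
      also have "\<dots> \<le> (1 + A + A\<^sup>2) * \<nu>"
        using N2 N3 by (simp add: \<nu>_def algebra_simps)
      finally have "k * (log_max h (t + 3) - log_max h t) \<le> k * ((1 + A + A\<^sup>2) * \<nu>)"
        by (rule mult_left_mono) simp
      moreover have "ln 3 + 3 * L \<le> 2 * (k * \<nu>)"
      proof -
        have "ln 3 \<le> ln (4 * (real k + 1))" by simp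
        moreover have "1 * \<nu> \<le> k * \<nu>" using k1 \<nu>1 by (intro mult_right_mono) auto
        ultimately show ?thesis using \<nu>1 le by linarith
      qed
      ultimately show ?thesis by (simp add: C'_def h_def algebra_simps)
    qed
    ultimately show ?thesis
      unfolding \<nu>_def using sbm[of k "t + 2 * 1" _ "t + 1"] by simp
  qed
  have "slope_bound f (Suc m) k t (C' * K * (real k ^ (Suc m + 1) + real k * N t))"
    if k: "k \<ge> 1" and t: "t \<ge> max t0 t1 + 1" for k t
  proof (cases "N t \<ge> K * real k ^ (m + 1)")
    case True
    have "slope_bound f (Suc m) k t (C' * (k * N t))"
      using main[OF k, of "t - 1"] True t by (simp del: max_less_iff_conj max.bounded_iff add: le_diff_eq)
    moreover have "C' * (k * N t) \<le> C' * K * (real k ^ (Suc m + 1) + real k * N t)"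
    proof -
      have "C' * (k * N t) \<le> C' * (real k ^ (Suc m + 1) + real k * N t)"
        using C' by (intro mult_left_mono) auto
      also have "\<dots> \<le> C' * (K * (real k ^ (Suc m + 1) + real k * N t))"
        using C' N0[of t] mult_right_mono[OF K(1), of "real k ^ (Suc m + 1) + real k * N t"]
        by (intro mult_left_mono) auto
      finally show ?thesis by (simp add: mult.assoc)
    qed
    ultimately show ?thesis using sbm by blast
  next
    case False
    \<comment> \<open>Below the threshold the bound is taken at a larger point, where the increment
      equals the threshold; there \<open>k * N s\<close> is a constant times
      \<open>k ^ (m + 2)\<close>.\<close>
    then obtain s where s: "s \<ge> t" "N s = K * real k ^ (m + 1)"
      using attains_above[OF continuous_on_log_max_increment[OF hnp] log_max_increment_at_top[OF hnp], of t "K * real k ^ (m + 1)"]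
      by (auto simp: N_def)
    have "slope_bound f (Suc m) k s (C' * (k * N s))"
      using main[OF k, of "s - 1"] t s by (simp del: max_less_iff_conj max.bounded_iff add: le_diff_eq)
    moreover have "C' * (k * N s) \<le> C' * K * (real k ^ (Suc m + 1) + real k * N t)"
    proof -
      have "C' * (k * N s) = C' * K * (real k ^ (Suc m + 1))" by (simp add: s)
      also have "\<dots> \<le> C' * K * (real k ^ (Suc m + 1) + real k * N t)"
        using C' K N0 by (intro mult_left_mono) auto
      finally show ?thesis .
    qed
    ultimately show ?thesis using sbm s(1) by blast
  qed
  then show ?thesis
    unfolding finite_order_bound_def N_def h_def
    using C' K by (intro exI[of _ "C' * K"]) auto
qed

section \<open>Infinite order: regularity of the growth\<close>

text \<open>A subgradient \<open>g\<close> is monotone, hence has only countably many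
  discontinuities. Where it is continuous, the difference quotients of \<open>\<psi>\<close> are
  squeezed between its values and converge.\<close>

lemma countable_not_differentiable_convex:
  fixes \<psi> :: "real \<Rightarrow> real"
  assumes "convex_on UNIV \<psi>"
  shows "countable {t. \<not> \<psi> differentiable (at t)}"
proof -
  \<comment> \<open>The infimum of the difference quotients to the right, that is, the right
    derivative.\<close>
  define g where "g = (\<lambda>t. Inf ((\<lambda>s. (\<psi> t - \<psi> s) / (t - s)) ` ({t<..} \<inter> UNIV)))"
  have sub: "\<psi> s \<ge> \<psi> t + g t * (s - t)" for s t
    unfolding g_def using convex_le_Inf_differential[OF assms, of t s] by simp
  have g_mono: "g s \<le> g t" if "s \<le> t" for s t
  proof (cases "s = t")
    case False
    have "g s * (t - s) \<le> g t * (t - s)"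
      using sub[of s t] sub[of t s] by (simp add: algebra_simps)
    then show ?thesis using that False by simp
  qed auto
  have "\<psi> differentiable (at t)" if cont: "isCont g t" for t
  proof -
    have lim: "(g \<longlongrightarrow> g t) (at t)" using cont by (simp add: isCont_def)
    have "((\<lambda>s. (\<psi> s - \<psi> t) / (s - t) - g t) \<longlongrightarrow> 0) (at t)"
    proof (rule Lim_null_comparison)
      show "\<forall>\<^sub>F s in at t. norm ((\<psi> s - \<psi> t) / (s - t) - g t) \<le> \<bar>g s - g t\<bar>"
      proof (rule eventually_at_topological[THEN iffD2], intro exI[of _ UNIV] conjI ballI impI)
        fix s assume "s \<noteq> t"
        define q where "q = (\<psi> s - \<psi> t) / (s - t)"
        have q: "q * (s - t) = \<psi> s - \<psi> t" using \<open>s \<noteq> t\<close> by (simp add: q_def)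
        have 1: "g t * (s - t) \<le> q * (s - t)" "q * (s - t) \<le> g s * (s - t)"
          unfolding q using sub[of t s] sub[of s t] by (auto simp: algebra_simps)
        show "norm ((\<psi> s - \<psi> t) / (s - t) - g t) \<le> \<bar>g s - g t\<bar>"
        proof (cases "s > t")
          case True
          then have "g t \<le> q" "q \<le> g s" using 1 by simp_all
          then show ?thesis unfolding q_def[symmetric] by simp
        next
          case False
          then have "q \<le> g t" "g s \<le> q" using 1 \<open>s \<noteq> t\<close> by (simp_all add: mult_le_cancel_right)
          then show ?thesis unfolding q_def[symmetric] by simp
        qed
      qed auto
      show "((\<lambda>s. \<bar>g s - g t\<bar>) \<longlongrightarrow> 0) (at t)"
        using lim by (simp add: LIM_zero_iff tendsto_rabs_zero_iff)
    qed
    then have "((\<lambda>s. (\<psi> s - \<psi> t) / (s - t)) \<longlongrightarrow> g t) (at t)"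
      by (rule LIM_zero_cancel)
    then have "(\<psi> has_field_derivative g t) (at t)"
      by (simp add: has_field_derivative_iff)
    then show ?thesis by (auto simp: real_differentiable_def)
  qed
  then have "{t. \<not> \<psi> differentiable (at t)} \<subseteq> {t. \<not> isCont g t}" by auto
  moreover have "countable {t. \<not> isCont g t}"
    by (rule mono_ctble_discont) (simp add: g_mono mono_def)
  ultimately show ?thesis by (rule countable_subset)
qed

text \<open>Otherwise some level \<open>y\<close> between \<open>v b\<close> and \<open>v a\<close> is not taken on \<open>X\<close>, and the derivative is
  positive at the last point where \<open>v \<ge> y\<close>.\<close>

lemma le_of_pos_derivative_off_countable:
  fixes v :: "real \<Rightarrow> real"
  assumes ab: "a \<le> b" and cont: "continuous_on {a..b} v" and X: "countable X"
    and der: "\<And>x. x \<in> {a..b} - X \<Longrightarrow> \<exists>D>0. (v has_real_derivative D) (at x)"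
  shows "v a \<le> v b"
proof (rule ccontr)
  assume "\<not> v a \<le> v b"
  then have "uncountable {v b<..<v a}" by (simp add: uncountable_open_interval)
  moreover have "countable (v ` X)" using X by simp
  ultimately have "\<not> {v b<..<v a} \<subseteq> v ` X" using countable_subset by blast
  then obtain y where "y \<in> {v b<..<v a}" and y: "y \<notin> v ` X" by blast
  then have y: "v b < y" "y < v a" "y \<notin> v ` X" by auto
  define S where "S = {a..b} \<inter> v -` {y..}"
  have "compact S"
    unfolding S_def
    by (intro compact_Int_closed[where S = "{a..b}" and T = S, unfolded S_def Int_left_absorb] compact_Icc
        continuous_closed_preimage cont closed_atLeast closed_atLeastAtMost)
  moreover have "a \<in> S" using ab y by (auto simp: S_def)
  ultimately obtain c where c: "c \<in> S" "\<forall>x\<in>S. x \<le> c"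
    using compact_attains_sup by blast
  have cab: "a \<le> c" "c \<le> b" "v c \<ge> y" using c(1) by (auto simp: S_def)
  have above: "v x < y" if "c < x" "x \<le> b" for x
  proof (rule ccontr)
    assume "\<not> v x < y"
    then have "x \<in> S" using that cab by (auto simp: S_def)
    then show False using c(2) that(1) by fastforce
  qed
  have cb: "c < b" using cab y by (cases "c = b") auto
  have "v c = y"
  proof (rule ccontr)
    assume "v c \<noteq> y"
    then have "y < v c" using cab by simp
    moreover have "continuous_on {c..b} v" using cont cab by (auto intro: continuous_on_subset)
    ultimately obtain x where "c \<le> x" "x \<le> b" "v x = y"
      using IVT2'[of v b y c] y cb by auto
    then show False using above[of x] \<open>v c \<noteq> y\<close> by (cases "x = c") auto
  qed
  then have "c \<notin> X" using y by auto
  then obtain D where "D > 0" "(v has_real_derivative D) (at c)"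
    using der cab by auto
  then obtain d where d: "d > 0" "\<And>h. 0 < h \<Longrightarrow> h < d \<Longrightarrow> v c < v (c + h)"
    using DERIV_pos_inc_right by blast
  define h where "h = min (d / 2) (b - c)"
  have h: "0 < h" "h < d" "c + h \<le> b" using d cb by (auto simp: h_def)
  show False using d(2)[OF h(1,2)] above[of "c + h"] h \<open>v c = y\<close> by simp
qed

lemma filterlim_at_top_of_ratio:
  fixes U L :: "real \<Rightarrow> real"
  assumes lim: "((\<lambda>t. U t / L t) \<longlongrightarrow> 1) at_top" and L: "filterlim L at_top at_top"
  shows "filterlim U at_top at_top"
proof -
  have "filterlim (\<lambda>t. U t / L t * L t) at_top at_top"
    by (rule filterlim_tendsto_pos_mult_at_top[OF lim _ L]) simp
  moreover have ev: "\<forall>\<^sub>F t in at_top. U t / L t * L t = U t"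
    using filterlim_at_top_dense[THEN iffD1, OF L, rule_format, of 0] by eventually_elim simp
  ultimately show ?thesis
    using filterlim_cong[OF refl refl ev] by simp
qed

text \<open>The derivative condition of \<open>class_II\<close> in integrated form, with
  \<open>U = ln \<psi>\<close>: the derivative of \<open>1 / U t - \<epsilon> / t\<close> is
  eventually positive off a countable set, so this function increases.\<close>

lemma class_II_witness:
  assumes h: "entire_nonpolynomial h" and II: "class_II h"
  obtains U where "((\<lambda>t. U t / ln (log_max h t)) \<longlongrightarrow> 1) at_top"
    and "\<And>\<epsilon>. \<epsilon> > 0 \<Longrightarrow> \<exists>t0\<ge>1. \<forall>a\<ge>t0. \<forall>b\<ge>a. 1 / U a - \<epsilon> / a \<le> 1 / U b - \<epsilon> / b"
proof -
  from II obtain \<psi> where \<psi>: "convex_on UNIV \<psi>" "mono \<psi>"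
    and lim: "((\<lambda>t. ln (\<psi> t) / ln (growth_phi h t)) \<longlongrightarrow> 1) at_top"
    and der: "((\<lambda>t. t\<^sup>2 * deriv (\<lambda>s. 1 / ln (\<psi> s)) t) \<longlongrightarrow> 0) (inf at_top (principal {t. \<psi> differentiable (at t)}))"
    unfolding class_II_def by blast
  define U where "U = (\<lambda>t. ln (\<psi> t))"
  have phi: "growth_phi h = log_max h"
    using growth_phi_eq_log_max[OF entire_nonpolynomial_holomorphic[OF h]] by auto
  have lim': "((\<lambda>t. U t / ln (log_max h t)) \<longlongrightarrow> 1) at_top"
    using lim by (simp add: U_def phi)
  have lnphi: "filterlim (\<lambda>t. ln (log_max h t)) at_top at_top"
    by (rule filterlim_compose[OF ln_at_top log_max_at_top[OF h]])
  have U_top: "filterlim U at_top at_top"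
    by (rule filterlim_at_top_of_ratio[OF lim' lnphi])
  text \<open>Since \<open>ln (- x) = ln x\<close>, it has to be excluded that \<open>\<psi>\<close> stays negative.\<close>
  obtain t1 where t1: "\<psi> t1 > 1"
  proof (rule ccontr)
    assume "\<not> thesis"
    then have le1: "\<psi> t \<le> 1" for t using that by (meson not_less)
    have "\<forall>\<^sub>F t in at_top. max 1 (ln \<bar>\<psi> 0\<bar>) < U t \<and> t \<ge> 0"
      by (rule eventually_conj[OF filterlim_at_top_dense[THEN iffD1, OF U_top, rule_format] eventually_ge_at_top])
    then obtain t where t: "max 1 (ln \<bar>\<psi> 0\<bar>) < U t" "t \<ge> 0"
      using eventually_happens'[OF trivial_limit_at_top_linorder] by blast
    show False
    proof (cases "\<psi> t > 0")
      case True
      then have "U t \<le> 0" using le1[of t] by (simp add: U_def)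
      then show False using t by simp
    next
      case False
      have "\<psi> 0 \<le> \<psi> t" using \<psi>(2) t(2) by (simp add: mono_def)
      moreover have "\<psi> t \<noteq> 0" using t by (auto simp: U_def)
      ultimately have "ln (- \<psi> t) \<le> ln (- \<psi> 0)" using False by simp
      then have "U t \<le> ln \<bar>\<psi> 0\<bar>" using False \<open>\<psi> 0 \<le> \<psi> t\<close> by (simp add: U_def ln_minus)
      then show False using t by simp
    qed
  qed
  have \<psi>1: "\<psi> t > 1" if "t \<ge> t1" for t
    using t1 \<psi>(2) that by (meson less_le_trans monoD)
  have cont: "continuous_on A \<psi>" for A
    using convex_on_continuous[OF open_UNIV \<psi>(1)] continuous_on_subset by blast
  show ?thesis
  proof (rule that[OF lim'])
    fix \<epsilon> :: real assume \<epsilon>: "\<epsilon> > 0"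
    have "\<forall>\<^sub>F t in inf at_top (principal {t. \<psi> differentiable (at t)}).
        dist (t\<^sup>2 * deriv (\<lambda>s. 1 / ln (\<psi> s)) t) 0 < \<epsilon>"
      using tendstoD[OF der \<epsilon>] .
    then have "\<forall>\<^sub>F t in at_top. \<psi> differentiable (at t) \<longrightarrow> \<bar>t\<^sup>2 * deriv (\<lambda>s. 1 / ln (\<psi> s)) t\<bar> < \<epsilon>"
      by (simp add: eventually_inf_principal)
    then obtain t2 where t2: "\<And>t. t \<ge> t2 \<Longrightarrow> \<psi> differentiable (at t) \<Longrightarrow> \<bar>t\<^sup>2 * deriv (\<lambda>s. 1 / ln (\<psi> s)) t\<bar> < \<epsilon>"
      unfolding eventually_at_top_linorder by blast
    define t0 where "t0 = max 1 (max t1 t2)"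
    have "1 / U a - \<epsilon> / a \<le> 1 / U b - \<epsilon> / b" if ab: "a \<ge> t0" "b \<ge> a" for a b
    proof (rule le_of_pos_derivative_off_countable[where v = "\<lambda>t. 1 / U t - \<epsilon> / t", OF ab(2) _ countable_not_differentiable_convex[OF \<psi>(1)]])
      have "x \<noteq> 0" "\<psi> x \<noteq> 0" "ln (\<psi> x) \<noteq> 0" if "x \<in> {a..b}" for x
        using that ab \<psi>1[of x] by (auto simp: t0_def)
      then show "continuous_on {a..b} (\<lambda>t. 1 / U t - \<epsilon> / t)"
        unfolding U_def by (intro continuous_intros cont) auto
    next
      fix x assume x: "x \<in> {a..b} - {t. \<not> \<psi> differentiable (at t)}"
      then have x1: "x \<ge> 1" "x \<ge> t1" "x \<ge> t2" using ab by (auto simp: t0_def)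
      have diff: "\<psi> differentiable (at x)" using x by simp
      then obtain D where D: "(\<psi> has_real_derivative D) (at x)" by (auto simp: real_differentiable_def)
      have px: "\<psi> x > 1" by (rule \<psi>1[OF x1(2)])
      then have lnx: "ln (\<psi> x) \<noteq> 0" "\<psi> x > 0" by auto
      have "\<exists>E. ((\<lambda>s. 1 / ln (\<psi> s)) has_real_derivative E) (at x)"
        by (rule exI) (rule derivative_eq_intros D refl lnx)+
      then obtain E where E: "((\<lambda>s. 1 / ln (\<psi> s)) has_real_derivative E) (at x)" ..
      have "\<bar>x\<^sup>2 * E\<bar> < \<epsilon>" using t2[OF x1(3) diff] DERIV_imp_deriv[OF E] by simp
      then have "0 < \<epsilon> + x\<^sup>2 * E" by linarith
      then have "0 < (\<epsilon> + x\<^sup>2 * E) / x\<^sup>2" using x1 by simp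
      also have "\<dots> = E + \<epsilon> / x\<^sup>2" using x1 by (simp add: add_divide_distrib)
      finally have pos: "0 < E + \<epsilon> / x\<^sup>2" .
      have "((\<lambda>t. \<epsilon> / t) has_real_derivative - (\<epsilon> / x\<^sup>2)) (at x)"
        using x1 by (auto intro!: derivative_eq_intros simp: power2_eq_square)
      from DERIV_diff[OF E this] have "((\<lambda>t. 1 / U t - \<epsilon> / t) has_real_derivative E + \<epsilon> / x\<^sup>2) (at x)"
        by (simp add: U_def)
      then show "\<exists>D>0. ((\<lambda>t. 1 / U t - \<epsilon> / t) has_real_derivative D) (at x)"
        using pos by blast
    qed
    then show "\<exists>t0\<ge>1. \<forall>a\<ge>t0. \<forall>b\<ge>a. 1 / U a - \<epsilon> / a \<le> 1 / U b - \<epsilon> / b"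
      by (intro exI[of _ t0]) (auto simp: t0_def)
  qed
qed

text \<open>Letting \<open>b\<close> tend to infinity in the monotonicity of
  \<open>1 / U t - \<epsilon> / t\<close> gives \<open>1 / U a \<le> \<epsilon> / a\<close>, where
  \<open>\<epsilon>\<close> is arbitrary.\<close>

lemma class_II_ln_superlinear:
  assumes h: "entire_nonpolynomial h" and II: "class_II h"
  shows "\<forall>\<^sub>F t in at_top. M * t \<le> ln (log_max h t)"
proof -
  from class_II_witness[OF h II] obtain U where
    lim: "((\<lambda>t. U t / ln (log_max h t)) \<longlongrightarrow> 1) at_top"
    and U: "\<And>\<epsilon>. \<epsilon> > 0 \<Longrightarrow> \<exists>t0\<ge>1. \<forall>a\<ge>t0. \<forall>b\<ge>a. 1 / U a - \<epsilon> / a \<le> 1 / U b - \<epsilon> / b"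
    by blast
  define L where "L = (\<lambda>t. ln (log_max h t))"
  have limL: "((\<lambda>t. U t / L t) \<longlongrightarrow> 1) at_top" using lim by (simp add: L_def)
  have L: "filterlim L at_top at_top"
    unfolding L_def by (rule filterlim_compose[OF ln_at_top log_max_at_top[OF h]])
  have U_top: "filterlim U at_top at_top"
    by (rule filterlim_at_top_of_ratio[OF limL L])
  define c where "c = \<bar>M\<bar> + 1"
  have c: "c > 0" by (simp add: c_def)
  define \<epsilon> where "\<epsilon> = 1 / (2 * c)"
  have \<epsilon>: "\<epsilon> > 0" using c by (simp add: \<epsilon>_def)
  from U[OF \<epsilon>] obtain t0 where t0: "t0 \<ge> 1" "\<And>a b. a \<ge> t0 \<Longrightarrow> b \<ge> a \<Longrightarrow> 1 / U a - \<epsilon> / a \<le> 1 / U b - \<epsilon> / b"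
    by blast
  have le: "1 / U a \<le> \<epsilon> / a" if "a \<ge> t0" for a
  proof -
    have "((\<lambda>b. 1 / U b - \<epsilon> / b) \<longlongrightarrow> 0 - 0) at_top"
      by (intro tendsto_diff real_tendsto_divide_at_top[OF tendsto_const] U_top filterlim_ident)
    moreover have "\<forall>\<^sub>F b in at_top. 1 / U a - \<epsilon> / a \<le> 1 / U b - \<epsilon> / b"
      using eventually_ge_at_top[of a] by eventually_elim (use t0 that in auto)
    ultimately have "1 / U a - \<epsilon> / a \<le> 0 - 0"
      using tendsto_lowerbound by force
    then show ?thesis by simp
  qed
  have "\<forall>\<^sub>F t in at_top. U t / L t < 2"
    using order_tendstoD(2)[OF limL, of 2] by (simp add: L_def)
  moreover have "\<forall>\<^sub>F t in at_top. 0 < L t"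
    using filterlim_at_top_dense[THEN iffD1, OF L] by blast
  moreover have "\<forall>\<^sub>F t in at_top. 0 < U t"
    using filterlim_at_top_dense[THEN iffD1, OF U_top] by blast
  ultimately have "\<forall>\<^sub>F t in at_top. M * t \<le> L t"
    using eventually_ge_at_top[of t0]
  proof eventually_elim
    case (elim t)
    have t: "t > 0" using elim t0 by simp
    have "1 / U t \<le> \<epsilon> / t" by (rule le) (use elim in simp)
    then have "t \<le> \<epsilon> * U t" using t elim by (simp add: field_simps)
    also have "\<dots> \<le> \<epsilon> * (2 * L t)"
      using elim \<epsilon> by (intro mult_left_mono) (auto simp: divide_less_eq)
    also have "\<dots> = L t / c" using c by (simp add: \<epsilon>_def)
    finally have "c * t \<le> L t" using c by (simp add: pos_le_divide_eq mult.commute)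
    moreover have "M * t \<le> c * t" using t by (intro mult_right_mono) (auto simp: c_def)
    ultimately show ?case by linarith
  qed
  then show ?thesis by (simp add: L_def)
qed

text \<open>Over a step of length \<open>1 / L t\<close> the quantity \<open>1 / U\<close> drops by
  at most \<open>\<epsilon> / L t\<close>, a small fraction of its size because \<open>U\<close> and
  \<open>L\<close> are asymptotically equal. This determines the step length of the
  induction.\<close>

lemma class_II_ln_slowly_increasing:
  assumes h: "entire_nonpolynomial h" and II: "class_II h" and \<eta>: "0 < \<eta>" "\<eta> \<le> 1"
  shows "\<forall>\<^sub>F t in at_top. ln (log_max h (t + 1 / ln (log_max h t))) \<le> (1 + \<eta>) * ln (log_max h t)"
proof -
  from class_II_witness[OF h II] obtain U where
    lim: "((\<lambda>t. U t / ln (log_max h t)) \<longlongrightarrow> 1) at_top"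
    and U: "\<And>\<epsilon>. \<epsilon> > 0 \<Longrightarrow> \<exists>t0\<ge>1. \<forall>a\<ge>t0. \<forall>b\<ge>a. 1 / U a - \<epsilon> / a \<le> 1 / U b - \<epsilon> / b"
    by blast
  define L where "L = (\<lambda>t. ln (log_max h t))"
  have limL: "((\<lambda>t. U t / L t) \<longlongrightarrow> 1) at_top" using lim by (simp add: L_def)
  have L: "filterlim L at_top at_top"
    unfolding L_def by (rule filterlim_compose[OF ln_at_top log_max_at_top[OF h]])
  \<comment> \<open>An eighth of \<open>\<eta>\<close> pays for the two comparisons of
    \<open>U\<close> with \<open>L\<close> and for the drop of \<open>1 / U\<close>.\<close>
  define \<epsilon> where "\<epsilon> = \<eta> / 8"
  have \<epsilon>: "0 < \<epsilon>" "\<epsilon> \<le> 1 / 8" using \<eta> by (auto simp: \<epsilon>_def)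
  from U[OF \<epsilon>(1)] obtain t0 where t0: "t0 \<ge> 1" "\<And>a b. a \<ge> t0 \<Longrightarrow> b \<ge> a \<Longrightarrow> 1 / U a - \<epsilon> / a \<le> 1 / U b - \<epsilon> / b"
    by blast
  have "\<forall>\<^sub>F t in at_top. U t / L t < 1 + \<epsilon> \<and> 1 - \<epsilon> < U t / L t \<and> L t > 0"
    using order_tendstoD[OF limL] \<epsilon> filterlim_at_top_dense[THEN iffD1, OF L, rule_format, of 0]
    by (intro eventually_conj) auto
  then obtain t1 where t1: "\<And>t. t \<ge> t1 \<Longrightarrow> U t / L t < 1 + \<epsilon>" "\<And>t. t \<ge> t1 \<Longrightarrow> 1 - \<epsilon> < U t / L t"
    "\<And>t. t \<ge> t1 \<Longrightarrow> L t > 0"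
    unfolding eventually_at_top_linorder by blast
  have "L (t + 1 / L t) \<le> (1 + \<eta>) * L t" if t: "t \<ge> t0" "t \<ge> t1" for t
  proof -
    define d where "d = 1 / L t"
    have Lt: "L t > 0" using t1 t by simp
    then have d: "d > 0" by (simp add: d_def)
    have td: "t + d \<ge> t" "t + d \<ge> t0" "t + d \<ge> t1" using t d by auto
    have Ltd: "L (t + d) > 0" using t1 td by simp
    have UL: "U t < (1 + \<epsilon>) * L t" "(1 - \<epsilon>) * L t < U t" "(1 - \<epsilon>) * L (t + d) < U (t + d)"
      using t1(1,2)[of t] t1(2)[of "t + d"] t td Lt Ltd by (simp_all add: pos_divide_less_eq pos_less_divide_eq)
    have Upos: "U t > 0" "U (t + d) > 0"
      using UL(2,3) mult_pos_pos[of "1 - \<epsilon>" "L t"] mult_pos_pos[of "1 - \<epsilon>" "L (t + d)"] \<epsilon> Lt Ltd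
      by linarith+
    have "\<epsilon> / t - \<epsilon> / (t + d) = \<epsilon> * (d / (t * (t + d)))"
      using t t0 d by (simp add: field_simps)
    also have "\<dots> \<le> \<epsilon> * (d / 1)"
      using t t0 d \<epsilon> mult_mono[of 1 t 1 "t + d"] by (intro mult_left_mono divide_left_mono) auto
    finally have "\<epsilon> / t - \<epsilon> / (t + d) \<le> \<epsilon> * d" by simp
    moreover have "1 / U t - \<epsilon> / t \<le> 1 / U (t + d) - \<epsilon> / (t + d)"
      using t0(2)[of t "t + d"] t td by simp
    ultimately have *: "1 / U t - \<epsilon> * d \<le> 1 / U (t + d)" by linarith
    have "d * U t \<le> 1 + \<epsilon>" using UL(1) Lt by (simp add: d_def field_simps)
    then have "\<epsilon> * (d * U t) \<le> \<epsilon> * (1 + \<epsilon>)" using \<epsilon> by (intro mult_left_mono) auto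
    then have "1 - \<epsilon> * (1 + \<epsilon>) \<le> (1 / U t - \<epsilon> * d) * U t"
      using Upos by (simp add: left_diff_distrib mult.assoc)
    also have "\<dots> \<le> 1 / U (t + d) * U t" using * Upos by (intro mult_right_mono) auto
    finally have "(1 - \<epsilon> * (1 + \<epsilon>)) * U (t + d) \<le> U t"
      using Upos by (simp add: pos_le_divide_eq)
    moreover have c: "1 - \<epsilon> * (1 + \<epsilon>) > 0"
      using \<epsilon> mult_mono[of \<epsilon> "1/8" "1 + \<epsilon>" 2] by auto
    then have "(1 - \<epsilon> * (1 + \<epsilon>)) * ((1 - \<epsilon>) * L (t + d)) \<le> (1 - \<epsilon> * (1 + \<epsilon>)) * U (t + d)"
      using UL(3) by (intro mult_left_mono) auto
    ultimately have A: "(1 - \<epsilon> * (1 + \<epsilon>)) * (1 - \<epsilon>) * L (t + d) \<le> (1 + \<epsilon>) * L t"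
      using UL(1) by (simp add: mult.assoc)
    have "1 - 2 * \<epsilon> \<le> (1 - \<epsilon> * (1 + \<epsilon>)) * (1 - \<epsilon>)"
    proof -
      have "(1 - \<epsilon> * (1 + \<epsilon>)) * (1 - \<epsilon>) = 1 - 2 * \<epsilon> + \<epsilon> ^ 3"
        by (simp add: algebra_simps power3_eq_cube)
      moreover have "\<epsilon> ^ 3 \<ge> 0" using \<epsilon> by simp
      ultimately show ?thesis by linarith
    qed
    then have "(1 - 2 * \<epsilon>) * L (t + d) \<le> (1 + \<epsilon>) * L t"
      by (rule order_trans[OF mult_right_mono A]) (use Ltd in simp)
    moreover have "(1 + \<epsilon>) * L t \<le> ((1 + \<eta>) * (1 - 2 * \<epsilon>)) * L t"
    proof (rule mult_right_mono)
      have "\<epsilon> * \<eta> \<le> \<epsilon> * 1" using \<epsilon> \<eta> by (intro mult_left_mono) auto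
      moreover have "\<eta> = 8 * \<epsilon>" by (simp add: \<epsilon>_def)
      moreover have "(1 + \<eta>) * (1 - 2 * \<epsilon>) = 1 + \<eta> - 2 * \<epsilon> - 2 * (\<epsilon> * \<eta>)"
        by (simp add: algebra_simps)
      ultimately show "1 + \<epsilon> \<le> (1 + \<eta>) * (1 - 2 * \<epsilon>)"
        using \<epsilon> by linarith
    qed (use Lt in simp)
    ultimately have "(1 - 2 * \<epsilon>) * L (t + d) \<le> (1 - 2 * \<epsilon>) * ((1 + \<eta>) * L t)"
      by (simp add: mult_ac)
    then show ?thesis using \<epsilon> by (simp add: d_def)
  qed
  then show ?thesis
    unfolding eventually_at_top_linorder L_def by (intro exI[of _ "max t0 t1"]) auto
qed

section \<open>Infinite order: the induction step\<close>

text \<open>The counterpart of \<open>finite_order_bound\<close>: increments are replaced by the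
  whole \<open>log_max\<close>, and \<open>\<epsilon>\<close> absorbs logarithmic factors and the
  growth over short steps.\<close>

definition power_bound :: "(nat \<Rightarrow> complex \<Rightarrow> complex) \<Rightarrow> nat \<Rightarrow> bool" where
  "power_bound f m \<longleftrightarrow> (\<forall>\<epsilon>>0. \<exists>C\<ge>0. \<exists>t0. \<forall>k\<ge>1. \<forall>t\<ge>t0.
     slope_bound f m k t (C * (real k powr (real m + 1 + \<epsilon>) + real k * log_max (f m) t powr (1 + \<epsilon>))))"

text \<open>The input of the step from \<open>m\<close> to \<open>m + 1\<close>: on the relevant
  range of \<open>k\<close>, the coefficients grow more slowly than
  \<open>log_max (f (Suc m)) t\<close> by a power. The saving \<open>\<sigma>\<close> beats the
  logarithmic losses of the step.\<close>

definition step_bound :: "(nat \<Rightarrow> complex \<Rightarrow> complex) \<Rightarrow> nat \<Rightarrow> bool" where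
  "step_bound f m \<longleftrightarrow> (\<forall>\<epsilon>>0. \<exists>C\<ge>0. \<exists>\<sigma>>0. \<exists>t0. \<forall>k\<ge>1. \<forall>t\<ge>t0.
     real k powr (real m + 1 + \<epsilon>) \<le> log_max (f (Suc m)) t \<longrightarrow>
     slope_bound f m k (t + 1) (C * log_max (f (Suc m)) t powr (1 - \<sigma>)))"

text \<open>The constant and the fourth power come from \<open>power_bound_Suc\<close>: with
  \<open>d = 1 / (3 * ln x)\<close> the available gain is \<open>d ^ 3 / 32 * x / t\<close>, and
  \<open>t \<le> ln x\<close> there.\<close>

lemma eventually_ln_plus_powr_le:
  assumes "\<sigma> > (0::real)"
  shows "\<forall>\<^sub>F x in at_top. ln (8 * x) + C * x powr (1 - \<sigma>) \<le> x / (864 * ln x ^ 4)"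
proof -
  have "((\<lambda>x. (ln (8 * x) + C * x powr (1 - \<sigma>)) * (864 * ln x ^ 4) / x) \<longlongrightarrow> 0) at_top"
  proof -
    have 1: "((\<lambda>x::real. ln (8 * x) * (864 * ln x ^ 4) / x) \<longlongrightarrow> 0) at_top"
      by real_asymp
    have 2: "((\<lambda>x. x powr (1 - \<sigma>) * (864 * ln x ^ 4) / x) \<longlongrightarrow> 0) at_top"
      using assms by real_asymp
    show ?thesis
      using tendsto_add[OF 1 tendsto_mult_left[OF 2, of C]]
      by (simp add: distrib_right add_divide_distrib mult.assoc)
  qed
  then have "\<forall>\<^sub>F x in at_top. (ln (8 * x) + C * x powr (1 - \<sigma>)) * (864 * ln x ^ 4) / x < 1"
    by (rule order_tendstoD) simp
  then show ?thesis
    using eventually_gt_at_top[of 1]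
  proof eventually_elim
    case (elim x)
    then have "ln x ^ 4 > 0" by simp
    with elim show ?case by (simp add: pos_le_divide_eq pos_divide_less_eq)
  qed
qed

lemma eventually_ln_le_powr:
  assumes "\<sigma> > (0::real)"
  shows "\<forall>\<^sub>F x in at_top. ln x \<le> x powr \<sigma>"
proof -
  have "((\<lambda>x. ln x / x powr \<sigma>) \<longlongrightarrow> 0) at_top"
    using assms by real_asymp
  then have "\<forall>\<^sub>F x in at_top. ln x / x powr \<sigma> < 1"
    by (rule order_tendstoD) simp
  then show ?thesis
    using eventually_gt_at_top[of 1]
    by eventually_elim (simp add: pos_divide_less_eq)
qed

text \<open>The coefficients are polynomials of slope at most \<open>k\<close>, and
  \<open>k powr (1 + \<epsilon>)\<close> below the logarithmic maximum is already a power
  saving.\<close>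

lemma step_bound_0:
  "step_bound f 0"
  unfolding step_bound_def
proof (intro allI impI)
  fix \<epsilon> :: real assume \<epsilon>: "\<epsilon> > 0"
  define \<sigma> where "\<sigma> = \<epsilon> / (1 + \<epsilon>)"
  have \<sigma>: "\<sigma> > 0" "1 - \<sigma> = 1 / (1 + \<epsilon>)" using \<epsilon> by (simp_all add: \<sigma>_def field_simps)
  have "slope_bound f 0 k (t + 1) (1 * log_max (f (Suc 0)) t powr (1 - \<sigma>))"
    if k: "k \<ge> 1" and le: "real k powr (real 0 + 1 + \<epsilon>) \<le> log_max (f (Suc 0)) t" for k t
  proof -
    have "real k = (real k powr (1 + \<epsilon>)) powr (1 - \<sigma>)"
      unfolding \<sigma>(2) using \<epsilon> k by (simp add: powr_powr)
    also have "\<dots> \<le> log_max (f (Suc 0)) t powr (1 - \<sigma>)"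
      using le \<epsilon> by (intro powr_mono2) (auto simp: \<sigma>(2))
    finally show ?thesis
      using slope_bound_mono[of 0 f k "t + 1" "real k" "t + 1"] slope_bound_polynomials by simp
  qed
  then show "\<exists>C\<ge>0. \<exists>\<sigma>>0. \<exists>t0. \<forall>k\<ge>1. \<forall>t\<ge>t0. real k powr (real 0 + 1 + \<epsilon>) \<le> log_max (f (Suc 0)) t \<longrightarrow>
     slope_bound f 0 k (t + 1) (C * log_max (f (Suc 0)) t powr (1 - \<sigma>))"
    using \<sigma>(1) by (intro exI[of _ 1] conjI exI[of _ \<sigma>]) auto
qed

text \<open>This serves the passage from finite to infinite order. An increment is at most the whole
  \<open>log_max\<close>, which is eventually positive.\<close>

lemma power_bound_of_finite_order_bound:
  assumes f: "\<And>j. j \<in> {1..m} \<Longrightarrow> entire_nonpolynomial (f j)" and m: "m \<ge> 1"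
    and fin: "finite_order_bound f m (log_max_increment (f m))"
  shows "power_bound f m"
  unfolding power_bound_def
proof (intro allI impI)
  fix \<epsilon> :: real assume \<epsilon>: "\<epsilon> > 0"
  have hnp: "entire_nonpolynomial (f m)" using f m by simp
  have hol: "\<And>j. j \<in> {1..m} \<Longrightarrow> f j holomorphic_on UNIV"
    using f entire_nonpolynomial_holomorphic by blast
  obtain C t0 where C: "C \<ge> 0" and sb: "\<And>k t. k \<ge> 1 \<Longrightarrow> t \<ge> t0 \<Longrightarrow>
      slope_bound f m k t (C * (real k ^ (m + 1) + real k * log_max_increment (f m) t))"
    using fin unfolding finite_order_bound_def by blast
  have "\<forall>\<^sub>F t in at_top. 1 \<le> log_max (f m) t"
    using log_max_at_top[OF hnp] by (simp add: filterlim_at_top)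
  then obtain t1 where t1: "\<And>t. t \<ge> t1 \<Longrightarrow> 1 \<le> log_max (f m) t"
    unfolding eventually_at_top_linorder by blast
  have "slope_bound f m k t (C * (real k powr (real m + 1 + \<epsilon>) + real k * log_max (f m) t powr (1 + \<epsilon>)))"
    if k: "k \<ge> 1" and t: "t \<ge> max t0 (t1 + 1)" for k t
  proof (rule slope_bound_mono[OF hol sb[OF k]])
    have tt: "t \<ge> t0" "t \<ge> t1" "t - 1 \<ge> t1" using t by auto
    show "t \<ge> t0" by fact
    have "log_max_increment (f m) t \<le> log_max (f m) t powr 1"
      using t1[OF tt(2)] t1[OF tt(3)] by (simp add: log_max_increment_def)
    also have "\<dots> \<le> log_max (f m) t powr (1 + \<epsilon>)"
      using \<epsilon> t1[OF tt(2)] by (intro powr_mono) auto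
    finally have 1: "log_max_increment (f m) t \<le> log_max (f m) t powr (1 + \<epsilon>)" .
    have "real k ^ (m + 1) = real k powr (real m + 1)"
      using k powr_realpow[of "real k" "m + 1"] by (simp add: add.commute)
    also have "\<dots> \<le> real k powr (real m + 1 + \<epsilon>)"
      using \<epsilon> k by (intro powr_mono) auto
    finally show "C * (real k ^ (m + 1) + real k * log_max_increment (f m) t)
      \<le> C * (real k powr (real m + 1 + \<epsilon>) + real k * log_max (f m) t powr (1 + \<epsilon>))"
      using C 1 by (intro mult_left_mono add_mono) auto
  qed auto
  then show "\<exists>C\<ge>0. \<exists>t0. \<forall>k\<ge>1. \<forall>t\<ge>t0. slope_bound f m k t
      (C * (real k powr (real m + 1 + \<epsilon>) + real k * log_max (f m) t powr (1 + \<epsilon>)))"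
    using C by blast
qed

text \<open>With \<open>x = log_max (f (Suc m)) t\<close>, the degree is at most
  \<open>x powr (1 / 2)\<close> since \<open>e \<ge> 2\<close>, and the gap bounds
  \<open>log_max (f m) (t + 1)\<close> by \<open>x powr \<theta>\<close>. As
  \<open>\<theta> < 1 / 2\<close>, the product is a power of \<open>x\<close> with exponent below
  one; this is where the one half of the hypothesis enters.\<close>

lemma step_bound_of_power_bound:
  assumes f: "\<And>j. j \<in> {1..Suc m} \<Longrightarrow> entire_nonpolynomial (f j)" and m: "m \<ge> 1"
    and pb: "power_bound f m" and \<theta>: "0 \<le> \<theta>" "\<theta> < 1 / 2"
    and gap: "\<forall>\<^sub>F t in at_top. ln (log_max (f m) t) \<le> \<theta> * ln (log_max (f (Suc m)) (t - 1))"
  shows "step_bound f m"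
  unfolding step_bound_def
proof (intro allI impI)
  fix \<epsilon> :: real assume \<epsilon>: "\<epsilon> > 0"
  define \<epsilon>' where "\<epsilon>' = min (\<epsilon> / 2) (1 / 2 - \<theta>)"
  have \<epsilon>': "0 < \<epsilon>'" "\<epsilon>' < \<epsilon>" "\<epsilon>' \<le> 1 / 2 - \<theta>" using \<epsilon> \<theta> by (auto simp: \<epsilon>'_def min_def)
  define e where "e = real m + 1 + \<epsilon>"
  have e: "e \<ge> 2" using m \<epsilon> by (simp add: e_def)
  define a where "a = (real m + 1 + \<epsilon>') / e"
  have a: "a < 1" using \<epsilon>' e by (simp add: a_def e_def)
  define b where "b = 1 / 2 + \<theta> * (1 + \<epsilon>')"
  have b: "b < 1"
  proof -
    have "\<theta> * \<epsilon>' \<le> 1 / 2 * \<epsilon>'" using \<theta> \<epsilon>' by (intro mult_right_mono) auto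
    then have "\<theta> * (1 + \<epsilon>') \<le> \<theta> + (1 / 2) * (1 / 2 - \<theta>)"
      using \<epsilon>'(3) by (simp add: distrib_left)
    then show ?thesis unfolding b_def using \<theta> by argo
  qed
  define \<sigma> where "\<sigma> = min (1 - a) (1 - b)"
  have \<sigma>: "\<sigma> > 0" "a \<le> 1 - \<sigma>" "b \<le> 1 - \<sigma>" using a b by (auto simp: \<sigma>_def)
  have hol: "\<And>j. j \<in> {1..m} \<Longrightarrow> f j holomorphic_on UNIV"
    using f entire_nonpolynomial_holomorphic by force
  have np: "entire_nonpolynomial (f m)" "entire_nonpolynomial (f (Suc m))" using f m by auto
  obtain C t0 where C: "C \<ge> 0" and sb: "\<And>k t. k \<ge> 1 \<Longrightarrow> t \<ge> t0 \<Longrightarrow>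
      slope_bound f m k t (C * (real k powr (real m + 1 + \<epsilon>') + real k * log_max (f m) t powr (1 + \<epsilon>')))"
    using pb[unfolded power_bound_def, rule_format, OF \<epsilon>'(1)] by blast
  have "\<forall>\<^sub>F t in at_top. 1 \<le> log_max (f m) t \<and> 1 \<le> log_max (f (Suc m)) t \<and>
      ln (log_max (f m) t) \<le> \<theta> * ln (log_max (f (Suc m)) (t - 1))"
    using log_max_at_top[OF np(1)] log_max_at_top[OF np(2)] gap by (simp add: filterlim_at_top eventually_conj)
  then obtain t1 where t1: "\<And>t. t \<ge> t1 \<Longrightarrow> 1 \<le> log_max (f m) t" "\<And>t. t \<ge> t1 \<Longrightarrow> 1 \<le> log_max (f (Suc m)) t"
    "\<And>t. t \<ge> t1 \<Longrightarrow> ln (log_max (f m) t) \<le> \<theta> * ln (log_max (f (Suc m)) (t - 1))"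
    unfolding eventually_at_top_linorder by blast
  have "slope_bound f m k (t + 1) (2 * C * log_max (f (Suc m)) t powr (1 - \<sigma>))"
    if k: "k \<ge> 1" and t: "t \<ge> max t0 t1" and le: "real k powr (real m + 1 + \<epsilon>) \<le> log_max (f (Suc m)) t" for k t
  proof (rule slope_bound_mono[OF hol sb[OF k, of "t + 1"]])
    define x where "x = log_max (f (Suc m)) t"
    define y where "y = log_max (f m) (t + 1)"
    have tt: "t \<ge> t0" "t \<ge> t1" "t + 1 \<ge> t1" using t by auto
    have x: "x \<ge> 1" using t1(2)[OF tt(2)] by (simp add: x_def)
    have y: "y \<ge> 1" "ln y \<le> \<theta> * ln x" using t1(1,3)[OF tt(3)] by (simp_all add: x_def y_def)
    have kx: "real k powr e \<le> x" using le by (simp add: x_def e_def)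
    have "y = exp (ln y)" using y by simp
    also have "\<dots> \<le> exp (\<theta> * ln x)" using y(2) by simp
    also have "\<dots> = x powr \<theta>" using x by (simp add: powr_def)
    finally have yx: "y \<le> x powr \<theta>" .
    have "real k powr (real m + 1 + \<epsilon>') = (real k powr e) powr a"
      using e by (simp add: powr_powr a_def)
    also have "\<dots> \<le> x powr a"
      using kx \<epsilon>' e by (intro powr_mono2) (auto simp: a_def)
    also have "\<dots> \<le> x powr (1 - \<sigma>)" using x \<sigma> by (intro powr_mono) auto
    finally have 1: "real k powr (real m + 1 + \<epsilon>') \<le> x powr (1 - \<sigma>)" .
    have "real k = (real k powr e) powr (1 / e)"
      using e k by (simp add: powr_powr)
    also have "\<dots> \<le> x powr (1 / e)"
      using kx e by (intro powr_mono2) auto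
    also have "\<dots> \<le> x powr (1 / 2)"
      using x e by (intro powr_mono) auto
    finally have kx2: "real k \<le> x powr (1 / 2)" .
    have "y powr (1 + \<epsilon>') \<le> (x powr \<theta>) powr (1 + \<epsilon>')"
      using yx y \<epsilon>' by (intro powr_mono2) auto
    also have "\<dots> = x powr (\<theta> * (1 + \<epsilon>'))" by (simp add: powr_powr)
    finally have "real k * y powr (1 + \<epsilon>') \<le> x powr (1 / 2) * x powr (\<theta> * (1 + \<epsilon>'))"
      using kx2 by (intro mult_mono) auto
    also have "\<dots> = x powr b" by (simp add: b_def powr_add)
    also have "\<dots> \<le> x powr (1 - \<sigma>)" using x \<sigma> by (intro powr_mono) auto
    finally have 2: "real k * y powr (1 + \<epsilon>') \<le> x powr (1 - \<sigma>)" .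
    have "C * (real k powr (real m + 1 + \<epsilon>') + real k * y powr (1 + \<epsilon>')) \<le> C * (x powr (1 - \<sigma>) + x powr (1 - \<sigma>))"
      using C 1 2 by (intro mult_left_mono add_mono) auto
    then show "C * (real k powr (real m + 1 + \<epsilon>') + real k * log_max (f m) (t + 1) powr (1 + \<epsilon>'))
      \<le> 2 * C * log_max (f (Suc m)) t powr (1 - \<sigma>)"
      by (simp add: x_def y_def)
    show "t0 \<le> t + 1" using tt by simp
  qed auto
  then show "\<exists>C\<ge>0. \<exists>\<sigma>>0. \<exists>t0. \<forall>k\<ge>1. \<forall>t\<ge>t0. real k powr (real m + 1 + \<epsilon>) \<le> log_max (f (Suc m)) t \<longrightarrow>
     slope_bound f m k (t + 1) (C * log_max (f (Suc m)) t powr (1 - \<sigma>))"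
    using \<sigma>(1) C by (intro exI[of _ "2 * C"] conjI exI[of _ \<sigma>] exI[of _ "max t0 t1"]) auto
qed

text \<open>The step length is \<open>d = 1 / (3 * L t)\<close>, so that up to
  \<open>t + 3 * d\<close> the growth of \<open>\<phi>\<close> stays within the power
  \<open>1 + \<epsilon>\<close>. Convexity and \<open>t \<le> L t\<close> make the increment over
  one step smaller than \<open>\<phi> t\<close> only by powers of \<open>L t\<close>, whereas the
  coefficients grow at most like \<open>\<phi> t powr (1 - \<sigma>)\<close>.\<close>

lemma power_bound_Suc:
  assumes f: "\<And>j. j \<in> {1..Suc m} \<Longrightarrow> entire_nonpolynomial (f j)"
    and II: "class_II (f (Suc m))" and step: "step_bound f m"
  shows "power_bound f (Suc m)"
  unfolding power_bound_def
proof (intro allI impI)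
  fix \<epsilon>' :: real assume \<epsilon>': "\<epsilon>' > 0"
  define h where "h = f (Suc m)"
  define \<phi> where "\<phi> = log_max h"
  define L where "L = (\<lambda>t. ln (\<phi> t))"
  have hnp: "entire_nonpolynomial h" using f by (simp add: h_def)
  have hII: "class_II h" using II by (simp add: h_def)
  obtain z0 where z0: "h z0 \<noteq> 0" using entire_nonpolynomial_nonzero[OF hnp] by blast
  have hol: "\<And>j. j \<in> {1..Suc m} \<Longrightarrow> f j holomorphic_on UNIV"
    using f entire_nonpolynomial_holomorphic by blast
  \<comment> \<open>Small enough that the multiples of \<open>\<epsilon>\<close> collected in the
    final exponent stay within \<open>\<epsilon>'\<close>.\<close>
  define \<epsilon> where "\<epsilon> = min 1 \<epsilon>' / (3 * real m + 7)"
  have \<epsilon>: "0 < \<epsilon>" "\<epsilon> \<le> 1" "2 * \<epsilon> \<le> \<epsilon>'" "\<epsilon> * (3 * real m + 7) \<le> \<epsilon>'"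
  proof -
    have 1: "\<epsilon> * (3 * real m + 7) = min 1 \<epsilon>'" by (simp add: \<epsilon>_def)
    show pos: "0 < \<epsilon>" using \<epsilon>' by (simp add: \<epsilon>_def)
    have "\<epsilon> * 7 \<le> \<epsilon> * (3 * real m + 7)" using pos by (intro mult_left_mono) auto
    then show "\<epsilon> \<le> 1" "2 * \<epsilon> \<le> \<epsilon>'" "\<epsilon> * (3 * real m + 7) \<le> \<epsilon>'"
      using 1 pos by auto
  qed
  define e where "e = real m + 1 + \<epsilon>"
  have e: "e \<ge> 1" using \<epsilon> by (simp add: e_def)
  \<comment> \<open>The final exponent: one factor \<open>k\<close> times
    \<open>\<phi> = k powr e\<close> raised to \<open>1 + 2 * \<epsilon>\<close>.\<close>
  have exps: "1 + e * (1 + 2 * \<epsilon>) \<le> real (Suc m) + 1 + \<epsilon>'"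
  proof -
    have "\<epsilon> * \<epsilon> \<le> \<epsilon> * 1" using \<epsilon> by (intro mult_left_mono) auto
    moreover have "1 + e * (1 + 2 * \<epsilon>) = real (Suc m) + 1 + \<epsilon> * (2 * real m + 3) + 2 * (\<epsilon> * \<epsilon>)"
      by (simp add: e_def algebra_simps)
    moreover have "\<epsilon> * (2 * real m + 3) + 2 * \<epsilon> \<le> \<epsilon> * (3 * real m + 7)"
      using mult_left_mono[of "2 * real m + 5" "3 * real m + 7" \<epsilon>] \<epsilon> by (simp add: distrib_left)
    ultimately show ?thesis using \<epsilon>(4) by linarith
  qed
  obtain C \<sigma> t0 where C: "C \<ge> 0" and \<sigma>: "\<sigma> > 0"
    and sb: "\<And>k t. k \<ge> 1 \<Longrightarrow> t \<ge> t0 \<Longrightarrow> real k powr e \<le> \<phi> t \<Longrightarrow>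
      slope_bound f m k (t + 1) (C * \<phi> t powr (1 - \<sigma>))"
    using step[unfolded step_bound_def, rule_format, OF \<epsilon>(1), folded e_def h_def, folded \<phi>_def] by blast
  have top: "filterlim \<phi> at_top at_top" unfolding \<phi>_def by (rule log_max_at_top[OF hnp])
  have "\<forall>\<^sub>F t in at_top. max (exp 1) (2 * \<bar>\<phi> 0\<bar>) \<le> \<phi> t"
    using top unfolding filterlim_at_top by blast
  moreover have "\<forall>\<^sub>F t in at_top. 1 * t \<le> L t"
    unfolding L_def \<phi>_def by (rule class_II_ln_superlinear[OF hnp hII])
  moreover have "\<forall>\<^sub>F t in at_top. L (t + 1 / L t) \<le> (1 + \<epsilon>) * L t"
    unfolding L_def \<phi>_def by (rule class_II_ln_slowly_increasing[OF hnp hII \<epsilon>(1,2)])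
  moreover have "\<forall>\<^sub>F t in at_top. ln (8 * \<phi> t) + C * \<phi> t powr (1 - \<sigma>) \<le> \<phi> t / (864 * ln (\<phi> t) ^ 4)"
    using filterlim_iff[THEN iffD1, OF top, rule_format, OF eventually_ln_plus_powr_le[OF \<sigma>]] .
  moreover have "\<forall>\<^sub>F t in at_top. ln (\<phi> t) \<le> \<phi> t powr \<epsilon>"
    using filterlim_iff[THEN iffD1, OF top, rule_format, OF eventually_ln_le_powr[OF \<epsilon>(1)]] .
  ultimately have "\<forall>\<^sub>F t in at_top. max (exp 1) (2 * \<bar>\<phi> 0\<bar>) \<le> \<phi> t \<and> t \<le> L t \<and>
      L (t + 1 / L t) \<le> (1 + \<epsilon>) * L t \<and>
      ln (8 * \<phi> t) + C * \<phi> t powr (1 - \<sigma>) \<le> \<phi> t / (864 * L t ^ 4) \<and> L t \<le> \<phi> t powr \<epsilon>"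
    by eventually_elim (simp add: L_def)
  then obtain t1 where t1: "\<And>t. t \<ge> t1 \<Longrightarrow> max (exp 1) (2 * \<bar>\<phi> 0\<bar>) \<le> \<phi> t \<and> t \<le> L t \<and>
      L (t + 1 / L t) \<le> (1 + \<epsilon>) * L t \<and>
      ln (8 * \<phi> t) + C * \<phi> t powr (1 - \<sigma>) \<le> \<phi> t / (864 * L t ^ 4) \<and> L t \<le> \<phi> t powr \<epsilon>"
    unfolding eventually_at_top_linorder by blast
  have main: "slope_bound f (Suc m) k t (6 * (real k * \<phi> t powr (1 + 2 * \<epsilon>)))"
    if k: "k \<ge> 1" and t: "t \<ge> max 1 (max t0 t1)" and big: "real k powr e \<le> \<phi> t" for k t
  proof -
    have tt: "t \<ge> 1" "t \<ge> t0" "t \<ge> t1" using t by auto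
    note T = t1[OF tt(3)]
    have x: "\<phi> t \<ge> exp 1" "\<bar>\<phi> 0\<bar> \<le> \<phi> t / 2" "\<phi> t \<ge> 1" "\<phi> t > 0"
    proof -
      show "\<phi> t \<ge> exp 1" "\<bar>\<phi> 0\<bar> \<le> \<phi> t / 2" using T by simp_all
      moreover have "exp 1 \<ge> (1::real)" by simp
      ultimately show "\<phi> t \<ge> 1" "\<phi> t > 0" by linarith+
    qed
    have "ln (exp 1) \<le> L t" unfolding L_def using x(1,4) by (intro ln_mono) auto
    then have L: "L t \<ge> 1" by simp
    define d where "d = 1 / (3 * L t)"
    have d: "0 < d" "d \<le> 1" "3 * d = 1 / L t" "3 * d \<le> 1" using L by (auto simp: d_def)
    define \<Lambda> where "\<Lambda> = C * \<phi> t powr (1 - \<sigma>)"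
    have \<Lambda>: "\<Lambda> \<ge> 0" using C by (simp add: \<Lambda>_def)
    have k1: "real k \<ge> 1" using k by simp
    have kx: "real k \<le> \<phi> t"
    proof -
      have "real k powr 1 \<le> real k powr e" using k1 e by (intro powr_mono) auto
      then show ?thesis using big k1 by simp
    qed
    have mono\<phi>: "\<phi> a \<le> \<phi> b" if "a \<le> b" for a b
      unfolding \<phi>_def by (rule mono_log_max_np[OF hnp that])
    \<comment> \<open>The slope over one step is at least the slope from \<open>0\<close> to
      \<open>t\<close>, and at least half of \<open>\<phi> t\<close> remains after subtracting
      \<open>\<phi> 0\<close>.\<close>
    have inc: "d * \<phi> t / (2 * t) \<le> \<phi> (t + d) - \<phi> t"
    proof -
      have "(\<phi> t - \<phi> 0) * (t + d - t) \<le> (\<phi> (t + d) - \<phi> t) * (t - 0)"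
        unfolding \<phi>_def using d tt by (intro convex_on_increments[OF convex_log_max_np[OF hnp]]) auto
      moreover have "\<phi> t / 2 * d \<le> (\<phi> t - \<phi> 0) * d"
        using x(2) d by (intro mult_right_mono) auto
      ultimately have "\<phi> t * d / 2 \<le> (\<phi> (t + d) - \<phi> t) * t" by simp
      then have "\<phi> t * d / 2 / t \<le> \<phi> (t + d) - \<phi> t" using tt by (subst pos_divide_le_eq) auto
      then show ?thesis by (simp add: mult.commute)
    qed
    have "ln (4 * (real k + 1)) + 3 * d * \<Lambda> \<le> ln (8 * \<phi> t) + \<Lambda>"
    proof (rule add_mono)
      have "4 * (real k + 1) \<le> 8 * real k" using k1 by simp
      also have "\<dots> \<le> 8 * \<phi> t" using kx by simp
      finally have "4 * (real k + 1) \<le> 8 * \<phi> t" .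
      then show "ln (4 * (real k + 1)) \<le> ln (8 * \<phi> t)" by (intro ln_mono) auto
      show "3 * d * \<Lambda> \<le> \<Lambda>" using mult_right_mono[OF d(4) \<Lambda>] by simp
    qed
    also have "\<dots> \<le> \<phi> t / (864 * L t ^ 4)" using T by (simp add: \<Lambda>_def)
    also have "\<dots> = d\<^sup>2 / 16 * (d * \<phi> t / (2 * L t))"
      using L by (simp add: d_def power2_eq_square power4_eq_xxxx)
    also have "\<dots> \<le> d\<^sup>2 / 16 * (d * \<phi> t / (2 * t))"
      using T tt d x by (intro mult_left_mono divide_left_mono) auto
    also have "\<dots> \<le> d\<^sup>2 / 16 * (\<phi> (t + d) - \<phi> t)"
      by (intro mult_left_mono inc) auto
    finally have le: "ln (4 * (real k + 1)) + 3 * d * \<Lambda> \<le> d\<^sup>2 / 16 * (\<phi> (t + d) - \<phi> t)" .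
    have "slope_bound f m k (t + 3 * d) \<Lambda>"
    proof (rule slope_bound_mono[of m f])
      show "slope_bound f m k (t + 1) \<Lambda>" unfolding \<Lambda>_def by (rule sb[OF k tt(2) big])
      show "t + 3 * d \<le> t + 1" using d by simp
    qed (use hol in auto)
    from slope_bound_step[OF hol z0[unfolded h_def] d(1,2) this \<Lambda> le[unfolded \<phi>_def h_def]]
    have sb2: "slope_bound f (Suc m) k (t + 2 * d)
        ((ln 3 + 3 * d * \<Lambda> + k * (\<phi> (t + 3 * d) - \<phi> t)) / d)"
      by (simp add: \<phi>_def h_def)
    show ?thesis
    proof (rule slope_bound_mono[OF hol sb2])
      define y where "y = \<phi> (t + 3 * d)"
      have y: "y \<ge> \<phi> t" "y \<ge> \<phi> (t + d)" unfolding y_def using d(1) by (auto intro!: mono\<phi>)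
      have "ln y \<le> (1 + \<epsilon>) * ln (\<phi> t)"
        using T by (simp add: y_def d(3) L_def)
      then have "exp (ln y) \<le> exp ((1 + \<epsilon>) * ln (\<phi> t))" by simp
      then have y2: "y \<le> \<phi> t powr (1 + \<epsilon>)" using x y by (simp add: powr_def)
      have "ln 3 \<le> ln (4 * (real k + 1))" by simp
      then have "ln 3 + 3 * d * \<Lambda> \<le> d\<^sup>2 / 16 * (\<phi> (t + d) - \<phi> t)" using le by linarith
      also have "\<dots> \<le> 1 * (\<phi> (t + d) - \<phi> t)"
        using d mono\<phi>[of t "t + d"] power_le_one[of d 2] by (intro mult_right_mono) auto
      also have "\<dots> \<le> 1 * y" using x y by simp
      also have "\<dots> \<le> k * y" using x y k1 by (intro mult_right_mono) auto
      finally have "ln 3 + 3 * d * \<Lambda> \<le> k * y" .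
      moreover have "k * (y - \<phi> t) \<le> k * y" using x by (intro mult_left_mono) auto
      ultimately have "ln 3 + 3 * d * \<Lambda> + k * (y - \<phi> t) \<le> 2 * (k * y)" by linarith
      then have "(ln 3 + 3 * d * \<Lambda> + k * (y - \<phi> t)) / d \<le> 2 * (k * y) / d"
        using d by (intro divide_right_mono) auto
      \<comment> \<open>Dividing by \<open>d\<close> costs a factor \<open>3 * L t\<close>, which is
        at most \<open>3 * \<phi> t powr \<epsilon>\<close>.\<close>
      also have "\<dots> = 6 * (k * y * L t)" using L by (simp add: d_def)
      also have "\<dots> \<le> 6 * (k * \<phi> t powr (1 + \<epsilon>) * \<phi> t powr \<epsilon>)"
        using y2 T L k1 by (intro mult_left_mono mult_mono) auto
      also have "\<dots> = 6 * (k * \<phi> t powr (1 + 2 * \<epsilon>))"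
      proof -
        have "1 + 2 * \<epsilon> = (1 + \<epsilon>) + \<epsilon>" by simp
        then show ?thesis by (simp only: powr_add mult.assoc)
      qed
      finally show "(ln 3 + 3 * d * \<Lambda> + k * (\<phi> (t + 3 * d) - \<phi> t)) / d \<le> 6 * (real k * \<phi> t powr (1 + 2 * \<epsilon>))"
        by (simp add: y_def)
      show "t \<le> t + 2 * d" using d by simp
    qed auto
  qed
  have "slope_bound f (Suc m) k t
      (6 * (real k powr (real (Suc m) + 1 + \<epsilon>') + real k * \<phi> t powr (1 + \<epsilon>')))"
    if k: "k \<ge> 1" and t: "t \<ge> max 1 (max t0 t1)" for k t
  proof (cases "real k powr e \<le> \<phi> t")
    case True
    have "\<phi> t \<ge> exp 1" using t1[of t] t by simp
    then have "\<phi> t \<ge> 1" using order_trans[of 1 "exp 1" "\<phi> t"] by simp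
    then have "\<phi> t powr (1 + 2 * \<epsilon>) \<le> \<phi> t powr (1 + \<epsilon>')"
      using \<epsilon> by (intro powr_mono) auto
    then have "real k * \<phi> t powr (1 + 2 * \<epsilon>) \<le> real k powr (real (Suc m) + 1 + \<epsilon>') + real k * \<phi> t powr (1 + \<epsilon>')"
      by (intro add_increasing mult_left_mono) auto
    then show ?thesis
      by (intro slope_bound_mono[OF hol main[OF k t True]]) auto
  next
    case False
    then obtain s where s: "s \<ge> t" "\<phi> s = real k powr e"
      using attains_above[of \<phi> t "real k powr e"] continuous_on_log_max[OF hnp] top
      by (auto simp: \<phi>_def)
    have k1: "real k \<ge> 1" using k by simp
    have "real k * \<phi> s powr (1 + 2 * \<epsilon>) = real k powr 1 * real k powr (e * (1 + 2 * \<epsilon>))"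
      using k1 by (simp add: s powr_powr)
    also have "\<dots> = real k powr (1 + e * (1 + 2 * \<epsilon>))"
      by (simp only: powr_add)
    also have "\<dots> \<le> real k powr (real (Suc m) + 1 + \<epsilon>')"
      using exps k1 by (intro powr_mono) auto
    finally have "real k * \<phi> s powr (1 + 2 * \<epsilon>) \<le> real k powr (real (Suc m) + 1 + \<epsilon>') + real k * \<phi> t powr (1 + \<epsilon>')"
      by (intro add_increasing2) auto
    moreover have "slope_bound f (Suc m) k s (6 * (real k * \<phi> s powr (1 + 2 * \<epsilon>)))"
      using t s by (intro main[OF k]) auto
    ultimately show ?thesis
      using slope_bound_mono[OF hol _ s(1)] by simp
  qed
  then show "\<exists>C\<ge>0. \<exists>t0. \<forall>k\<ge>1. \<forall>t\<ge>t0. slope_bound f (Suc m) k t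
      (C * (real k powr (real (Suc m) + 1 + \<epsilon>') + real k * log_max (f (Suc m)) t powr (1 + \<epsilon>')))"
    unfolding \<phi>_def h_def
    by (intro exI[of _ 6] conjI exI[of _ "max 1 (max t0 t1)"] allI impI) auto
qed

section \<open>The Bernstein inequality\<close>

lemma entire_nonpolynomial_of_class_C: "h \<in> class_C \<Longrightarrow> entire_nonpolynomial h"
  by (simp add: class_C_def)

lemma class_C_growth_order_infinite:
  assumes "h \<in> class_C" "\<not> growth_order h < \<infinity>"
  shows "class_II h"
  using assms by (auto simp: class_C_def class_I_def)

text \<open>Finite order selects \<open>class_I\<close>, whose condition is a doubling condition on
  increments.\<close>

lemma log_max_increment_doubling:
  assumes h: "h \<in> class_C" "growth_order h < \<infinity>"
  obtains A where "A \<ge> 1"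
    "\<forall>\<^sub>F t in at_top. log_max_increment h (t + 1) \<le> A * log_max_increment h t"
proof -
  note np = entire_nonpolynomial_of_class_C[OF h(1)]
  have phi: "growth_phi h = log_max h"
    using growth_phi_eq_log_max[OF entire_nonpolynomial_holomorphic[OF np]] by auto
  have "class_I h" using h by (auto simp: class_C_def class_II_def)
  then have "Limsup at_top (\<lambda>t. ereal (log_max_increment h (t + 1) / log_max_increment h t)) < \<infinity>"
    by (simp add: class_I_def phi log_max_increment_def)
  then obtain A where A: "Limsup at_top (\<lambda>t. ereal (log_max_increment h (t + 1) / log_max_increment h t)) < ereal A"
    using ereal_dense2 by blast
  have "\<forall>\<^sub>F t in at_top. 0 < log_max_increment h t"
    using filterlim_at_top_dense[THEN iffD1, OF log_max_increment_at_top[OF np]] by blast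
  with Limsup_lessD[OF A] have "\<forall>\<^sub>F t in at_top. log_max_increment h (t + 1) \<le> max 1 A * log_max_increment h t"
  proof eventually_elim
    case (elim t)
    then have "log_max_increment h (t + 1) \<le> A * log_max_increment h t"
      by (simp add: pos_divide_less_eq)
    also have "\<dots> \<le> max 1 A * log_max_increment h t"
      using elim by (intro mult_right_mono) auto
    finally show ?case .
  qed
  then show ?thesis by (intro that[of "max 1 A"]) auto
qed

lemma finite_growth_order_ln_log_max:
  assumes h: "entire_nonpolynomial h" "growth_order h < \<infinity>"
  obtains B where "\<forall>\<^sub>F t in at_top. ln (log_max h t) \<le> B * t"
proof -
  from h(2) obtain B where "growth_order h < ereal B"
    using ereal_dense2 by blast
  then have "\<forall>\<^sub>F r in at_top. ereal (ln (log_max_modulus h r) / ln r) < ereal B"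
    unfolding growth_order_def by (rule Limsup_lessD)
  from filterlim_iff[THEN iffD1, OF exp_at_top, rule_format, OF this]
  have "\<forall>\<^sub>F t in at_top. ln (log_max_modulus h (exp t)) / ln (exp t) < B" by simp
  then have "\<forall>\<^sub>F t in at_top. ln (log_max h t) \<le> B * t"
    using eventually_gt_at_top[of 0]
  proof eventually_elim
    case (elim t)
    then show ?case
      using growth_phi_eq_log_max[OF entire_nonpolynomial_holomorphic[OF h(1)], of t]
      by (simp add: growth_phi_def pos_divide_less_eq)
  qed
  then show ?thesis by (rule that)
qed

text \<open>At the passage from finite to infinite order the gap follows from the growth classes:
  one side is at most linear in \<open>t\<close>, the other superlinear. The value
  \<open>1 / 4\<close> stands for any positive constant below \<open>1 / 2\<close>.\<close>

lemma gap_of_finite_infinite: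
  assumes g: "entire_nonpolynomial g" "growth_order g < \<infinity>"
    and h: "entire_nonpolynomial h" "class_II h"
  shows "\<forall>\<^sub>F t in at_top. ln (log_max g t) \<le> 1 / 4 * ln (log_max h (t - 1))"
proof -
  obtain B where B: "\<forall>\<^sub>F t in at_top. ln (log_max g t) \<le> B * t"
    using finite_growth_order_ln_log_max[OF g] by blast
  have "filterlim (\<lambda>t::real. t - 1) at_top at_top"
    by real_asymp
  from filterlim_iff[THEN iffD1, OF this, rule_format, OF class_II_ln_superlinear[OF h, of "8 * \<bar>B\<bar>"]]
  have "\<forall>\<^sub>F t in at_top. 8 * \<bar>B\<bar> * (t - 1) \<le> ln (log_max h (t - 1))" .
  with B show ?thesis using eventually_ge_at_top[of 2]
  proof eventually_elim
    case (elim t)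
    have "ln (log_max g t) \<le> B * t" using elim by simp
    also have "\<dots> \<le> \<bar>B\<bar> * (2 * (t - 1))"
      using elim by (intro mult_mono) auto
    also have "\<dots> = 1 / 4 * (8 * \<bar>B\<bar> * (t - 1))" by simp
    also have "\<dots> \<le> 1 / 4 * ln (log_max h (t - 1))"
      using elim by (intro mult_left_mono) auto
    finally show ?case .
  qed
qed

text \<open>A number strictly between the upper limit and one half serves as
  \<open>\<theta>\<close>; as it may be negative, its maximum with zero is taken.\<close>

lemma gap_of_Limsup:
  assumes g: "entire_nonpolynomial g" and h: "entire_nonpolynomial h"
    and lim: "Limsup at_top (\<lambda>r. ereal (ln (log_max_modulus g r) / ln (log_max_modulus h (r / exp 1)))) < ereal (1 / 2)"
  obtains \<theta> where "0 \<le> \<theta>" "\<theta> < 1 / 2"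
    "\<forall>\<^sub>F t in at_top. ln (log_max g t) \<le> \<theta> * ln (log_max h (t - 1))"
proof -
  have phi: "log_max_modulus g (exp t) = log_max g t" "log_max_modulus h (exp t) = log_max h t" for t
    using growth_phi_eq_log_max[OF entire_nonpolynomial_holomorphic] g h by (simp_all add: growth_phi_def)
  from lim obtain \<theta> where \<theta>: "Limsup at_top (\<lambda>r. ereal (ln (log_max_modulus g r) / ln (log_max_modulus h (r / exp 1)))) < ereal \<theta>"
    "ereal \<theta> < ereal (1 / 2)"
    using ereal_dense2 by blast
  have "\<forall>\<^sub>F t in at_top. ereal (ln (log_max_modulus g (exp t)) / ln (log_max_modulus h (exp t / exp 1))) < ereal \<theta>"
    using filterlim_iff[THEN iffD1, OF exp_at_top, rule_format, OF Limsup_lessD[OF \<theta>(1)]] .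
  then have 1: "\<forall>\<^sub>F t in at_top. ln (log_max g t) / ln (log_max h (t - 1)) < \<theta>"
    by (simp add: phi flip: exp_diff)
  have "filterlim (\<lambda>t. ln (log_max h (t - 1))) at_top at_top"
  proof (rule filterlim_compose[OF filterlim_compose[OF ln_at_top log_max_at_top[OF h]]])
    show "filterlim (\<lambda>t::real. t - 1) at_top at_top" by real_asymp
  qed
  then have "\<forall>\<^sub>F t in at_top. 0 < ln (log_max h (t - 1))"
    unfolding filterlim_at_top_dense by blast
  with 1 have "\<forall>\<^sub>F t in at_top. ln (log_max g t) \<le> max 0 \<theta> * ln (log_max h (t - 1))"
  proof eventually_elim
    case (elim t)
    then have "ln (log_max g t) \<le> \<theta> * ln (log_max h (t - 1))"
      by (simp add: pos_divide_less_eq)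
    also have "\<dots> \<le> max 0 \<theta> * ln (log_max h (t - 1))"
      using elim by (intro mult_right_mono) auto
    finally show ?case .
  qed
  then show ?thesis using \<theta>(2) by (intro that[of "max 0 \<theta>"]) auto
qed

lemma increment_le_sqrt:
  assumes g: "entire_nonpolynomial g" and h: "entire_nonpolynomial h"
    and lim: "((\<lambda>r. (log_max_modulus g r - log_max_modulus g (r / exp 1)) /
                 sqrt (log_max_modulus h r - log_max_modulus h (r / exp 1))) \<longlongrightarrow> 0) at_top"
  shows "\<forall>\<^sub>F t in at_top. 0 \<le> log_max_increment g t \<and> log_max_increment g t \<le> sqrt (log_max_increment h t)"
proof -
  have phi: "log_max_modulus g (exp t) = log_max g t" "log_max_modulus h (exp t) = log_max h t" for t
    using growth_phi_eq_log_max[OF entire_nonpolynomial_holomorphic] g h by (simp_all add: growth_phi_def)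
  have "((\<lambda>t. log_max_increment g t / sqrt (log_max_increment h t)) \<longlongrightarrow> 0) at_top"
    using filterlim_compose[OF lim exp_at_top] by (simp add: phi log_max_increment_def flip: exp_diff)
  then have "\<forall>\<^sub>F t in at_top. log_max_increment g t / sqrt (log_max_increment h t) < 1"
    by (rule order_tendstoD) simp
  moreover have "\<forall>\<^sub>F t in at_top. 0 < log_max_increment h t"
    using filterlim_at_top_dense[THEN iffD1, OF log_max_increment_at_top[OF h]] by blast
  ultimately show ?thesis
    by eventually_elim (simp add: log_max_increment_nonneg[OF g] pos_divide_less_eq)
qed

section \<open>From slope bounds to the Bernstein inequality\<close>

lemma graph_space_0_const:
  assumes "F \<in> graph_space f m 0"
  obtains c where "F = (\<lambda>_. c)"
  using assms
proof (induction m arbitrary: F thesis)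
  case 0
  then obtain p where "F = poly p" "degree p = 0" by auto
  then obtain a where "F = poly [:a:]" by (metis degree_eq_zeroE)
  then have "F = (\<lambda>_. a)" by auto
  then show ?case by (rule 0)
next
  case (Suc m)
  then obtain g where g: "\<And>i. g i \<in> graph_space f m 0" "F = (\<lambda>z. \<Sum>i\<le>0. g i z * f (Suc m) z ^ i)"
    by auto
  obtain c where "g 0 = (\<lambda>_. c)" using Suc.IH[OF _ g(1)] by blast
  then show ?case using g(2) Suc.prems(1) by simp
qed

text \<open>The radii \<open>r\<close> and \<open>e * r\<close> are the points \<open>ln r\<close>
  and \<open>ln r + 1\<close>, at distance one, so the slope bound is the logarithm of the required
  factor and \<open>exp B\<close> serves as the constant.\<close>

lemma graph_bernsteinI:
  assumes bound: "\<And>t. \<exists>B\<ge>0. \<forall>k\<ge>1. slope_bound f m k t (B * real k powr e k)"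
  shows "graph_bernstein m f (\<lambda>k. real k powr e k)"
  unfolding graph_bernstein_def
proof (intro allI impI)
  fix r :: real assume r: "r > 0"
  obtain B where B: "B \<ge> 0" "\<And>k. k \<ge> 1 \<Longrightarrow> slope_bound f m k (ln r + 1) (B * real k powr e k)"
    using bound by blast
  have "(SUP z\<in>cball 0 (exp 1 * r). norm (eval_poly_at p (graph_point f z)))
      \<le> exp B powr (real (total_deg p) powr e (total_deg p)) *
        (SUP z\<in>cball 0 r. norm (eval_poly_at p (graph_point f z)))" if p: "p \<in> polynomials_on (m + 1)" for p
  proof -
    define k where "k = total_deg p"
    define F where "F = (\<lambda>z. eval_poly_at p (graph_point f z))"
    have F: "F \<in> graph_space f m k"
      unfolding F_def k_def by (rule eval_poly_at_graph_point_in_graph_space[OF p order_refl])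
    have "disc_max F (exp 1 * r) \<le> exp B powr (real k powr e k) * disc_max F r"
    proof (cases "k = 0")
      case True
      \<comment> \<open>For \<open>k = 0\<close> the exponent \<open>0 powr e 0\<close> is zero and
        the factor is one, which suffices for a constant function.\<close>
      then obtain c where c: "F = (\<lambda>_. c)" using F graph_space_0_const by blast
      have "disc_max F (exp 1 * r) \<le> norm c"
        using r by (intro disc_max_leI) (auto simp: c)
      also have "norm c \<le> disc_max F r"
        using norm_le_disc_max[of F 0 r] r by (simp add: c)
      finally show ?thesis using True by simp
    next
      case False
      then have "disc_max F (exp (ln r + 1)) \<le> exp (B * real k powr e k * (ln r + 1 - ln r)) * disc_max F (exp (ln r))"
        by (intro slope_boundD[OF B(2) F]) auto
      then show ?thesis using r by (simp add: exp_add mult.commute powr_def)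
    qed
    then show ?thesis by (simp add: disc_max_def F_def k_def)
  qed
  then show "\<exists>C\<ge>0. \<forall>p\<in>polynomials_on (m + 1).
      (SUP z\<in>cball 0 (exp 1 * r). norm (eval_poly_at p (graph_point f z)))
        \<le> C powr (real (total_deg p) powr e (total_deg p)) *
          (SUP z\<in>cball 0 r. norm (eval_poly_at p (graph_point f z)))"
    by (intro exI[of _ "exp B"]) auto
qed

text \<open>The value \<open>2 / n\<close> is used once the constants \<open>C 1, \<dots>, C n\<close> are absorbed by the factors
  \<open>k powr (1 / i)\<close>.\<close>

lemma diagonal_exponent:
  fixes P :: "nat \<Rightarrow> real \<Rightarrow> real \<Rightarrow> bool" and M :: real
  assumes mono: "\<And>k t t' L L'. P k t L \<Longrightarrow> t' \<le> t \<Longrightarrow> L \<le> L' \<Longrightarrow> P k t' L'"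
    and bound: "\<And>\<epsilon> t. \<epsilon> > 0 \<Longrightarrow> \<exists>C\<ge>0. \<forall>k\<ge>1. P k t (C * real k powr (M + \<epsilon>))"
  obtains \<epsilon> :: "nat \<Rightarrow> real" where "\<And>k. 0 \<le> \<epsilon> k" "decseq \<epsilon>" "\<epsilon> \<longlonglongrightarrow> 0"
    "\<And>t. \<exists>B\<ge>0. \<forall>k\<ge>1. P k t (B * real k powr (M + \<epsilon> k))"
proof -
  have "\<exists>C\<ge>0. \<forall>k\<ge>1. P k (real n) (C * real k powr (M + 1 / real n))" if "n \<ge> 1" for n
    using that by (intro bound) auto
  then obtain C where C: "\<And>n k. n \<ge> 1 \<Longrightarrow> k \<ge> 1 \<Longrightarrow> P k (real n) (C n * real k powr (M + 1 / real n))"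
    by metis
  have "\<forall>\<^sub>F k in sequentially. C n \<le> real k powr (1 / real n)" if "n \<ge> 1" for n
  proof -
    have "filterlim (\<lambda>x::real. x powr (1 / real n)) at_top at_top"
      using that by real_asymp
    then have "filterlim (\<lambda>k. real k powr (1 / real n)) at_top sequentially"
      by (rule filterlim_compose) (rule filterlim_real_sequentially)
    then show ?thesis by (simp add: filterlim_at_top)
  qed
  then have "\<exists>K. \<forall>k\<ge>K. C n \<le> real k powr (1 / real n)" if "n \<ge> 1" for n
    using that unfolding eventually_sequentially by blast
  then obtain K where K: "\<And>n k. n \<ge> 1 \<Longrightarrow> k \<ge> K n \<Longrightarrow> C n \<le> real k powr (1 / real n)"
    by metis
  \<comment> \<open>The indices \<open>n\<close> whose constants, like all earlier ones, are already
    absorbed at \<open>k\<close>. The condition \<open>n \<le> k\<close> keeps the set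
    finite.\<close>
  define S where "S = (\<lambda>k. {n. n \<le> k \<and> (\<forall>i\<in>{1..n}. K i \<le> k)})"
  define N where "N = (\<lambda>k. Max (S k))"
  have S: "finite (S k)" "0 \<in> S k" for k
    by (auto simp: S_def intro: finite_subset[of _ "{..k}"])
  have NS: "N k \<in> S k" for k
    unfolding N_def using S by (intro Max_in) auto
  have N_ge: "n \<le> N k" if "n \<in> S k" for n k
    unfolding N_def using S that by (intro Max_ge) auto
  have N_mono: "N j \<le> N k" if "j \<le> k" for j k
    using NS[of j] that by (intro N_ge) (auto simp: S_def)
  have N_top: "\<exists>k0. \<forall>k\<ge>k0. n \<le> N k" for n
  proof (intro exI allI impI)
    fix k assume k: "k \<ge> max n (Max (insert 0 (K ` {1..n})))"
    then have "K i \<le> k" if "i \<in> {1..n}" for i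
      using that Max_ge[of "insert 0 (K ` {1..n})" "K i"] by auto
    then show "n \<le> N k" using k by (intro N_ge) (auto simp: S_def)
  qed
  define \<epsilon> where "\<epsilon> = (\<lambda>k. 2 / real (max 1 (N k)))"
  show ?thesis
  proof (rule that[of \<epsilon>])
    show "0 \<le> \<epsilon> k" for k by (simp add: \<epsilon>_def)
    show "decseq \<epsilon>"
      unfolding decseq_def \<epsilon>_def
    proof (intro allI impI divide_left_mono)
      fix j k :: nat assume "j \<le> k"
      then show "real (max 1 (N j)) \<le> real (max 1 (N k))" using N_mono[of j k] by simp
    qed auto
    show "\<epsilon> \<longlonglongrightarrow> 0"
    proof -
      have "filterlim (\<lambda>k. max 1 (N k)) at_top sequentially"
        unfolding filterlim_at_top eventually_sequentially
        using N_top by (meson max.coboundedI2)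
      then have "filterlim (\<lambda>k. real (max 1 (N k))) at_top sequentially"
        by (rule filterlim_compose[OF filterlim_real_sequentially])
      then show ?thesis
        unfolding \<epsilon>_def by (intro real_tendsto_divide_at_top[OF tendsto_const])
    qed
    show "\<exists>B\<ge>0. \<forall>k\<ge>1. P k t (B * real k powr (M + \<epsilon> k))" for t
    proof -
      obtain n0 :: nat where n0: "t \<le> real n0" using real_arch_simple by blast
      obtain k0 where k0: "\<And>k. k \<ge> k0 \<Longrightarrow> max 1 n0 \<le> N k" using N_top by blast
      obtain D where D: "D \<ge> 0" "\<And>k. k \<ge> 1 \<Longrightarrow> P k t (D * real k powr (M + 1))"
        using bound[of 1 t] by auto
      \<comment> \<open>The finitely many \<open>k < k0\<close> use the bound with
        \<open>\<epsilon> = 1\<close>, where the surplus factor \<open>k\<close> is at most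
        \<open>k0\<close>.\<close>
      define B where "B = max 1 (D * real k0)"
      have "P k t (B * real k powr (M + \<epsilon> k))" if k: "k \<ge> 1" for k
      proof (cases "k \<ge> k0")
        case True
        define n where "n = N k"
        have n: "n \<ge> 1" "n \<ge> n0" using k0[OF True] by (auto simp: n_def)
        have "K n \<le> k" using NS[of k] n by (auto simp: S_def n_def)
        then have "C n * real k powr (M + 1 / real n) \<le> real k powr (1 / real n) * real k powr (M + 1 / real n)"
          by (intro mult_right_mono K n) auto
        also have "\<dots> = real k powr (M + \<epsilon> k)"
        proof -
          have "1 / real n + (M + 1 / real n) = M + \<epsilon> k"
            using n by (simp add: \<epsilon>_def n_def[symmetric] max_def)
          then show ?thesis by (simp only: powr_add[symmetric])
        qed
        also have "\<dots> \<le> B * real k powr (M + \<epsilon> k)"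
          using mult_right_mono[of 1 B "real k powr (M + \<epsilon> k)"] by (simp add: B_def)
        finally show ?thesis
          by (intro mono[OF C[OF n(1) k]]) (use n n0 in auto)
      next
        case False
        have "real k powr (M + 1) = real k * real k powr M"
          using k by (simp add: powr_add)
        also have "\<dots> \<le> real k0 * real k powr (M + \<epsilon> k)"
          using False k by (intro mult_mono powr_mono) (auto simp: \<epsilon>_def)
        finally have "D * real k powr (M + 1) \<le> D * (real k0 * real k powr (M + \<epsilon> k))"
          using D by (intro mult_left_mono) auto
        also have "\<dots> \<le> B * real k powr (M + \<epsilon> k)"
          unfolding mult.assoc[symmetric] by (intro mult_right_mono) (auto simp: B_def)
        finally show ?thesis
          by (intro mono[OF D(2)[OF k]]) auto
      qed
      moreover have "B \<ge> 0" by (simp add: B_def)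
      ultimately show ?thesis by blast
    qed
  qed
qed

lemma Suc_le_two_power: "real m + 1 \<le> 2 ^ m"
proof -
  have "m + 1 \<le> 2 ^ m" using less_exp[of m] by (simp only: Suc_eq_plus1[symmetric] Suc_le_eq)
  then have "real (m + 1) \<le> real (2 ^ m)" by (simp only: of_nat_le_iff)
  then show ?thesis by simp
qed

text \<open>A slope bound at a large point holds at all smaller ones, so evaluating at
  \<open>max t t0\<close> fixes the constant; \<open>m + 1 \<le> 2 ^ m\<close> supplies the
  exponent.\<close>

lemma slope_bound_powr:
  assumes f: "\<And>j. j \<in> {1..m} \<Longrightarrow> f j holomorphic_on UNIV"
    and sb: "\<And>k t. k \<ge> 1 \<Longrightarrow> t \<ge> t0 \<Longrightarrow> slope_bound f m k t (C * (real k powr (real m + 1 + \<epsilon>) + real k * G t))"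
    and C: "C \<ge> 0" and G: "\<And>t. G t \<ge> 0" and \<epsilon>: "\<epsilon> \<ge> 0"
  shows "\<exists>B\<ge>0. \<forall>k\<ge>1. slope_bound f m k t (B * real k powr (2 ^ m + \<epsilon>))"
proof (intro exI[of _ "C * (1 + G (max t t0))"] conjI allI impI)
  fix k :: nat assume k: "k \<ge> 1"
  have "1 \<le> 2 ^ m + \<epsilon>" using one_le_power[of "2::real" m] \<epsilon> by linarith
  then have "real k powr 1 \<le> real k powr (2 ^ m + \<epsilon>)"
    using k by (intro powr_mono) auto
  then have 1: "real k \<le> real k powr (2 ^ m + \<epsilon>)" using k by simp
  have 2: "real k powr (real m + 1 + \<epsilon>) \<le> real k powr (2 ^ m + \<epsilon>)"
    using k Suc_le_two_power[of m] by (intro powr_mono) auto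
  have "C * (real k powr (real m + 1 + \<epsilon>) + real k * G (max t t0))
      \<le> C * (real k powr (2 ^ m + \<epsilon>) + real k powr (2 ^ m + \<epsilon>) * G (max t t0))"
    using C G 1 2 by (intro mult_left_mono add_mono mult_right_mono) auto
  also have "\<dots> = C * (1 + G (max t t0)) * real k powr (2 ^ m + \<epsilon>)"
    by (simp add: algebra_simps)
  finally show "slope_bound f m k t (C * (1 + G (max t t0)) * real k powr (2 ^ m + \<epsilon>))"
    by (intro slope_bound_mono[OF f sb[OF k, of "max t t0"]]) auto
qed (use C G in auto)

theorem theorem1p8:
  fixes m :: nat and f :: "nat \<Rightarrow> complex \<Rightarrow> complex"
  assumes "m \<ge> 1"
    and "\<And>j. j \<in> {1..m} \<Longrightarrow> f j \<in> class_C"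
    and "\<And>j. j \<in> {1..<m} \<Longrightarrow> growth_order (f j) \<le> growth_order (f (j + 1))"
    and "\<And>j. j \<in> {1..<m} \<Longrightarrow> growth_order (f (j + 1)) < \<infinity> \<Longrightarrow>
           ((\<lambda>r. (log_max_modulus (f j) r - log_max_modulus (f j) (r / exp 1)) /
                 sqrt (log_max_modulus (f (j + 1)) r - log_max_modulus (f (j + 1)) (r / exp 1)))
             \<longlongrightarrow> 0) at_top"
    and "\<And>j. j \<in> {1..<m} \<Longrightarrow> growth_order (f j) = \<infinity> \<Longrightarrow>
           Limsup at_top (\<lambda>r. ereal (ln (log_max_modulus (f j) r) /
                                      ln (log_max_modulus (f (j + 1)) (r / exp 1)))) < ereal (1 / 2)"
  shows "\<exists>\<epsilon> :: nat \<Rightarrow> real. (\<forall>k. 0 \<le> \<epsilon> k) \<and> decseq \<epsilon> \<and> \<epsilon> \<longlonglongrightarrow> 0 \<and>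
           ((\<forall>j\<in>{1..m}. growth_order (f j) < \<infinity>) \<longrightarrow> (\<forall>k. \<epsilon> k = 0)) \<and>
           graph_bernstein m f (\<lambda>k. real k powr (2 ^ m + \<epsilon> k))"
proof -
  have np: "entire_nonpolynomial (f j)" if "j \<in> {1..m}" for j
    using assms(2)[OF that] by (rule entire_nonpolynomial_of_class_C)
  have hol: "f j holomorphic_on UNIV" if "j \<in> {1..m}" for j
    using np[OF that] by (rule entire_nonpolynomial_holomorphic)
  \<comment> \<open>The orders increase, so a finite order at \<open>Suc j\<close> makes all earlier
    ones finite and the induction stays within finite order.\<close>
  have finite_case: "finite_order_bound f (Suc j) (log_max_increment (f (Suc j)))"
    if "Suc j \<le> m" "growth_order (f (Suc j)) < \<infinity>" for j
    using that
  proof (induction j)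
    case 0
    obtain A where A: "A \<ge> 1"
      "\<forall>\<^sub>F t in at_top. log_max_increment (f (Suc 0)) (t + 1) \<le> A * log_max_increment (f (Suc 0)) t"
      using log_max_increment_doubling[of "f (Suc 0)"] assms(2)[of "Suc 0"] 0 by auto
    have npj: "\<And>i. i \<in> {1..Suc 0} \<Longrightarrow> entire_nonpolynomial (f i)"
      using np 0 by auto
    show ?case
      by (rule finite_order_bound_Suc[where m = 0 and f = f, OF npj finite_order_bound_0 A]) auto
  next
    case (Suc j)
    have j: "Suc j \<in> {1..<m}" using Suc.prems by auto
    have "growth_order (f (Suc j)) < \<infinity>"
      by (rule le_less_trans[OF assms(3)[OF j, folded Suc_eq_plus1] Suc.prems(2)])
    then have IH: "finite_order_bound f (Suc j) (log_max_increment (f (Suc j)))"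
      using Suc by simp
    obtain A where A: "A \<ge> 1"
      "\<forall>\<^sub>F t in at_top. log_max_increment (f (Suc (Suc j))) (t + 1) \<le> A * log_max_increment (f (Suc (Suc j))) t"
      using log_max_increment_doubling[of "f (Suc (Suc j))"] assms(2)[of "Suc (Suc j)"] Suc.prems by auto
    have "\<forall>\<^sub>F t in at_top. 0 \<le> log_max_increment (f (Suc j)) t \<and>
        log_max_increment (f (Suc j)) t \<le> sqrt (log_max_increment (f (Suc (Suc j))) t)"
      using assms(4)[OF j] Suc.prems by (intro increment_le_sqrt np) auto
    moreover have npj: "\<And>i. i \<in> {1..Suc (Suc j)} \<Longrightarrow> entire_nonpolynomial (f i)"
      using np Suc.prems by auto
    ultimately show ?case
      by (intro finite_order_bound_Suc[where m = "Suc j" and f = f, OF npj IH A]) auto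
  qed
  \<comment> \<open>The preceding function may have finite or infinite order: the gap comes from the
    growth classes in the first case and from the hypothesis in the second.\<close>
  have infinite_case: "power_bound f (Suc j)"
    if "Suc j \<le> m" "\<not> growth_order (f (Suc j)) < \<infinity>" for j
    using that
  proof (induction j)
    case 0
    have npj: "\<And>i. i \<in> {1..Suc 0} \<Longrightarrow> entire_nonpolynomial (f i)"
      using np 0 by auto
    have II: "class_II (f (Suc 0))"
      using 0 assms(2)[of "Suc 0"] by (intro class_C_growth_order_infinite) auto
    show ?case
      by (rule power_bound_Suc[where m = 0 and f = f, OF npj II step_bound_0])
  next
    case (Suc j)
    have j: "Suc j \<in> {1..<m}" using Suc.prems by auto
    have II: "class_II (f (Suc (Suc j)))"
      using class_C_growth_order_infinite[of "f (Suc (Suc j))"] assms(2)[of "Suc (Suc j)"] Suc.prems by auto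
    have np': "entire_nonpolynomial (f (Suc j))" "entire_nonpolynomial (f (Suc (Suc j)))"
      using np Suc.prems by auto
    have npj: "\<And>i. i \<in> {1..Suc (Suc j)} \<Longrightarrow> entire_nonpolynomial (f i)"
      using np Suc.prems by auto
    have "step_bound f (Suc j)"
    proof (cases "growth_order (f (Suc j)) < \<infinity>")
      case True
      have npj': "\<And>i. i \<in> {1..Suc j} \<Longrightarrow> entire_nonpolynomial (f i)"
        using np Suc.prems by auto
      have pb: "power_bound f (Suc j)"
        by (rule power_bound_of_finite_order_bound[where m = "Suc j" and f = f, OF npj' _ finite_case])
          (use True Suc.prems in auto)
      show ?thesis
        by (rule step_bound_of_power_bound[where m = "Suc j" and f = f, OF npj _ pb _ _
              gap_of_finite_infinite[OF np'(1) True np'(2) II]]) auto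
    next
      case False
      then have pb: "power_bound f (Suc j)" using Suc by simp
      have "growth_order (f (Suc j)) = \<infinity>" using False by auto
      then have lim: "Limsup at_top (\<lambda>r. ereal (ln (log_max_modulus (f (Suc j)) r) /
          ln (log_max_modulus (f (Suc (Suc j))) (r / exp 1)))) < ereal (1 / 2)"
        using assms(5)[OF j] by simp
      obtain \<theta> where "0 \<le> \<theta>" "\<theta> < 1 / 2"
        "\<forall>\<^sub>F t in at_top. ln (log_max (f (Suc j)) t) \<le> \<theta> * ln (log_max (f (Suc (Suc j))) (t - 1))"
        using gap_of_Limsup[OF np' lim] by blast
      then show ?thesis
        by (intro step_bound_of_power_bound[where m = "Suc j" and f = f, OF npj _ pb]) auto
    qed
    then show ?case
      by (intro power_bound_Suc[where m = "Suc j" and f = f, OF npj II])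
  qed
  obtain m' where m': "m = Suc m'" using assms(1) by (cases m) auto
  \<comment> \<open>The last order decides: if it is finite, \<open>\<epsilon> = 0\<close> is
    reached, and otherwise the clause on finite orders is vacuous.\<close>
  show ?thesis
  proof (cases "growth_order (f m) < \<infinity>")
    case True
    then obtain C t0 where C: "C \<ge> 0" and sb: "\<And>k t. k \<ge> 1 \<Longrightarrow> t \<ge> t0 \<Longrightarrow>
        slope_bound f m k t (C * (real k ^ (m + 1) + real k * log_max_increment (f m) t))"
      using finite_case[of m'] m' unfolding finite_order_bound_def by blast
    have "graph_bernstein m f (\<lambda>k. real k powr (2 ^ m + 0))"
    proof (rule graph_bernsteinI, rule slope_bound_powr[OF hol])
      show "slope_bound f m k t (C * (real k powr (real m + 1 + 0) + real k * log_max_increment (f m) t))"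
        if "k \<ge> 1" "t \<ge> t0" for k t
        using sb[OF that] that powr_realpow[of "real k" "m + 1"] by (simp add: add.commute)
      show "0 \<le> log_max_increment (f m) t" for t
        using assms(1) by (intro log_max_increment_nonneg np) auto
    qed (use C in auto)
    then show ?thesis
      by (intro exI[of _ "\<lambda>_. 0"]) (auto simp: decseq_def)
  next
    case False
    then have pb: "power_bound f m" using infinite_case[of m'] m' by simp
    have bound: "\<exists>C\<ge>0. \<forall>k\<ge>1. slope_bound f m k t (C * real k powr (2 ^ m + \<epsilon>))" if \<epsilon>: "\<epsilon> > 0" for \<epsilon> t
    proof -
      obtain C t0 where C: "C \<ge> 0" and sb: "\<And>k t. k \<ge> 1 \<Longrightarrow> t \<ge> t0 \<Longrightarrow>
        slope_bound f m k t (C * (real k powr (real m + 1 + \<epsilon>) + real k * log_max (f m) t powr (1 + \<epsilon>)))"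
        using pb[unfolded power_bound_def, rule_format, OF \<epsilon>] by blast
      show ?thesis
        by (rule slope_bound_powr[OF hol sb C]) (use \<epsilon> in auto)
    qed
    obtain \<epsilon> :: "nat \<Rightarrow> real" where \<epsilon>: "\<And>k. 0 \<le> \<epsilon> k" "decseq \<epsilon>" "\<epsilon> \<longlonglongrightarrow> 0"
      "\<And>t. \<exists>B\<ge>0. \<forall>k\<ge>1. slope_bound f m k t (B * real k powr (2 ^ m + \<epsilon> k))"
    proof (rule diagonal_exponent[of "slope_bound f m" "2 ^ m"])
      show "slope_bound f m k t' L'" if "slope_bound f m k t L" "t' \<le> t" "L \<le> L'" for k t t' L L'
        using hol that by (rule slope_bound_mono)
    qed (use bound in auto)
    have "graph_bernstein m f (\<lambda>k. real k powr (2 ^ m + \<epsilon> k))"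
      using \<epsilon>(4) by (rule graph_bernsteinI)
    moreover have "\<not> (\<forall>j\<in>{1..m}. growth_order (f j) < \<infinity>)" using False assms(1) by auto
    ultimately show ?thesis using \<epsilon>(1-3) by blast
  qed
qed

end
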